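(* Let $\Omega\subset\mathbb{R}^d$ be a nonempty and bounded open set. Then there exists a constant $C_0=C_0(\mathcal{T})>0$ such that, for all integers $L\ge2$ and all $f\in C^k(\mathbb{R}^d)$, $$\|\mathcal{E}_Lf\|_{L^\infty(\Omega)}\le\frac{C_0}{h_0^{r+1}}\bigl(J_{L-1}(\nu,\mu)\bigr)^{L-1}h_L^{r+1}\,|f|_{W^{r+1,k,\infty}_{\delta_0}(B_{S_L}(\Omega))}.$$ If $\Omega$ is a Lipschitz domain and $h_L=\mu^Lh_0<1$, then additionally $$\|\mathcal{E}_Lf\|_{W^{r+1,\infty}(\Omega)}\le\frac{C_0}{h_0^{r+1}}\bigl(J_{L-1}(\nu,\mu)\bigr)^{L-1}\,|f|_{W^{r+1,k,\infty}_{\delta_0}(B_{S_L}(\Omega))}.$$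
   Context: Standing assumptions: $d,k,m\in\mathbb{N}$ and $r\in\mathbb{N}_0$ with $m>k>r$; $\Phi\in C^m(\mathbb{R}^d)$ is non-negative, not identically zero, with compact support in the unit ball; $\pi_r(\mathbb{R}^d)$ is the space of polynomials of degree at most $r$, with a basis $\mathcal{B}=\{p_1,\dots,p_M\}$, $M=\dim\pi_r(\mathbb{R}^d)$. Write $\mathcal{T}=(\Phi,d,m,r,\mathcal{B})$. A constant $C(\mathcal{T})$ (or $C(\mathcal{T},k)$) depends only on the listed quantities. MLS operator: for $h>0$, $\nu>1$, $\delta=\nu h$ let $A(x)\in\mathbb{R}^{M\times M}$ have entries $a_{ij}(x)=\sum_{q\in\mathbb{Z}^d}\Phi\bigl(\frac{x-hq}{\delta}\bigr)p_i\bigl(\frac{x-hq}{\delta}\bigr)p_j\bigl(\frac{x-hq}{\delta}\bigr)$. If $A(x)$ is positive definite for all $x$, put $\lambda(x)=A(x)^{-1}(p_1(0),\dots,p_M(0))^{\rm T}$, $w_\delta(y,x)=\Phi\bigl(\frac{x-y}{\delta}\bigr)\sum_{j=1}^M\lambda_j(x)p_j\bigl(\frac{x-y}{\delta}\bigr)$, $Q_hf(x)=\sum_{q\in\mathbb{Z}^d}w_\delta(hq,x)f(hq)$ and $E_hf=f-Q_hf$. Fix constants $\nu_*=\nu_*(\mathcal{T})>0$ and $\tau_*=\tau_*(\mathcal{T})>0$ such that $\lambda_{\min}(A(x))\ge\tau_*\nu^d$ for all $h>0$, $\nu\ge\nu_*$, $x\in\mathbb{R}^d$ (such constants exist). Multilevel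 scheme: fix $h_0>0$ and $0<\mu<1<\nu$ with $\nu\ge\nu_*$; put $h_j=\mu^jh_0$, $\delta_j=\nu h_j$ for $j\in\mathbb{N}_0$. Define $\mathcal{Q}_0f=0$, $\mathcal{E}_0f=f$ and, for $j\ge1$, $\mathcal{Q}_jf=\mathcal{Q}_{j-1}f+Q_{h_j}\mathcal{E}_{j-1}f$, $\mathcal{E}_jf=\mathcal{E}_{j-1}f-Q_{h_j}\mathcal{E}_{j-1}f$ (so $\mathcal{E}_jf=E_{h_j}\cdots E_{h_1}f$), where $Q_{h_j}$ and $E_{h_j}$ are formed with support radius $\delta_j$. The constants in the claim do not depend on $h_0,\mu,\nu,L,f$. Seminorms: for $\varepsilon>0$ and integers $0\le j\le n$, $|g|_{W^{j,n,\infty}_\varepsilon(\Omega)}=\max_{j\le|\alpha|\le n}\varepsilon^{|\alpha|}\|D^\alpha g\|_{L^\infty(\Omega)}$, and $|g|_{W^{n,\infty}_\varepsilon(\Omega)}=|g|_{W^{n,n,\infty}_\varepsilon(\Omega)}$. $\|\cdot\|_{W^{n,\infty}(\Omega)}$ is the usual Sobolev norm. $B_R(x)$ is the open ball, and $B_R(\Omega)=\{x\in\mathbb{R}^d:\exists y\in\Omega,\ \|x-y\|<R\}$. Further quantities: $S_L=\delta_1+\dots+\delta_L$; $\theta_j=\min\{j(r+1),k-r-1\}$ for $j\ge0$ (so $\theta_0=0$); $\rho=\nu^{k-m}+\mu^{\theta_1}$; and for $L\ge1$ $$J_L(\nu,\mu)=\mathcal{C}\min\Bigl\{\rho,\Bigl(\mu^{\theta_1+\cdots+\theta_L}+\nu^{k-m}\sum_{j=0}^{L-1}\mu^{\theta_0+\cdots+\theta_j}\rho^{L-j-1}\Bigr)^{1/L}\Bigr\}.$$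 Here $\mathcal{C}=\mathcal{C}(\mathcal{T},k)>0$ is a fixed constant (which exists) such that for all $f\in C^k(\mathbb{R}^d)$, $x\in\mathbb{R}^d$, $h>0$, $R>0$, $\nu\ge\nu_*$, $\delta=\nu h$, and $r+1\le n\le k$, $$|E_hf|_{W^{n,\infty}_\delta(B_R(x))}\le\mathcal{C}\bigl(\nu^{n-m}|f|_{W^{r+1,k,\infty}_\delta(B_{R+\delta}(x))}+|f|_{W^{\min\{n+r+1,k\},\infty}_\delta(B_{R+\delta}(x))}\bigr),$$ and for every $\mu\in(0,1]$, $|E_hf|_{W^{r+1,k,\infty}_\delta(B_R(x))}\le\mathcal{C}\bigl(\nu^{k-m}\mu^{r+1}+\mu^{\min\{2r+2,k\}}\bigr)|f|_{W^{r+1,k,\infty}_{\delta/\mu}(B_{R+\delta}(x))}$. *)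

theory Defs
  imports "HOL-Analysis.Analysis" "HOL-Probability.Essential_Supremum"
begin

section \<open>Partial derivatives, smoothness, polynomials\<close>

definition pderiv_dir :: "'n::finite \<Rightarrow> (real^'n \<Rightarrow> real) \<Rightarrow> real^'n \<Rightarrow> real" where
  "pderiv_dir i g x = deriv (\<lambda>t. g (x + t *\<^sub>R axis i 1)) 0"

primrec Ck :: "nat \<Rightarrow> (real^'n::finite \<Rightarrow> real) \<Rightarrow> bool" where
  "Ck 0 g \<longleftrightarrow> continuous_on UNIV g"
| "Ck (Suc n) g \<longleftrightarrow> continuous_on UNIV g \<and>
     (\<forall>i. (\<forall>x. (\<lambda>t. g (x + t *\<^sub>R axis i 1)) differentiable (at 0)) \<and> Ck n (pderiv_dir i g))"

text \<open>Multi-indices are functions \<open>'n \<Rightarrow> nat\<close>.\<close>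

definition mi_abs :: "('n::finite \<Rightarrow> nat) \<Rightarrow> nat" where
  "mi_abs \<alpha> = (\<Sum>i\<in>UNIV. \<alpha> i)"

text \<open>An arbitrary but fixed enumeration of the coordinates, used to order the partial derivatives
  in \<open>D\<^sup>\<alpha>\<close>; for functions of class \<open>C\<^sup>n\<close> and \<open>|\<alpha>| \<le> n\<close> the order is irrelevant.\<close>

definition coords :: "'n::finite list" where
  "coords = (SOME xs. distinct xs \<and> set xs = UNIV)"

lemma distinct_coords: "distinct (coords :: 'n::finite list)"
  and set_coords: "set (coords :: 'n::finite list) = UNIV"
proof -
  have "\<exists>xs :: 'n list. distinct xs \<and> set xs = UNIV"
    using finite_distinct_list[of "UNIV :: 'n set"] by auto
  then have "distinct (coords :: 'n list) \<and> set (coords :: 'n list) = UNIV"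
    unfolding coords_def by (rule someI_ex)
  then show "distinct (coords :: 'n list)" "set (coords :: 'n list) = UNIV" by auto
qed

definition mi_deriv :: "('n::finite \<Rightarrow> nat) \<Rightarrow> (real^'n \<Rightarrow> real) \<Rightarrow> real^'n \<Rightarrow> real" where
  "mi_deriv \<alpha> g = foldr (\<lambda>i. pderiv_dir i ^^ \<alpha> i) coords g"

definition poly_space :: "nat \<Rightarrow> (real^'n::finite \<Rightarrow> real) set" where
  "poly_space r = {q. \<exists>c. \<forall>x. q x = (\<Sum>\<alpha> | mi_abs \<alpha> \<le> r. c \<alpha> * (\<Prod>i\<in>UNIV. (x $ i) ^ \<alpha> i))}"

text \<open>The basis is indexed by a finite type \<open>'b\<close>; being a basis forces
  \<open>CARD('b)\<close> to be the dimension of the polynomial space.\<close>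

definition poly_basis :: "nat \<Rightarrow> ('b::finite \<Rightarrow> real^'n::finite \<Rightarrow> real) \<Rightarrow> bool" where
  "poly_basis r p \<longleftrightarrow>
     (\<forall>j. p j \<in> poly_space r) \<and>
     (\<forall>c. (\<forall>x. (\<Sum>j\<in>UNIV. c j * p j x) = 0) \<longrightarrow> (\<forall>j. c j = 0)) \<and>
     (\<forall>q\<in>poly_space r. \<exists>c. \<forall>x. q x = (\<Sum>j\<in>UNIV. c j * p j x))"

section \<open>Moving least squares\<close>

definition int_lattice :: "(real^'n::finite) set" where
  "int_lattice = {q. \<forall>i. q $ i \<in> \<int>}"

text \<open>The lattice sums below have only finitely many nonzero terms when \<open>\<Phi>\<close> has
  compact support and \<open>h, \<nu> > 0\<close>, so that the infinite sum is just a finite sum.\<close>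

definition mls_matrix ::
  "(real^'n::finite \<Rightarrow> real) \<Rightarrow> ('b::finite \<Rightarrow> real^'n \<Rightarrow> real) \<Rightarrow> real \<Rightarrow> real \<Rightarrow> real^'n \<Rightarrow> real^'b^'b" where
  "mls_matrix \<Phi> p \<nu> h x = (\<chi> i j. \<Sum>\<^sub>\<infinity>q\<in>int_lattice.
     \<Phi> ((x - h *\<^sub>R q) /\<^sub>R (\<nu> * h)) * p i ((x - h *\<^sub>R q) /\<^sub>R (\<nu> * h)) * p j ((x - h *\<^sub>R q) /\<^sub>R (\<nu> * h)))"

text \<open>The smallest real eigenvalue; meant for symmetric matrices, where all eigenvalues are real.\<close>

definition lambda_min :: "real^'b^'b::finite \<Rightarrow> real" where
  "lambda_min A = Min {l. \<exists>v. v \<noteq> 0 \<and> A *v v = l *\<^sub>R v}"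

definition mls_lambda ::
  "(real^'n::finite \<Rightarrow> real) \<Rightarrow> ('b::finite \<Rightarrow> real^'n \<Rightarrow> real) \<Rightarrow> real \<Rightarrow> real \<Rightarrow> real^'n \<Rightarrow> real^'b" where
  "mls_lambda \<Phi> p \<nu> h x = matrix_inv (mls_matrix \<Phi> p \<nu> h x) *v (\<chi> j. p j 0)"

definition mls_weight ::
  "(real^'n::finite \<Rightarrow> real) \<Rightarrow> ('b::finite \<Rightarrow> real^'n \<Rightarrow> real) \<Rightarrow> real \<Rightarrow> real \<Rightarrow> real^'n \<Rightarrow> real^'n \<Rightarrow> real" where
  "mls_weight \<Phi> p \<nu> h y x = \<Phi> ((x - y) /\<^sub>R (\<nu> * h)) *
     (\<Sum>j\<in>UNIV. mls_lambda \<Phi> p \<nu> h x $ j * p j ((x - y) /\<^sub>R (\<nu> * h)))"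

definition mls_Q ::
  "(real^'n::finite \<Rightarrow> real) \<Rightarrow> ('b::finite \<Rightarrow> real^'n \<Rightarrow> real) \<Rightarrow> real \<Rightarrow> real \<Rightarrow> (real^'n \<Rightarrow> real) \<Rightarrow> real^'n \<Rightarrow> real" where
  "mls_Q \<Phi> p \<nu> h f x = (\<Sum>\<^sub>\<infinity>q\<in>int_lattice. mls_weight \<Phi> p \<nu> h (h *\<^sub>R q) x * f (h *\<^sub>R q))"

definition mls_E ::
  "(real^'n::finite \<Rightarrow> real) \<Rightarrow> ('b::finite \<Rightarrow> real^'n \<Rightarrow> real) \<Rightarrow> real \<Rightarrow> real \<Rightarrow> (real^'n \<Rightarrow> real) \<Rightarrow> real^'n \<Rightarrow> real" where
  "mls_E \<Phi> p \<nu> h f x = f x - mls_Q \<Phi> p \<nu> h f x"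

section \<open>The multilevel scheme\<close>

text \<open>Level \<open>j\<close> uses the mesh size \<open>\<mu>\<^sup>j h\<^sub>0\<close>; its support radius is \<open>\<nu>\<close> times that.
  The residual and the approximation satisfy \<open>ml_E = f - ml_Q\<close>.\<close>

primrec ml_E ::
  "(real^'n::finite \<Rightarrow> real) \<Rightarrow> ('b::finite \<Rightarrow> real^'n \<Rightarrow> real) \<Rightarrow> real \<Rightarrow> real \<Rightarrow> real \<Rightarrow> (real^'n \<Rightarrow> real)
    \<Rightarrow> nat \<Rightarrow> real^'n \<Rightarrow> real" where
  "ml_E \<Phi> p \<nu> \<mu> h0 f 0 = f"
| "ml_E \<Phi> p \<nu> \<mu> h0 f (Suc j) =
     (\<lambda>x. ml_E \<Phi> p \<nu> \<mu> h0 f j x - mls_Q \<Phi> p \<nu> (\<mu> ^ Suc j * h0) (ml_E \<Phi> p \<nu> \<mu> h0 f j) x)"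

primrec ml_Q ::
  "(real^'n::finite \<Rightarrow> real) \<Rightarrow> ('b::finite \<Rightarrow> real^'n \<Rightarrow> real) \<Rightarrow> real \<Rightarrow> real \<Rightarrow> real \<Rightarrow> (real^'n \<Rightarrow> real)
    \<Rightarrow> nat \<Rightarrow> real^'n \<Rightarrow> real" where
  "ml_Q \<Phi> p \<nu> \<mu> h0 f 0 = (\<lambda>x. 0)"
| "ml_Q \<Phi> p \<nu> \<mu> h0 f (Suc j) =
     (\<lambda>x. ml_Q \<Phi> p \<nu> \<mu> h0 f j x + mls_Q \<Phi> p \<nu> (\<mu> ^ Suc j * h0) (ml_E \<Phi> p \<nu> \<mu> h0 f j) x)"

lemma ml_E_eq: "ml_E \<Phi> p \<nu> \<mu> h0 f j x = f x - ml_Q \<Phi> p \<nu> \<mu> h0 f j x"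
  by (induction j) auto

lemma ml_E_Suc: "ml_E \<Phi> p \<nu> \<mu> h0 f (Suc j) = mls_E \<Phi> p \<nu> (\<mu> ^ Suc j * h0) (ml_E \<Phi> p \<nu> \<mu> h0 f j)"
  by (auto simp: mls_E_def)

section \<open>Norms and domains\<close>

definition Linf_norm :: "(real^'n::finite) set \<Rightarrow> (real^'n \<Rightarrow> real) \<Rightarrow> ennreal" where
  "Linf_norm \<Omega> g = esssup (lebesgue_on \<Omega>) (\<lambda>x. ennreal \<bar>g x\<bar>)"

text \<open>The supremum is over a finite set of multi-indices, hence a maximum.
  Derivatives are classical, since the norms are only applied to functions of class \<open>C\<^sup>n\<close>.\<close>

definition W_seminorm :: "nat \<Rightarrow> nat \<Rightarrow> real \<Rightarrow> (real^'n::finite) set \<Rightarrow> (real^'n \<Rightarrow> real) \<Rightarrow> ennreal" where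
  "W_seminorm j n \<epsilon> \<Omega> g =
     (SUP \<alpha>\<in>{\<alpha>. j \<le> mi_abs \<alpha> \<and> mi_abs \<alpha> \<le> n}. ennreal (\<epsilon> ^ mi_abs \<alpha>) * Linf_norm \<Omega> (mi_deriv \<alpha> g))"

definition W_norm :: "nat \<Rightarrow> (real^'n::finite) set \<Rightarrow> (real^'n \<Rightarrow> real) \<Rightarrow> ennreal" where
  "W_norm n \<Omega> g = (SUP \<alpha>\<in>{\<alpha>. mi_abs \<alpha> \<le> n}. Linf_norm \<Omega> (mi_deriv \<alpha> g))"

definition nbhd :: "real \<Rightarrow> (real^'n::finite) set \<Rightarrow> (real^'n) set" where
  "nbhd R \<Omega> = {x. \<exists>y\<in>\<Omega>. norm (x - y) < R}"

text \<open>Near each boundary point, the set is the strict epigraph of a Lipschitz function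
  defined on the hyperplane orthogonal to a unit vector \<open>u\<close>. Connectedness is not required.\<close>

definition Lipschitz_domain :: "(real^'n::finite) set \<Rightarrow> bool" where
  "Lipschitz_domain \<Omega> \<longleftrightarrow> open \<Omega> \<and> bounded \<Omega> \<and> \<Omega> \<noteq> {} \<and>
     (\<forall>z\<in>frontier \<Omega>. \<exists>e>0. \<exists>u. \<exists>\<gamma> :: real^'n \<Rightarrow> real. \<exists>B. norm u = 1 \<and>
        B-lipschitz_on {y. y \<bullet> u = 0} \<gamma> \<and>
        \<Omega> \<inter> ball z e = {x \<in> ball z e. x \<bullet> u > \<gamma> (x - (x \<bullet> u) *\<^sub>R u)})"

section \<open>Constants in the convergence estimate\<close>

definition theta :: "nat \<Rightarrow> nat \<Rightarrow> nat \<Rightarrow> nat" where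
  "theta k r j = min (j * (r + 1)) (k - r - 1)"

definition rho :: "nat \<Rightarrow> nat \<Rightarrow> nat \<Rightarrow> real \<Rightarrow> real \<Rightarrow> real" where
  "rho m k r \<nu> \<mu> = \<nu> powi (int k - int m) + \<mu> ^ theta k r 1"

definition J :: "real \<Rightarrow> nat \<Rightarrow> nat \<Rightarrow> nat \<Rightarrow> nat \<Rightarrow> real \<Rightarrow> real \<Rightarrow> real" where
  "J C m k r L \<nu> \<mu> = C * min (rho m k r \<nu> \<mu>)
     (root L (\<mu> ^ (\<Sum>i=1..L. theta k r i) +
        \<nu> powi (int k - int m) *
          (\<Sum>j<L. \<mu> ^ (\<Sum>i\<le>j. theta k r i) * rho m k r \<nu> \<mu> ^ (L - j - 1))))"

definition radius_sum :: "real \<Rightarrow> real \<Rightarrow> real \<Rightarrow> nat \<Rightarrow> real" where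
  "radius_sum \<nu> \<mu> h0 L = (\<Sum>j=1..L. \<nu> * (\<mu> ^ j * h0))"

text \<open>The two single-level error estimates satisfied by the constant \<open>C\<close> entering \<open>J\<close>.\<close>

definition single_level_const ::
  "(real^'n::finite \<Rightarrow> real) \<Rightarrow> ('b::finite \<Rightarrow> real^'n \<Rightarrow> real) \<Rightarrow> nat \<Rightarrow> nat \<Rightarrow> nat \<Rightarrow> real \<Rightarrow> real \<Rightarrow> bool" where
  "single_level_const \<Phi> p m r k \<nu>s C \<longleftrightarrow>
    (\<forall>f x h R \<nu>. Ck k f \<longrightarrow> 0 < h \<longrightarrow> 0 < R \<longrightarrow> 1 < \<nu> \<longrightarrow> \<nu>s \<le> \<nu> \<longrightarrow>
      (\<forall>n. r + 1 \<le> n \<longrightarrow> n \<le> k \<longrightarrow>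
        W_seminorm n n (\<nu> * h) (ball x R) (mls_E \<Phi> p \<nu> h f)
          \<le> ennreal C * (ennreal (\<nu> powi (int n - int m)) * W_seminorm (r + 1) k (\<nu> * h) (ball x (R + \<nu> * h)) f
              + W_seminorm (min (n + r + 1) k) (min (n + r + 1) k) (\<nu> * h) (ball x (R + \<nu> * h)) f)) \<and>
      (\<forall>\<mu>. 0 < \<mu> \<longrightarrow> \<mu> \<le> 1 \<longrightarrow>
        W_seminorm (r + 1) k (\<nu> * h) (ball x R) (mls_E \<Phi> p \<nu> h f)
          \<le> ennreal (C * (\<nu> powi (int k - int m) * \<mu> ^ (r + 1) + \<mu> ^ min (2 * r + 2) k))
            * W_seminorm (r + 1) k (\<nu> * h / \<mu>) (ball x (R + \<nu> * h)) f))"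

end

theory Submission
  imports Defs
begin

text \<open>The residual after \<open>L\<close> levels is a composition of single-level residuals, so its size at a point
\<open>x\<close> is controlled in two stages.

The last level turns a seminorm of order \<open>r + 1\<close> into pointwise values. Moving least squares
reproduces polynomials of degree at most \<open>r\<close>, so near \<open>x\<close> the function may be replaced by its
Taylor remainder at \<open>x\<close>, which is of size \<open>\<delta> ^ (r + 1)\<close> times the derivatives of order \<open>r + 1\<close>
on the ball of radius \<open>\<delta>\<close>. The weights have derivatives of order \<open>s\<close> bounded by a multiple of
\<open>1 / (\<delta> ^ s * \<nu> ^ d)\<close>, and at most \<open>(3 * \<nu>) ^ d\<close> lattice points contribute, so the powers of \<open>\<nu>\<close>
cancel and the constant depends neither on \<open>h\<close> nor on \<open>\<nu>\<close> (\<open>mls_E_local_estimate\<close>). This holds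
for all derivatives of order at most \<open>r + 1\<close>, at every point of \<open>\<Omega>\<close> separately, so both claims
follow from the same pointwise estimate.

The bounds on the weights come from the inverse \<open>B\<close> of the moment matrix \<open>A\<close>. The eigenvalue
bound controls the entries of \<open>B\<close>, and \<open>\<partial>B = - B (\<partial>A) B\<close> then gives smoothness and derivative
bounds by induction on the order (\<open>bounded_Ck_matrix_inverse\<close>).

The first \<open>L - 1\<close> levels are handled by the two given single-level estimates. Iterating the one
for all orders between \<open>r + 1\<close> and \<open>k\<close> produces the factor \<open>\<rho>\<close> once per level
(\<open>all_orders_decay\<close>). Iterating the one for a single order raises the order by \<open>r + 1\<close> with each
level passed downwards, until it is capped at \<open>k\<close>; every raise gains an additional power of
\<open>\<mu>\<close>, and the first term of the estimate is absorbed by \<open>all_orders_decay\<close>. This yields the sum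
under the root in \<open>J\<close> (\<open>single_order_decay\<close>). Balls around a fixed \<open>x\<close> grow by \<open>\<delta>\<^sub>j\<close> at level \<open>j\<close>,
which adds up to \<open>radius_sum\<close>.\<close>

section \<open>Iterated partial derivatives\<close>

text \<open>Derivatives along a list of directions, the last entry being applied first. Lists allow induction
on the order and a derivative to be split off at either end, which the multi-index derivatives do
not; \<open>pderivs_eq_mi_deriv\<close> translates between the two.\<close>

definition pderivs :: "'n::finite list \<Rightarrow> (real^'n \<Rightarrow> real) \<Rightarrow> real^'n \<Rightarrow> real" where
  "pderivs l g = foldr pderiv_dir l g"

definition has_pderiv :: "'n::finite \<Rightarrow> (real^'n \<Rightarrow> real) \<Rightarrow> (real^'n \<Rightarrow> real) \<Rightarrow> bool" where
  "has_pderiv i g g' \<longleftrightarrow>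
     (\<forall>x. ((\<lambda>t. g (x + t *\<^sub>R axis i 1)) has_real_derivative g' x) (at 0))"

lemma pderivs_Nil [simp]: "pderivs [] g = g"
  and pderivs_snoc: "pderivs (l @ [i]) g = pderivs l (pderiv_dir i g)"
  and pderivs_Cons: "pderivs (i # l) g = pderiv_dir i (pderivs l g)"
  and pderivs_append: "pderivs (l @ l') g = pderivs l (pderivs l' g)"
  by (simp_all add: pderivs_def)

lemma has_pderiv_eq: "has_pderiv i g g' \<Longrightarrow> pderiv_dir i g = g'"
  by (rule ext) (simp add: has_pderiv_def pderiv_dir_def DERIV_imp_deriv)

lemma Ck_SucI:
  assumes "continuous_on UNIV g" "\<And>i. has_pderiv i g (g' i)" "\<And>i. Ck n (g' i)"
  shows "Ck (Suc n) g"
  using assms has_pderiv_eq[OF assms(2)]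
  by (auto simp: has_pderiv_def real_differentiable_def)

lemma Ck_continuous: "Ck n g \<Longrightarrow> continuous_on UNIV g"
  by (cases n) auto

lemma Ck_has_pderiv: "Ck (Suc n) g \<Longrightarrow> has_pderiv i g (pderiv_dir i g)"
  by (auto simp: has_pderiv_def pderiv_dir_def DERIV_deriv_iff_real_differentiable)

lemma Ck_pderiv: "Ck (Suc n) g \<Longrightarrow> Ck n (pderiv_dir i g)"
  by simp

lemma Ck_less: "Ck (Suc n) g \<Longrightarrow> Ck n g"
proof (induction n arbitrary: g)
  case (Suc n)
  then show ?case by (metis Ck.simps(2))
qed auto

lemma Ck_mono: "Ck n g \<Longrightarrow> k \<le> n \<Longrightarrow> Ck k g"
  by (induction n) (auto simp del: Ck.simps simp: le_Suc_eq dest: Ck_less)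

lemma Ck_pderivs: "Ck (length l + n) g \<Longrightarrow> Ck n (pderivs l g)"
proof (induction l arbitrary: n)
  case (Cons i l)
  then have "Ck (Suc n) (pderivs l g)" using Cons.IH[of "Suc n"] by simp
  then show ?case by (simp add: pderivs_Cons)
qed simp

lemma has_pderiv_line:
  assumes "has_pderiv i g g'"
  shows "((\<lambda>t. g (x + t *\<^sub>R axis i 1)) has_real_derivative g' (x + s *\<^sub>R axis i 1)) (at s)"
proof -
  have "((\<lambda>t. g ((x + s *\<^sub>R axis i 1) + t *\<^sub>R axis i 1)) has_real_derivative
          g' (x + s *\<^sub>R axis i 1)) (at 0)"
    using assms by (simp add: has_pderiv_def)
  also have "(\<lambda>t. g ((x + s *\<^sub>R axis i 1) + t *\<^sub>R axis i 1)) = (\<lambda>t. g (x + (t + s) *\<^sub>R axis i 1))"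
    by (simp add: algebra_simps)
  finally show ?thesis
    using DERIV_shift[of "\<lambda>t. g (x + t *\<^sub>R axis i 1)" _ 0 s] by (simp add: add.commute)
qed

lemma has_pderiv_const: "has_pderiv i (\<lambda>x. c) (\<lambda>x. 0)"
  by (simp add: has_pderiv_def)

lemma has_pderiv_add:
  "has_pderiv i f f' \<Longrightarrow> has_pderiv i g g' \<Longrightarrow> has_pderiv i (\<lambda>x. f x + g x) (\<lambda>x. f' x + g' x)"
  by (auto simp: has_pderiv_def intro!: derivative_eq_intros)

lemma has_pderiv_diff:
  "has_pderiv i f f' \<Longrightarrow> has_pderiv i g g' \<Longrightarrow> has_pderiv i (\<lambda>x. f x - g x) (\<lambda>x. f' x - g' x)"
  by (auto simp: has_pderiv_def intro!: derivative_eq_intros)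

lemma has_pderiv_mult:
  "has_pderiv i f f' \<Longrightarrow> has_pderiv i g g' \<Longrightarrow>
     has_pderiv i (\<lambda>x. f x * g x) (\<lambda>x. f' x * g x + f x * g' x)"
  unfolding has_pderiv_def by (intro allI DERIV_cong[OF DERIV_mult]) auto

lemma has_pderiv_affine:
  assumes "has_pderiv i g g'"
  shows "has_pderiv i (\<lambda>x. g (a *\<^sub>R (x - c))) (\<lambda>x. a * g' (a *\<^sub>R (x - c)))"
  unfolding has_pderiv_def
proof
  fix x
  have "((\<lambda>t. g (a *\<^sub>R (x - c) + t *\<^sub>R axis i 1)) has_real_derivative g' (a *\<^sub>R (x - c))) (at (a * 0))"
    using assms by (auto simp: has_pderiv_def)
  from DERIV_chain2[where g = "\<lambda>t. a * t" and Db = a and s = UNIV, OF this]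
  have "((\<lambda>t. g (a *\<^sub>R (x - c) + (a * t) *\<^sub>R axis i 1)) has_real_derivative g' (a *\<^sub>R (x - c)) * a) (at 0)"
    by (auto intro!: derivative_eq_intros)
  then show "((\<lambda>t. g (a *\<^sub>R (x + t *\<^sub>R axis i 1 - c))) has_real_derivative a * g' (a *\<^sub>R (x - c))) (at 0)"
    by (simp add: algebra_simps)
qed

lemma Ck_const: "Ck n (\<lambda>x. c)"
proof (induction n arbitrary: c)
  case (Suc n)
  show ?case by (rule Ck_SucI[where g' = "\<lambda>i x. 0"]) (auto intro: has_pderiv_const Suc)
qed simp

lemma Ck_add: "Ck n f \<Longrightarrow> Ck n g \<Longrightarrow> Ck n (\<lambda>x. f x + g x)"
proof (induction n arbitrary: f g)
  case (Suc n)
  show ?case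
    by (rule Ck_SucI[where g' = "\<lambda>i x. pderiv_dir i f x + pderiv_dir i g x"])
      (use Suc in \<open>auto intro!: continuous_on_add has_pderiv_add Ck_has_pderiv[of n] Suc.IH\<close>)
qed (auto intro: continuous_on_add)

lemma Ck_diff: "Ck n f \<Longrightarrow> Ck n g \<Longrightarrow> Ck n (\<lambda>x. f x - g x)"
proof (induction n arbitrary: f g)
  case (Suc n)
  show ?case
    by (rule Ck_SucI[where g' = "\<lambda>i x. pderiv_dir i f x - pderiv_dir i g x"])
      (use Suc in \<open>auto intro!: continuous_on_diff has_pderiv_diff Ck_has_pderiv[of n] Suc.IH\<close>)
qed (auto intro: continuous_on_diff)

lemma Ck_mult: "Ck n f \<Longrightarrow> Ck n g \<Longrightarrow> Ck n (\<lambda>x. f x * g x)"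
proof (induction n arbitrary: f g)
  case (Suc n)
  note less = Suc.prems[THEN Ck_less]
  show ?case
    by (rule Ck_SucI[where g' = "\<lambda>i x. pderiv_dir i f x * g x + f x * pderiv_dir i g x"])
      (use Suc.prems less in \<open>auto intro!: continuous_on_mult has_pderiv_mult Ck_has_pderiv[of n] Ck_add Suc.IH\<close>)
qed (auto intro: continuous_on_mult)

lemma Ck_sum: "(\<And>a. a \<in> F \<Longrightarrow> Ck n (f a)) \<Longrightarrow> Ck n (\<lambda>x. \<Sum>a\<in>F. f a x)"
  by (induction F rule: infinite_finite_induct) (auto intro: Ck_const Ck_add)

lemma pderivs_diff:
  "Ck (length l) f \<Longrightarrow> Ck (length l) g \<Longrightarrow> pderivs l (\<lambda>x. f x - g x) = (\<lambda>x. pderivs l f x - pderivs l g x)"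
proof (induction l arbitrary: f g rule: rev_induct)
  case (snoc i l)
  have "pderiv_dir i (\<lambda>x. f x - g x) = (\<lambda>x. pderiv_dir i f x - pderiv_dir i g x)"
    using snoc.prems by (intro has_pderiv_eq has_pderiv_diff Ck_has_pderiv[of "length l"]) auto
  then show ?case using snoc by (simp add: pderivs_snoc)
qed simp

lemma pderivs_add:
  "Ck (length l) f \<Longrightarrow> Ck (length l) g \<Longrightarrow> pderivs l (\<lambda>x. f x + g x) = (\<lambda>x. pderivs l f x + pderivs l g x)"
proof (induction l arbitrary: f g rule: rev_induct)
  case (snoc i l)
  have "pderiv_dir i (\<lambda>x. f x + g x) = (\<lambda>x. pderiv_dir i f x + pderiv_dir i g x)"
    using snoc.prems by (intro has_pderiv_eq has_pderiv_add Ck_has_pderiv[of "length l"]) auto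
  then show ?case using snoc by (simp add: pderivs_snoc)
qed simp

lemma pderivs_cmult:
  "Ck (length l) f \<Longrightarrow> pderivs l (\<lambda>x. c * f x) = (\<lambda>x. c * pderivs l f x)"
proof (induction l arbitrary: f rule: rev_induct)
  case (snoc i l)
  have "pderiv_dir i (\<lambda>x. c * f x) = (\<lambda>x. 0 * f x + c * pderiv_dir i f x)"
    using snoc.prems by (intro has_pderiv_eq has_pderiv_mult has_pderiv_const Ck_has_pderiv[of "length l"]) auto
  then show ?case using snoc by (simp add: pderivs_snoc)
qed simp

lemma pderivs_const: "pderivs l (\<lambda>x. c) = (if l = [] then (\<lambda>x. c) else (\<lambda>x. 0))"
proof (induction l)
  case (Cons i l)
  then show ?case by (simp add: pderivs_Cons has_pderiv_eq[OF has_pderiv_const])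
qed simp

lemma pderivs_sum:
  "(\<And>a. a \<in> F \<Longrightarrow> Ck (length l) (f a)) \<Longrightarrow>
     pderivs l (\<lambda>x. \<Sum>a\<in>F. f a x) = (\<lambda>x. \<Sum>a\<in>F. pderivs l (f a) x)"
  by (induction F rule: infinite_finite_induct)
    (auto simp: pderivs_const pderivs_add Ck_sum)

text \<open>Both iterated differences over a square coincide, so expressing them through mixed derivatives in
the two possible orders compares these derivatives. The mean value theorem along one coordinate
line and then along the other produces the intermediate point.\<close>

lemma small_square_mixed_difference:
  assumes g: "Ck 2 g" and h: "0 < h"
  obtains s t where "0 < s" "s < h" "0 < t" "t < h"
    "g (x + h *\<^sub>R axis i 1 + h *\<^sub>R axis j 1) - g (x + h *\<^sub>R axis i 1)
       - g (x + h *\<^sub>R axis j 1) + g x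
     = h * h * pderiv_dir j (pderiv_dir i g) (x + s *\<^sub>R axis i 1 + t *\<^sub>R axis j 1)"
proof -
  have g2: "Ck (Suc (Suc 0)) g" using g by (simp add: numeral_2_eq_2)
  let ?e = "\<lambda>i. axis i 1 :: real^'n"
  let ?d = "\<lambda>i. pderiv_dir i g"
  define \<phi> where "\<phi> s = g (x + h *\<^sub>R ?e j + s *\<^sub>R ?e i) - g (x + s *\<^sub>R ?e i)" for s
  have "(\<phi> has_real_derivative ?d i (x + h *\<^sub>R ?e j + s *\<^sub>R ?e i) - ?d i (x + s *\<^sub>R ?e i)) (at s)" for s
    unfolding \<phi>_def by (intro DERIV_diff has_pderiv_line Ck_has_pderiv[OF g2])
  then obtain s where s: "0 < s" "s < h"
    "\<phi> h - \<phi> 0 = h * (?d i (x + h *\<^sub>R ?e j + s *\<^sub>R ?e i) - ?d i (x + s *\<^sub>R ?e i))"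
    using MVT2[OF h, of \<phi> "\<lambda>s. ?d i (x + h *\<^sub>R ?e j + s *\<^sub>R ?e i) - ?d i (x + s *\<^sub>R ?e i)"] by auto
  have "((\<lambda>t. ?d i (x + s *\<^sub>R ?e i + t *\<^sub>R ?e j)) has_real_derivative
      pderiv_dir j (?d i) (x + s *\<^sub>R ?e i + t *\<^sub>R ?e j)) (at t)" for t
    by (intro has_pderiv_line Ck_has_pderiv[OF Ck_pderiv[OF g2]])
  then obtain t where t: "0 < t" "t < h"
    "?d i (x + s *\<^sub>R ?e i + h *\<^sub>R ?e j) - ?d i (x + s *\<^sub>R ?e i + 0 *\<^sub>R ?e j)
      = h * pderiv_dir j (?d i) (x + s *\<^sub>R ?e i + t *\<^sub>R ?e j)"
    using MVT2[OF h, of "\<lambda>t. ?d i (x + s *\<^sub>R ?e i + t *\<^sub>R ?e j)"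
        "\<lambda>t. pderiv_dir j (?d i) (x + s *\<^sub>R ?e i + t *\<^sub>R ?e j)"] by auto
  show thesis
    by (rule that[OF s(1,2) t(1,2)]) (use s(3) t(3) in \<open>simp add: \<phi>_def algebra_simps\<close>)
qed

text \<open>The square of side \<open>1 / (n + 1)\<close> contains points where the two mixed derivatives agree. As \<open>n\<close>
grows, these points tend to \<open>x\<close> and continuity gives equality there.\<close>

lemma Clairaut:
  fixes g :: "real^'n::finite \<Rightarrow> real"
  assumes g: "Ck 2 g"
  shows "pderiv_dir i (pderiv_dir j g) = pderiv_dir j (pderiv_dir i g)"
proof
  fix x
  let ?e = "\<lambda>i. axis i 1 :: real^'n"
  define A where "A = pderiv_dir i (pderiv_dir j g)"
  define B where "B = pderiv_dir j (pderiv_dir i g)"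
  have cont: "isCont A x" "isCont B x"
    using g continuous_on_eq_continuous_at[of UNIV] by (auto simp: numeral_2_eq_2 A_def B_def)
  have "\<forall>n. \<exists>y z. norm (y - x) \<le> 2 / real (Suc n) \<and> norm (z - x) \<le> 2 / real (Suc n) \<and> A y = B z"
  proof
    fix n
    define h where "h = 1 / real (Suc n)"
    have h: "0 < h" by (simp add: h_def)
    obtain s t where 1: "0 < s" "s < h" "0 < t" "t < h"
      "g (x + h *\<^sub>R ?e i + h *\<^sub>R ?e j) - g (x + h *\<^sub>R ?e i) - g (x + h *\<^sub>R ?e j) + g x
        = h * h * B (x + s *\<^sub>R ?e i + t *\<^sub>R ?e j)"
      unfolding B_def by (rule small_square_mixed_difference[OF g h, of x i j]) blast
    obtain s' t' where 2: "0 < s'" "s' < h" "0 < t'" "t' < h"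
      "g (x + h *\<^sub>R ?e j + h *\<^sub>R ?e i) - g (x + h *\<^sub>R ?e j) - g (x + h *\<^sub>R ?e i) + g x
        = h * h * A (x + s' *\<^sub>R ?e j + t' *\<^sub>R ?e i)"
      unfolding A_def by (rule small_square_mixed_difference[OF g h, of x j i]) blast
    have near: "norm (a *\<^sub>R ?e k + b *\<^sub>R ?e l) \<le> 2 / real (Suc n)"
      if "0 < a" "a < h" "0 < b" "b < h" for a b k l
      using norm_triangle_ineq[of "a *\<^sub>R ?e k" "b *\<^sub>R ?e l"] that
      by (simp add: h_def)
    have "h * h * A (x + s' *\<^sub>R ?e j + t' *\<^sub>R ?e i) = h * h * B (x + s *\<^sub>R ?e i + t *\<^sub>R ?e j)"
    proof -
      have "x + h *\<^sub>R ?e j + h *\<^sub>R ?e i = x + h *\<^sub>R ?e i + h *\<^sub>R ?e j" by simp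
      from 2(5)[unfolded this] 1(5) show ?thesis by linarith
    qed
    then have "A (x + s' *\<^sub>R ?e j + t' *\<^sub>R ?e i) = B (x + s *\<^sub>R ?e i + t *\<^sub>R ?e j)"
      using h by simp
    moreover have "x + a *\<^sub>R ?e k + b *\<^sub>R ?e l - x = a *\<^sub>R ?e k + b *\<^sub>R ?e l" for a b k l
      by simp
    ultimately show "\<exists>y z. norm (y - x) \<le> 2 / real (Suc n) \<and> norm (z - x) \<le> 2 / real (Suc n) \<and> A y = B z"
      using near[OF 1(1-4), of i j] near[OF 2(1-4), of j i] by metis
  qed
  then obtain y z where yz: "\<And>n. norm (y n - x) \<le> 2 / real (Suc n)"
    "\<And>n. norm (z n - x) \<le> 2 / real (Suc n)" "\<And>n. A (y n) = B (z n)"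
    by metis
  have lim0: "(\<lambda>n. 2 / real (Suc n)) \<longlonglongrightarrow> 0"
    using LIMSEQ_Suc[OF lim_const_over_n[of "2::real"]] by simp
  have conv: "w \<longlonglongrightarrow> x" if "\<And>n. norm (w n - x) \<le> 2 / real (Suc n)" for w
    using Lim_null_comparison[OF _ lim0, of "\<lambda>n. w n - x"] that LIM_zero_cancel by fastforce
  have "(\<lambda>n. A (y n)) \<longlonglongrightarrow> A x" "(\<lambda>n. B (z n)) \<longlonglongrightarrow> B x"
    using isCont_tendsto_compose[OF cont(1) conv[OF yz(1)]]
      isCont_tendsto_compose[OF cont(2) conv[OF yz(2)]] by auto
  then have "A x = B x" using yz(3) LIMSEQ_unique by auto
  then show "pderiv_dir i (pderiv_dir j g) x = pderiv_dir j (pderiv_dir i g) x"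
    by (simp add: A_def B_def)
qed

lemma pderivs_pderiv_commute:
  "Ck (Suc (length l)) g \<Longrightarrow> pderivs l (pderiv_dir i g) = pderiv_dir i (pderivs l g)"
proof (induction l)
  case (Cons j l)
  have 1: "Ck (Suc (length l)) g" using Ck_less[OF Cons.prems] by (simp del: Ck.simps)
  have 2: "Ck 2 (pderivs l g)" using Cons.prems by (intro Ck_pderivs) (simp del: Ck.simps)
  have "pderivs (j # l) (pderiv_dir i g) = pderiv_dir j (pderiv_dir i (pderivs l g))"
    by (simp add: pderivs_Cons Cons.IH[OF 1])
  also have "\<dots> = pderiv_dir i (pderivs (j # l) g)"
    by (simp add: pderivs_Cons Clairaut[OF 2])
  finally show ?case .
qed simp

lemma pderivs_mset_cong:
  assumes "mset l = mset l'" "Ck (length l) g"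
  shows "pderivs l g = pderivs l' g"
  using assms
proof (induction l arbitrary: l')
  case (Cons i l)
  then obtain a b where l': "l' = a @ i # b" "mset l = mset (a @ b)"
    using split_list[of i l'] by (metis add_mset_add_mset_same_iff in_set_conv_decomp insert_iff list.set(2) mset.simps(2) mset_eq_setD mset_append union_mset_add_mset_right)
  have len: "length l = length a + length b" using mset_eq_length[OF l'(2)] by simp
  have "pderivs l g = pderivs (a @ b) g"
    using Cons.IH[OF l'(2)] Ck_less[of "length l" g] Cons.prems(2) by (simp del: Ck.simps)
  then have "pderivs (i # l) g = pderiv_dir i (pderivs a (pderivs b g))"
    by (simp add: pderivs_Cons pderivs_append)
  also have "\<dots> = pderivs a (pderiv_dir i (pderivs b g))"
  proof (rule pderivs_pderiv_commute[symmetric])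
    show "Ck (Suc (length a)) (pderivs b g)"
      using Cons.prems(2) len by (intro Ck_pderivs) (simp del: Ck.simps add: add.commute)
  qed
  finally show ?case by (simp add: l' pderivs_append pderivs_Cons)
qed simp

definition mi_list :: "('n::finite \<Rightarrow> nat) \<Rightarrow> 'n list" where
  "mi_list \<alpha> = concat (map (\<lambda>i. replicate (\<alpha> i) i) coords)"

lemma pderivs_replicate: "pderivs (replicate n i) g = (pderiv_dir i ^^ n) g"
  by (induction n) (auto simp: pderivs_Cons)

lemma mi_deriv_eq_pderivs: "mi_deriv \<alpha> g = pderivs (mi_list \<alpha>) g"
proof -
  have "foldr (\<lambda>i. pderiv_dir i ^^ \<alpha> i) xs g = pderivs (concat (map (\<lambda>i. replicate (\<alpha> i) i) xs)) g" for xs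
    by (induction xs) (auto simp: pderivs_append pderivs_replicate)
  then show ?thesis by (simp add: mi_deriv_def mi_list_def)
qed

lemma count_mi_list: "count (mset (mi_list \<alpha>)) i = \<alpha> i"
proof -
  have "count (mset (concat (map (\<lambda>i. replicate (\<alpha> i) i) xs))) i = (if i \<in> set xs then \<alpha> i else 0)"
    if "distinct xs" for xs
    using that by (induction xs) auto
  then show ?thesis by (simp add: mi_list_def distinct_coords set_coords)
qed

lemma length_eq_sum_count: "length (l :: 'n::finite list) = (\<Sum>i\<in>UNIV. count (mset l) i)"
  by (metis (no_types) size_mset size_multiset_overloaded_eq sum.mono_neutral_left finite_class.finite_UNIV subset_UNIV count_eq_zero_iff DiffE)

lemma length_mi_list: "length (mi_list \<alpha>) = mi_abs \<alpha>"
  by (simp add: length_eq_sum_count count_mi_list mi_abs_def)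

lemma pderivs_eq_mi_deriv:
  assumes "Ck (length l) g"
  shows "pderivs l g = mi_deriv (count (mset l)) g" "mi_abs (count (mset l)) = length l"
proof -
  have "mset l = mset (mi_list (count (mset l)))"
    by (rule multiset_eqI) (simp add: count_mi_list)
  then show "pderivs l g = mi_deriv (count (mset l)) g"
    unfolding mi_deriv_eq_pderivs by (rule pderivs_mset_cong[OF _ assms])
  show "mi_abs (count (mset l)) = length l"
    by (simp add: mi_abs_def length_eq_sum_count)
qed

section \<open>Scaled derivative bounds and locally finite sums\<close>

text \<open>Functions with a scale \<open>\<epsilon>\<close>: each derivative is worth a factor \<open>1 / \<epsilon>\<close>. Building the scale into
the bound makes the product rule and the inversion rule scale-free, so that their constants do not
see the support radius.\<close>

definition bounded_Ck :: "nat \<Rightarrow> real \<Rightarrow> real \<Rightarrow> (real^'n::finite \<Rightarrow> real) \<Rightarrow> bool" where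
  "bounded_Ck n \<epsilon> K g \<longleftrightarrow> Ck n g \<and> (\<forall>l x. length l \<le> n \<longrightarrow> \<epsilon> ^ length l * \<bar>pderivs l g x\<bar> \<le> K)"

lemma bounded_Ck_imp_Ck: "bounded_Ck n \<epsilon> K g \<Longrightarrow> Ck n g"
  and bounded_Ck_pderivs_le: "bounded_Ck n \<epsilon> K g \<Longrightarrow> length l \<le> n \<Longrightarrow> \<epsilon> ^ length l * \<bar>pderivs l g x\<bar> \<le> K"
  by (auto simp: bounded_Ck_def)

lemma bounded_Ck_abs_le: "bounded_Ck n \<epsilon> K g \<Longrightarrow> \<bar>g x\<bar> \<le> K"
  using bounded_Ck_pderivs_le[of n \<epsilon> K g "[]"] by simp

lemma bounded_Ck_nonneg: "bounded_Ck n \<epsilon> K g \<Longrightarrow> 0 \<le> K"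
  using bounded_Ck_abs_le[of n \<epsilon> K g undefined] by linarith

lemma bounded_Ck_weaken: "bounded_Ck n \<epsilon> K g \<Longrightarrow> K \<le> L \<Longrightarrow> bounded_Ck n \<epsilon> L g"
  unfolding bounded_Ck_def using order_trans by blast

lemma bounded_Ck_less: "bounded_Ck (Suc n) \<epsilon> K g \<Longrightarrow> bounded_Ck n \<epsilon> K g"
  unfolding bounded_Ck_def using Ck_less[of n g] by (simp del: Ck.simps)

lemma bounded_Ck_0I: "continuous_on UNIV g \<Longrightarrow> (\<And>x. \<bar>g x\<bar> \<le> K) \<Longrightarrow> bounded_Ck 0 \<epsilon> K g"
  by (simp add: bounded_Ck_def)

lemma bounded_Ck_SucI:
  assumes \<epsilon>: "0 < \<epsilon>" and g: "continuous_on UNIV g" "\<And>x. \<bar>g x\<bar> \<le> K"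
    and g': "\<And>i. has_pderiv i g (g' i)" "\<And>i. bounded_Ck n \<epsilon> (K / \<epsilon>) (g' i)"
  shows "bounded_Ck (Suc n) \<epsilon> K g"
  unfolding bounded_Ck_def
proof (intro conjI allI impI)
  show "Ck (Suc n) g" using g g' by (intro Ck_SucI[where g' = g']) (auto dest: bounded_Ck_imp_Ck)
  fix l :: "'a list" and x assume l: "length l \<le> Suc n"
  show "\<epsilon> ^ length l * \<bar>pderivs l g x\<bar> \<le> K"
  proof (cases l rule: rev_cases)
    case (snoc k i)
    have "\<epsilon> ^ length k * \<bar>pderivs k (g' i) x\<bar> \<le> K / \<epsilon>"
      using bounded_Ck_pderivs_le[OF g'(2)] l snoc by simp
    then show ?thesis using \<epsilon> has_pderiv_eq[OF g'(1)]
      by (simp add: snoc pderivs_snoc field_simps)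
  qed (use g in simp)
qed

lemma bounded_Ck_pderiv:
  assumes "0 < \<epsilon>" "bounded_Ck (Suc n) \<epsilon> K g"
  shows "bounded_Ck n \<epsilon> (K / \<epsilon>) (pderiv_dir i g)"
  unfolding bounded_Ck_def
proof (intro conjI allI impI)
  show "Ck n (pderiv_dir i g)" using bounded_Ck_imp_Ck[OF assms(2)] by simp
  fix l :: "'a list" and x assume l: "length l \<le> n"
  show "\<epsilon> ^ length l * \<bar>pderivs l (pderiv_dir i g) x\<bar> \<le> K / \<epsilon>"
    using bounded_Ck_pderivs_le[OF assms(2), of "l @ [i]" x] l assms(1) by (simp add: pderivs_snoc field_simps)
qed

lemma bounded_Ck_has_pderiv: "bounded_Ck (Suc n) \<epsilon> K g \<Longrightarrow> has_pderiv i g (pderiv_dir i g)"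
  by (rule Ck_has_pderiv[OF bounded_Ck_imp_Ck])

lemma bounded_Ck_const: "bounded_Ck n \<epsilon> \<bar>c\<bar> (\<lambda>x. c)"
  by (auto simp: bounded_Ck_def Ck_const pderivs_const)

lemma bounded_Ck_add:
  assumes "0 \<le> \<epsilon>" "bounded_Ck n \<epsilon> K f" "bounded_Ck n \<epsilon> L g"
  shows "bounded_Ck n \<epsilon> (K + L) (\<lambda>x. f x + g x)"
  unfolding bounded_Ck_def
proof (intro conjI allI impI)
  note C = bounded_Ck_imp_Ck[OF assms(2)] bounded_Ck_imp_Ck[OF assms(3)]
  show "Ck n (\<lambda>x. f x + g x)" using C by (rule Ck_add)
  fix l :: "'a list" and x assume l: "length l \<le> n"
  have "pderivs l (\<lambda>x. f x + g x) = (\<lambda>x. pderivs l f x + pderivs l g x)"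
    by (rule pderivs_add[OF Ck_mono[OF C(1) l] Ck_mono[OF C(2) l]])
  then have "\<epsilon> ^ length l * \<bar>pderivs l (\<lambda>x. f x + g x) x\<bar>
      \<le> \<epsilon> ^ length l * \<bar>pderivs l f x\<bar> + \<epsilon> ^ length l * \<bar>pderivs l g x\<bar>"
    using assms(1) by (simp add: mult_left_mono flip: distrib_left)
  also have "\<dots> \<le> K + L"
    using bounded_Ck_pderivs_le[OF assms(2) l] bounded_Ck_pderivs_le[OF assms(3) l] by (rule add_mono)
  finally show "\<epsilon> ^ length l * \<bar>pderivs l (\<lambda>x. f x + g x) x\<bar> \<le> K + L" .
qed

lemma bounded_Ck_sum:
  assumes "0 \<le> \<epsilon>" "\<And>a. a \<in> F \<Longrightarrow> bounded_Ck n \<epsilon> (K a) (f a)"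
  shows "bounded_Ck n \<epsilon> (\<Sum>a\<in>F. K a) (\<lambda>x. \<Sum>a\<in>F. f a x)"
  using assms(2)
proof (induction F rule: infinite_finite_induct)
  case (insert a F)
  have "bounded_Ck n \<epsilon> (K a + sum K F) (\<lambda>x. f a x + (\<Sum>a\<in>F. f a x))"
    using insert by (intro bounded_Ck_add assms(1)) auto
  then show ?case using insert by simp
qed (use bounded_Ck_const[of n \<epsilon> 0] in auto)

text \<open>Each derivative of a product doubles the number of terms, whence the factor \<open>2 ^ n\<close>.\<close>

lemma bounded_Ck_mult:
  assumes "0 < \<epsilon>" "bounded_Ck n \<epsilon> K f" "bounded_Ck n \<epsilon> L g"
  shows "bounded_Ck n \<epsilon> (2 ^ n * (K * L)) (\<lambda>x. f x * g x)"
  using assms(2,3)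
proof (induction n arbitrary: f g K L)
  case 0
  have "\<bar>f x * g x\<bar> \<le> K * L" for x
    unfolding abs_mult using bounded_Ck_abs_le[OF 0(1)] bounded_Ck_abs_le[OF 0(2)] bounded_Ck_nonneg[OF 0(1)]
    by (intro mult_mono) auto
  then show ?case using bounded_Ck_imp_Ck[OF 0(1)] bounded_Ck_imp_Ck[OF 0(2)]
    by (intro bounded_Ck_0I continuous_on_mult) auto
next
  case (Suc n)
  show ?case
  proof (rule bounded_Ck_SucI[OF assms(1), where g' = "\<lambda>i x. pderiv_dir i f x * g x + f x * pderiv_dir i g x"])
    show "continuous_on UNIV (\<lambda>x. f x * g x)"
      using Suc.prems by (intro continuous_on_mult Ck_continuous[OF bounded_Ck_imp_Ck])
    show "has_pderiv i (\<lambda>x. f x * g x) (\<lambda>x. pderiv_dir i f x * g x + f x * pderiv_dir i g x)" for i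
      using Suc.prems by (intro has_pderiv_mult bounded_Ck_has_pderiv)
    have KL: "0 \<le> K * L" using bounded_Ck_nonneg[OF Suc.prems(1)] bounded_Ck_nonneg[OF Suc.prems(2)] by simp
    show "\<bar>f x * g x\<bar> \<le> 2 ^ Suc n * (K * L)" for x
    proof -
      have "\<bar>f x * g x\<bar> \<le> K * L"
        unfolding abs_mult using bounded_Ck_abs_le[OF Suc.prems(1)] bounded_Ck_abs_le[OF Suc.prems(2)] bounded_Ck_nonneg[OF Suc.prems(1)]
        by (intro mult_mono) auto
      also have "\<dots> \<le> 2 ^ Suc n * (K * L)"
        using mult_right_mono[OF one_le_power[of "2::real" "Suc n"] KL] by simp
      finally show ?thesis .
    qed
    have "bounded_Ck n \<epsilon> (2 ^ n * (K / \<epsilon> * L) + 2 ^ n * (K * (L / \<epsilon>))) (\<lambda>x. pderiv_dir i f x * g x + f x * pderiv_dir i g x)" for i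
      using assms(1) Suc.prems[THEN bounded_Ck_less] bounded_Ck_pderiv[OF assms(1) Suc.prems(1)] bounded_Ck_pderiv[OF assms(1) Suc.prems(2)]
      by (intro bounded_Ck_add[OF _ Suc.IH Suc.IH]) auto
    moreover have "2 ^ n * (K / \<epsilon> * L) + 2 ^ n * (K * (L / \<epsilon>)) = 2 ^ Suc n * (K * L) / \<epsilon>"
      using assms(1) by (simp add: field_simps)
    ultimately show "bounded_Ck n \<epsilon> (2 ^ Suc n * (K * L) / \<epsilon>) (\<lambda>x. pderiv_dir i f x * g x + f x * pderiv_dir i g x)" for i
      by metis
  qed
qed

lemma bounded_Ck_cmult: 
  assumes "0 \<le> \<epsilon>" "bounded_Ck n \<epsilon> K g" shows "bounded_Ck n \<epsilon> (\<bar>c\<bar> * K) (\<lambda>x. c * g x)"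
  unfolding bounded_Ck_def
proof (intro conjI allI impI)
  show "Ck n (\<lambda>x. c * g x)" using bounded_Ck_imp_Ck[OF assms(2)] by (intro Ck_mult Ck_const)
  fix l :: "'a list" and x assume l: "length l \<le> n"
  have "pderivs l (\<lambda>x. c * g x) = (\<lambda>x. c * pderivs l g x)"
    by (rule pderivs_cmult[OF Ck_mono[OF bounded_Ck_imp_Ck[OF assms(2)] l]])
  then have "\<epsilon> ^ length l * \<bar>pderivs l (\<lambda>x. c * g x) x\<bar> = \<bar>c\<bar> * (\<epsilon> ^ length l * \<bar>pderivs l g x\<bar>)"
    by (simp add: abs_mult)
  also have "\<dots> \<le> \<bar>c\<bar> * K" using bounded_Ck_pderivs_le[OF assms(2) l] by (intro mult_left_mono) auto
  finally show "\<epsilon> ^ length l * \<bar>pderivs l (\<lambda>x. c * g x) x\<bar> \<le> \<bar>c\<bar> * K" .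
qed

text \<open>Dilating by \<open>\<delta>\<close> turns scale one into scale \<open>\<delta>\<close> with the same bound: fixed functions of the
normalised variable satisfy bounds that are uniform in the support radius.\<close>

lemma bounded_Ck_affine:
  assumes "0 < \<delta>" "bounded_Ck n 1 K g"
  shows "bounded_Ck n \<delta> K (\<lambda>x. g ((x - c) /\<^sub>R \<delta>))"
  using assms(2)
proof (induction n arbitrary: g K)
  case 0
  have "continuous_on UNIV (\<lambda>x. g ((x - c) /\<^sub>R \<delta>))"
    by (rule continuous_on_compose2[OF Ck_continuous[OF bounded_Ck_imp_Ck[OF 0]]]) (auto intro!: continuous_intros)
  then show ?case using bounded_Ck_abs_le[OF 0] by (intro bounded_Ck_0I)
next
  case (Suc n)
  show ?case
  proof (rule bounded_Ck_SucI[OF assms(1), where g' = "\<lambda>i x. inverse \<delta> * pderiv_dir i g ((x - c) /\<^sub>R \<delta>)"])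
    show "continuous_on UNIV (\<lambda>x. g ((x - c) /\<^sub>R \<delta>))"
      by (rule continuous_on_compose2[OF Ck_continuous[OF bounded_Ck_imp_Ck[OF Suc.prems]]])
        (auto intro!: continuous_intros)
    show "has_pderiv i (\<lambda>x. g ((x - c) /\<^sub>R \<delta>)) (\<lambda>x. inverse \<delta> * pderiv_dir i g ((x - c) /\<^sub>R \<delta>))" for i
      by (intro has_pderiv_affine bounded_Ck_has_pderiv[OF Suc.prems])
    show "\<bar>g ((x - c) /\<^sub>R \<delta>)\<bar> \<le> K" for x using bounded_Ck_abs_le[OF Suc.prems] .
    have "bounded_Ck n \<delta> (\<bar>inverse \<delta>\<bar> * K) (\<lambda>x. inverse \<delta> * pderiv_dir i g ((x - c) /\<^sub>R \<delta>))" for i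
    proof -
      have "bounded_Ck n 1 K (pderiv_dir i g)" using bounded_Ck_pderiv[OF _ Suc.prems, of i] by simp
      from Suc.IH[OF this] have "bounded_Ck n \<delta> K (\<lambda>x. pderiv_dir i g ((x - c) /\<^sub>R \<delta>))" .
      then show ?thesis using assms(1) by (intro bounded_Ck_cmult) simp_all
    qed
    then show "bounded_Ck n \<delta> (K / \<delta>) (\<lambda>x. inverse \<delta> * pderiv_dir i g ((x - c) /\<^sub>R \<delta>))" for i
      using assms(1) by (simp add: field_simps)
  qed
qed

lemma pderivs_cong_open:
  assumes "open U" "\<And>x. x \<in> U \<Longrightarrow> f x = g x" "x \<in> U"
  shows "pderivs l f x = pderivs l g x"
  using assms(3)
proof (induction l arbitrary: x)
  case (Cons i l)
  have "((\<lambda>t::real. x + t *\<^sub>R axis i 1) \<longlongrightarrow> x + 0 *\<^sub>R axis i 1) (nhds 0)"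
    by (intro tendsto_intros filterlim_ident)
  then have "eventually (\<lambda>t. x + t *\<^sub>R axis i 1 \<in> U) (nhds (0::real))"
    using assms(1) Cons.prems by (simp add: tendsto_def)
  then have "eventually (\<lambda>t. pderivs l f (x + t *\<^sub>R axis i 1) = pderivs l g (x + t *\<^sub>R axis i 1)) (nhds (0::real))"
    by eventually_elim (rule Cons.IH)
  then show ?case by (simp add: pderivs_Cons pderiv_dir_def deriv_cong_ev)
qed (use assms in simp)

lemma pderivs_zero_outside:
  assumes "\<And>x. \<delta> < norm (x - c) \<Longrightarrow> g x = 0" "\<delta> < norm (x - c)"
  shows "pderivs l g x = 0"
proof -
  have "open {x. \<delta> < norm (x - c)}"
    by (intro open_Collect_less continuous_intros)
  then have "pderivs l g x = pderivs l (\<lambda>x. 0) x"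
    using assms by (intro pderivs_cong_open[of "{x. \<delta> < norm (x - c)}"]) auto
  then show ?thesis by (simp add: pderivs_const)
qed

lemma bounded_Ck_compact_support:
  fixes g :: "real^'n::finite \<Rightarrow> real"
  assumes "Ck n g" "\<And>x. 1 < norm x \<Longrightarrow> g x = 0"
  shows "\<exists>K. bounded_Ck n 1 K g"
proof -
  have "\<exists>K. \<forall>x. \<bar>pderivs l g x\<bar> \<le> K" if "length l \<le> n" for l
  proof -
    have "continuous_on UNIV (pderivs l g)"
      using Ck_pderivs[of l 0 g] Ck_mono[OF assms(1) that] by simp
    then have "compact (pderivs l g ` cball 0 1)"
      by (intro compact_continuous_image) (auto intro: continuous_on_subset)
    then obtain K where K: "\<forall>x\<in>cball 0 1. \<bar>pderivs l g x\<bar> \<le> K"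
      using compact_imp_bounded by (fastforce simp: bounded_iff)
    have "\<bar>pderivs l g x\<bar> \<le> max K 0" for x
    proof (cases "norm x \<le> 1")
      case False
      then have "pderivs l g x = 0"
        using assms(2) pderivs_zero_outside[of 1 0 g x l] by auto
      then show ?thesis by simp
    next
      case True
      then have "\<bar>pderivs l g x\<bar> \<le> K" using K by simp
      then show ?thesis by simp
    qed
    then show ?thesis by blast
  qed
  then obtain K where K: "\<And>l x. length l \<le> n \<Longrightarrow> \<bar>pderivs l g x\<bar> \<le> K l" by metis
  define B where "B = (\<Sum>l\<in>{l. length l \<le> n}. max 0 (K l))"
  have fin: "finite {l::'n list. length l \<le> n}"
    using finite_lists_length_le[of "UNIV::'n set" n] by simp
  have "\<bar>pderivs l g x\<bar> \<le> B" if "length l \<le> n" for l x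
  proof -
    have "max 0 (K l) \<le> B" unfolding B_def using fin that by (intro member_le_sum) auto
    then show ?thesis using K[OF that, of x] by simp
  qed
  then have "bounded_Ck n 1 B g" using assms(1) by (simp add: bounded_Ck_def)
  then show ?thesis ..
qed

lemma infsum_eq_sum:
  assumes "finite F" "F \<subseteq> S" "\<And>q. q \<in> S - F \<Longrightarrow> f q = 0"
  shows "infsum f S = sum f F"
proof -
  have "infsum f S = infsum f F"
    using assms by (intro infsum_cong_neutral) auto
  then show ?thesis using assms(1) by simp
qed

text \<open>Families in which the member with index \<open>q\<close> vanishes outside the closed ball of radius \<open>\<delta>\<close> around
\<open>c q\<close>, with finitely many centres in every ball. Near a given point such a sum is a fixed finite
sum, so it may be differentiated termwise.\<close>

context
  fixes S :: "'q set" and c :: "'q \<Rightarrow> real^'n::finite" and \<delta> :: real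
  assumes lf: "\<And>x \<rho>. finite {q \<in> S. norm (x - c q) \<le> \<rho>}"
begin

lemma locally_finite_sum_eq:
  assumes "\<And>q x. q \<in> S \<Longrightarrow> \<delta> < norm (x - c q) \<Longrightarrow> g q x = 0" "norm (x - x0) \<le> \<rho>"
  shows "(\<Sum>\<^sub>\<infinity>q\<in>S. g q x) = (\<Sum>q\<in>{q \<in> S. norm (x0 - c q) \<le> \<delta> + \<rho>}. g q x)"
proof (rule infsum_eq_sum[OF lf])
  fix q assume q: "q \<in> S - {q \<in> S. norm (x0 - c q) \<le> \<delta> + \<rho>}"
  then have "\<delta> < norm (x - c q)"
    using norm_triangle_ineq[of "x0 - x" "x - c q"] assms(2) by (auto simp: norm_minus_commute)
  then show "g q x = 0" using q assms(1) by auto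
qed auto

lemma locally_finite_sum_ball:
  assumes "\<And>q x. q \<in> S \<Longrightarrow> \<delta> < norm (x - c q) \<Longrightarrow> g q x = 0" "x \<in> ball x0 1"
  shows "(\<Sum>\<^sub>\<infinity>q\<in>S. g q x) = (\<Sum>q\<in>{q \<in> S. norm (x0 - c q) \<le> \<delta> + 1}. g q x)"
  using assms(2) by (intro locally_finite_sum_eq assms(1)) (auto simp: dist_norm norm_minus_commute)

lemma has_pderiv_locally_finite_sum:
  assumes g: "\<And>q x. q \<in> S \<Longrightarrow> \<delta> < norm (x - c q) \<Longrightarrow> g q x = 0"
    and g': "\<And>q. q \<in> S \<Longrightarrow> has_pderiv i (g q) (g' q)"
  shows "has_pderiv i (\<lambda>x. \<Sum>\<^sub>\<infinity>q\<in>S. g q x) (\<lambda>x. \<Sum>\<^sub>\<infinity>q\<in>S. g' q x)"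
  unfolding has_pderiv_def
proof
  fix x0
  define F where "F = {q \<in> S. norm (x0 - c q) \<le> \<delta> + 1}"
  have g'0: "g' q x = 0" if "q \<in> S" "\<delta> < norm (x - c q)" for q x
    using pderivs_zero_outside[of \<delta> "c q" "g q" x "[i]"] g that has_pderiv_eq[OF g'] by (simp add: pderivs_Cons)
  have "((\<lambda>t. \<Sum>q\<in>F. g q (x0 + t *\<^sub>R axis i 1)) has_real_derivative (\<Sum>q\<in>F. g' q x0)) (at 0)"
    using g' by (intro DERIV_sum) (auto simp: F_def has_pderiv_def)
  moreover have "(\<Sum>q\<in>F. g' q x0) = (\<Sum>\<^sub>\<infinity>q\<in>S. g' q x0)"
    unfolding F_def using g'0 by (intro locally_finite_sum_ball[symmetric]) auto
  moreover have "(\<Sum>q\<in>F. g q (x0 + t *\<^sub>R axis i 1)) = (\<Sum>\<^sub>\<infinity>q\<in>S. g q (x0 + t *\<^sub>R axis i 1))"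
    if "t \<in> ball 0 1" for t
    unfolding F_def using g that by (intro locally_finite_sum_ball[symmetric]) (auto simp: dist_norm)
  ultimately show "((\<lambda>t. \<Sum>\<^sub>\<infinity>q\<in>S. g q (x0 + t *\<^sub>R axis i 1)) has_real_derivative (\<Sum>\<^sub>\<infinity>q\<in>S. g' q x0)) (at 0)"
    using has_field_derivative_transform_within_open[of "\<lambda>t. \<Sum>q\<in>F. g q (x0 + t *\<^sub>R axis i 1)" _ 0 "ball 0 1"]
    by auto
qed

lemma Ck_locally_finite_sum:
  assumes "\<And>q x. q \<in> S \<Longrightarrow> \<delta> < norm (x - c q) \<Longrightarrow> g q x = 0"
    and "\<And>q. q \<in> S \<Longrightarrow> Ck n (g q)"
  shows "Ck n (\<lambda>x. \<Sum>\<^sub>\<infinity>q\<in>S. g q x)"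
proof -
  have cont: "continuous_on UNIV (\<lambda>x. \<Sum>\<^sub>\<infinity>q\<in>S. g q x)"
    if g: "\<And>q x. q \<in> S \<Longrightarrow> \<delta> < norm (x - c q) \<Longrightarrow> g q x = 0"
      and C: "\<And>q. q \<in> S \<Longrightarrow> Ck n (g q)" for g n
  proof (rule continuous_at_imp_continuous_on, intro ballI)
    fix x0
    define F where "F = {q \<in> S. norm (x0 - c q) \<le> \<delta> + 1}"
    have "continuous_on (ball x0 1) (\<lambda>x. \<Sum>q\<in>F. g q x)"
      using C by (intro continuous_on_sum continuous_on_subset[OF Ck_continuous]) (auto simp: F_def)
    moreover have "(\<Sum>q\<in>F. g q x) = (\<Sum>\<^sub>\<infinity>q\<in>S. g q x)" if "x \<in> ball x0 1" for x
      unfolding F_def using g that by (intro locally_finite_sum_ball[symmetric]) auto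
    ultimately have "continuous_on (ball x0 1) (\<lambda>x. \<Sum>\<^sub>\<infinity>q\<in>S. g q x)"
      by (subst (asm) continuous_on_cong) auto
    then show "isCont (\<lambda>x. \<Sum>\<^sub>\<infinity>q\<in>S. g q x) x0"
      by (simp add: continuous_on_eq_continuous_at)
  qed
  show ?thesis using assms
  proof (induction n arbitrary: g)
    case 0 then show ?case using cont[of g 0] by simp
  next
    case (Suc n)
    show ?case
    proof (rule Ck_SucI[where g' = "\<lambda>i x. \<Sum>\<^sub>\<infinity>q\<in>S. pderiv_dir i (g q) x"])
      show "continuous_on UNIV (\<lambda>x. \<Sum>\<^sub>\<infinity>q\<in>S. g q x)" using cont[OF Suc.prems] .
      show "has_pderiv i (\<lambda>x. \<Sum>\<^sub>\<infinity>q\<in>S. g q x) (\<lambda>x. \<Sum>\<^sub>\<infinity>q\<in>S. pderiv_dir i (g q) x)" for i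
        using Suc.prems by (intro has_pderiv_locally_finite_sum Ck_has_pderiv) auto
      show "Ck n (\<lambda>x. \<Sum>\<^sub>\<infinity>q\<in>S. pderiv_dir i (g q) x)" for i
      proof (rule Suc.IH)
        show "pderiv_dir i (g q) x = 0" if "q \<in> S" "\<delta> < norm (x - c q)" for q x
          using pderivs_zero_outside[of \<delta> "c q" "g q" x "[i]"] Suc.prems(1) that by (simp add: pderivs_Cons)
      qed (use Suc.prems in simp)
    qed
  qed
qed

lemma pderivs_locally_finite_sum:
  assumes "\<And>q x. q \<in> S \<Longrightarrow> \<delta> < norm (x - c q) \<Longrightarrow> g q x = 0"
    and "\<And>q. q \<in> S \<Longrightarrow> Ck (length l) (g q)"
  shows "pderivs l (\<lambda>x. \<Sum>\<^sub>\<infinity>q\<in>S. g q x) = (\<lambda>x. \<Sum>\<^sub>\<infinity>q\<in>S. pderivs l (g q) x)"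
  using assms
proof (induction l arbitrary: g rule: rev_induct)
  case (snoc i l)
  have "pderiv_dir i (\<lambda>x. \<Sum>\<^sub>\<infinity>q\<in>S. g q x) = (\<lambda>x. \<Sum>\<^sub>\<infinity>q\<in>S. pderiv_dir i (g q) x)"
    using snoc.prems by (intro has_pderiv_eq has_pderiv_locally_finite_sum Ck_has_pderiv[of "length l"]) auto
  moreover have "pderiv_dir i (g q) x = 0" if "q \<in> S" "\<delta> < norm (x - c q)" for q x
    using pderivs_zero_outside[of \<delta> "c q" "g q" x "[i]"] snoc.prems(1) that by (simp add: pderivs_Cons)
  ultimately show ?case using snoc by (simp add: pderivs_snoc)
qed simp

lemma locally_finite_sum_abs_le:
  assumes "\<And>q. q \<in> S \<Longrightarrow> \<delta> < norm (x - c q) \<Longrightarrow> f q = 0"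
    and "\<And>q. q \<in> S \<Longrightarrow> norm (x - c q) \<le> \<delta> \<Longrightarrow> \<bar>f q\<bar> \<le> K"
    and N: "real (card {q \<in> S. norm (x - c q) \<le> \<delta>}) \<le> N" and K: "0 \<le> K"
  shows "\<bar>\<Sum>\<^sub>\<infinity>q\<in>S. f q\<bar> \<le> N * K"
proof -
  let ?F = "{q \<in> S. norm (x - c q) \<le> \<delta>}"
  have "(\<Sum>\<^sub>\<infinity>q\<in>S. f q) = sum f ?F"
    using assms(1) by (intro infsum_eq_sum lf) auto
  then have "\<bar>\<Sum>\<^sub>\<infinity>q\<in>S. f q\<bar> \<le> (\<Sum>q\<in>?F. \<bar>f q\<bar>)" by simp
  also have "\<dots> \<le> real (card ?F) * K"
    using assms(2) by (intro sum_bounded_above) auto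
  also have "\<dots> \<le> N * K" using N K by (rule mult_right_mono)
  finally show ?thesis .
qed

lemma bounded_Ck_locally_finite_sum:
  assumes \<epsilon>: "0 < \<epsilon>" and g: "\<And>q x. q \<in> S \<Longrightarrow> \<delta> < norm (x - c q) \<Longrightarrow> g q x = 0"
    and C: "\<And>q. q \<in> S \<Longrightarrow> bounded_Ck n \<epsilon> K (g q)" and K: "0 \<le> K"
    and N: "\<And>x. real (card {q \<in> S. norm (x - c q) \<le> \<delta>}) \<le> N"
  shows "bounded_Ck n \<epsilon> (N * K) (\<lambda>x. \<Sum>\<^sub>\<infinity>q\<in>S. g q x)"
  unfolding bounded_Ck_def
proof (intro conjI allI impI)
  show "Ck n (\<lambda>x. \<Sum>\<^sub>\<infinity>q\<in>S. g q x)" using bounded_Ck_imp_Ck[OF C] by (intro Ck_locally_finite_sum g)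
  fix l :: "'n list" and x assume l: "length l \<le> n"
  have "pderivs l (\<lambda>x. \<Sum>\<^sub>\<infinity>q\<in>S. g q x) = (\<lambda>x. \<Sum>\<^sub>\<infinity>q\<in>S. pderivs l (g q) x)"
    using Ck_mono[OF bounded_Ck_imp_Ck[OF C] l] by (intro pderivs_locally_finite_sum g)
  moreover have "\<bar>\<Sum>\<^sub>\<infinity>q\<in>S. pderivs l (g q) x\<bar> \<le> N * (K / \<epsilon> ^ length l)"
  proof (rule locally_finite_sum_abs_le[OF _ _ N])
    show "pderivs l (g q) x = 0" if "q \<in> S" "\<delta> < norm (x - c q)" for q
      using pderivs_zero_outside[of \<delta> "c q"] g that by auto
    show "\<bar>pderivs l (g q) x\<bar> \<le> K / \<epsilon> ^ length l" if "q \<in> S" for q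
      using bounded_Ck_pderivs_le[OF C[OF that] l, of x] \<epsilon> by (simp add: field_simps)
  qed (use K \<epsilon> in simp)
  ultimately show "\<epsilon> ^ length l * \<bar>pderivs l (\<lambda>x. \<Sum>\<^sub>\<infinity>q\<in>S. g q x) x\<bar> \<le> N * K"
    using \<epsilon> by (simp add: field_simps)
qed

end

section \<open>Polynomials and Taylor expansion\<close>

lemma finite_mi: "finite {\<alpha> :: 'n::finite \<Rightarrow> nat. mi_abs \<alpha> \<le> r}"
proof (rule finite_subset)
  show "{\<alpha> :: 'n \<Rightarrow> nat. mi_abs \<alpha> \<le> r} \<subseteq> PiE UNIV (\<lambda>_. {..r})"
  proof (clarsimp simp: PiE_UNIV_domain)
    fix \<alpha> :: "'n \<Rightarrow> nat" and i assume "mi_abs \<alpha> \<le> r"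
    moreover have "\<alpha> i \<le> mi_abs \<alpha>" unfolding mi_abs_def by (intro member_le_sum) auto
    ultimately show "\<alpha> i \<le> r" by simp
  qed
qed (intro finite_PiE; simp)

lemma poly_spaceI: "(\<And>x. q x = (\<Sum>\<alpha> | mi_abs \<alpha> \<le> r. c \<alpha> * (\<Prod>i\<in>UNIV. (x $ i) ^ \<alpha> i))) \<Longrightarrow> q \<in> poly_space r"
  by (auto simp: poly_space_def)

lemma poly_space_add: "f \<in> poly_space r \<Longrightarrow> g \<in> poly_space r \<Longrightarrow> (\<lambda>x. f x + g x) \<in> poly_space r"
proof -
  assume "f \<in> poly_space r" "g \<in> poly_space r"
  then obtain c d where
    "\<And>x. f x = (\<Sum>\<alpha> | mi_abs \<alpha> \<le> r. c \<alpha> * (\<Prod>i\<in>UNIV. (x $ i) ^ \<alpha> i))"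
    "\<And>x. g x = (\<Sum>\<alpha> | mi_abs \<alpha> \<le> r. d \<alpha> * (\<Prod>i\<in>UNIV. (x $ i) ^ \<alpha> i))"
    unfolding poly_space_def by auto
  then show ?thesis
    by (intro poly_spaceI[where c = "\<lambda>\<alpha>. c \<alpha> + d \<alpha>"]) (simp add: sum.distrib algebra_simps)
qed

lemma poly_space_cmult: "f \<in> poly_space r \<Longrightarrow> (\<lambda>x. a * f x) \<in> poly_space r"
proof -
  assume "f \<in> poly_space r"
  then obtain c where
    "\<And>x. f x = (\<Sum>\<alpha> | mi_abs \<alpha> \<le> r. c \<alpha> * (\<Prod>i\<in>UNIV. (x $ i) ^ \<alpha> i))"
    unfolding poly_space_def by auto
  then show ?thesis
    by (intro poly_spaceI[where c = "\<lambda>\<alpha>. a * c \<alpha>"]) (simp add: sum_distrib_left mult.assoc)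
qed

lemma poly_space_monomial:
  fixes \<alpha> :: "'n::finite \<Rightarrow> nat"
  assumes "mi_abs \<alpha> \<le> r"
  shows "(\<lambda>x. \<Prod>i\<in>UNIV. (x $ i) ^ \<alpha> i) \<in> poly_space r"
proof (rule poly_spaceI)
  fix x :: "real^'n"
  have "(\<Sum>\<beta> | mi_abs \<beta> \<le> r. (if \<beta> = \<alpha> then 1 else 0) * (\<Prod>i\<in>UNIV. (x $ i) ^ \<beta> i))
     = (\<Sum>\<beta> | mi_abs \<beta> \<le> r. (if \<beta> = \<alpha> then \<Prod>i\<in>UNIV. (x $ i) ^ \<beta> i else 0))"
    by (intro sum.cong) auto
  also have "\<dots> = (\<Prod>i\<in>UNIV. (x $ i) ^ \<alpha> i)"
    using assms by (simp add: finite_mi)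
  finally show "(\<Prod>i\<in>UNIV. (x $ i) ^ \<alpha> i)
     = (\<Sum>\<beta> | mi_abs \<beta> \<le> r. (if \<beta> = \<alpha> then 1 else 0) * (\<Prod>i\<in>UNIV. (x $ i) ^ \<beta> i))" by simp
qed

lemma poly_space_const: "(\<lambda>x. a) \<in> poly_space r"
  using poly_space_cmult[OF poly_space_monomial[of "\<lambda>i. 0" r], of a] by (simp add: mi_abs_def)

lemma poly_space_sum: "(\<And>a. a \<in> F \<Longrightarrow> f a \<in> poly_space r) \<Longrightarrow> (\<lambda>x. \<Sum>a\<in>F. f a x) \<in> poly_space r"
  by (induction F rule: infinite_finite_induct) (auto intro: poly_space_const poly_space_add)

lemma poly_space_coord: "(\<lambda>x :: real^'n::finite. x $ i) \<in> poly_space 1"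
proof -
  define \<alpha> where "\<alpha> j = (if j = i then 1 else 0::nat)" for j
  have "mi_abs \<alpha> \<le> 1" by (simp add: mi_abs_def \<alpha>_def)
  moreover have "(\<Prod>j\<in>UNIV. (x $ j) ^ \<alpha> j) = x $ i" for x :: "real^'n"
  proof -
    have "(\<Prod>j\<in>UNIV. (x $ j) ^ \<alpha> j) = (\<Prod>j\<in>UNIV. if j = i then x $ j else 1)"
      by (intro prod.cong) (auto simp: \<alpha>_def)
    then show ?thesis by simp
  qed
  ultimately show ?thesis using poly_space_monomial[of \<alpha> 1] by simp
qed

lemma poly_space_mono:
  assumes "f \<in> poly_space r" "r \<le> s" shows "f \<in> poly_space s"
proof -
  obtain c where c: "f = (\<lambda>x. \<Sum>\<alpha> | mi_abs \<alpha> \<le> r. c \<alpha> * (\<Prod>i\<in>UNIV. (x $ i) ^ \<alpha> i))"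
    using assms(1) by (auto simp: poly_space_def)
  show ?thesis unfolding c
    using assms(2) by (intro poly_space_sum poly_space_cmult poly_space_monomial) auto
qed

lemma poly_space_mult:
  assumes "f \<in> poly_space r" "g \<in> poly_space s"
  shows "(\<lambda>x. f x * g x) \<in> poly_space (r + s)"
proof -
  obtain c where c: "f = (\<lambda>x. \<Sum>\<alpha> | mi_abs \<alpha> \<le> r. c \<alpha> * (\<Prod>i\<in>UNIV. (x $ i) ^ \<alpha> i))"
    using assms(1) by (auto simp: poly_space_def)
  obtain d where d: "g = (\<lambda>x. \<Sum>\<alpha> | mi_abs \<alpha> \<le> s. d \<alpha> * (\<Prod>i\<in>UNIV. (x $ i) ^ \<alpha> i))"
    using assms(2) by (auto simp: poly_space_def)
  have "(\<lambda>x. f x * g x) = (\<lambda>x. \<Sum>\<alpha> | mi_abs \<alpha> \<le> r. \<Sum>\<beta> | mi_abs \<beta> \<le> s.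
     (c \<alpha> * d \<beta>) * (\<Prod>i\<in>UNIV. (x $ i) ^ (\<alpha> i + \<beta> i)))"
    by (simp add: c d sum_product power_add prod.distrib mult_ac)
  also have "\<dots> \<in> poly_space (r + s)"
    by (intro poly_space_sum poly_space_cmult poly_space_monomial) (auto simp: mi_abs_def sum.distrib)
  finally show ?thesis .
qed

lemma poly_space_power: "f \<in> poly_space 1 \<Longrightarrow> (\<lambda>x. f x ^ n) \<in> poly_space n"
proof (induction n)
  case (Suc n)
  then show ?case using poly_space_mult[of f 1 "\<lambda>x. f x ^ n" n] by simp
qed (simp add: poly_space_const)

lemma poly_space_prod:
  "finite F \<Longrightarrow> (\<And>i. i \<in> F \<Longrightarrow> f i \<in> poly_space (\<alpha> i)) \<Longrightarrow> (\<lambda>x. \<Prod>i\<in>F. f i x) \<in> poly_space (\<Sum>i\<in>F. \<alpha> i)"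
proof (induction F rule: finite_induct)
  case (insert i F)
  then show ?case using poly_space_mult[of "f i" "\<alpha> i" "\<lambda>x. \<Prod>i\<in>F. f i x"] by simp
qed (simp add: poly_space_const)

lemma poly_space_affine:
  assumes "q \<in> poly_space r"
  shows "(\<lambda>u. q (x - a *\<^sub>R u)) \<in> poly_space r"
proof -
  obtain c where c: "q = (\<lambda>x. \<Sum>\<alpha> | mi_abs \<alpha> \<le> r. c \<alpha> * (\<Prod>i\<in>UNIV. (x $ i) ^ \<alpha> i))"
    using assms by (auto simp: poly_space_def)
  have lin: "(\<lambda>u. (x - a *\<^sub>R u) $ i) \<in> poly_space 1" for i
    using poly_space_add[OF poly_space_const[of "x $ i"] poly_space_cmult[OF poly_space_coord, of "- a" i]]
    by simp
  have "(\<lambda>u. \<Prod>i\<in>UNIV. ((x - a *\<^sub>R u) $ i) ^ \<alpha> i) \<in> poly_space r" if "mi_abs \<alpha> \<le> r" for \<alpha>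
  proof -
    have "(\<lambda>u. \<Prod>i\<in>UNIV. ((x - a *\<^sub>R u) $ i) ^ \<alpha> i) \<in> poly_space (\<Sum>i\<in>UNIV. \<alpha> i)"
      by (intro poly_space_prod poly_space_power lin) auto
    then show ?thesis using that poly_space_mono[of _ "mi_abs \<alpha>" r] by (simp add: mi_abs_def)
  qed
  then show ?thesis unfolding c
    by (intro poly_space_sum poly_space_cmult) auto
qed

text \<open>With the normalisation by factorials, differentiation lowers an exponent without creating
factors.\<close>

definition taylor_monomial :: "real^'n::finite \<Rightarrow> ('n \<Rightarrow> nat) \<Rightarrow> real^'n \<Rightarrow> real" where
  "taylor_monomial x \<alpha> y = (\<Prod>i\<in>UNIV. (y $ i - x $ i) ^ \<alpha> i / fact (\<alpha> i))"

lemma taylor_monomial_poly: 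
  assumes "mi_abs \<alpha> \<le> r" shows "taylor_monomial x \<alpha> \<in> poly_space r"
proof -
  have lin: "(\<lambda>y. y $ i - x $ i) \<in> poly_space 1" for i
    using poly_space_add[OF poly_space_const[of "- x $ i"] poly_space_coord[of i]] by simp
  have "(\<lambda>y. \<Prod>i\<in>UNIV. (1 / fact (\<alpha> i)) * (y $ i - x $ i) ^ \<alpha> i) \<in> poly_space (\<Sum>i\<in>UNIV. \<alpha> i)"
    by (intro poly_space_prod poly_space_cmult poly_space_power lin) auto
  then show ?thesis
    using assms poly_space_mono[of _ "mi_abs \<alpha>"] by (auto simp: mi_abs_def taylor_monomial_def[abs_def])
qed

lemma has_pderiv_taylor_monomial:
  "has_pderiv i (taylor_monomial x \<alpha>) (if \<alpha> i = 0 then (\<lambda>y. 0) else taylor_monomial x (\<alpha>(i := \<alpha> i - 1)))"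
  unfolding has_pderiv_def
proof
  fix y
  define P where "P = (\<Prod>j\<in>UNIV - {i}. (y $ j - x $ j) ^ \<alpha> j / fact (\<alpha> j))"
  have split: "taylor_monomial x \<beta> (y + t *\<^sub>R axis i 1) = (t + (y $ i - x $ i)) ^ \<beta> i / fact (\<beta> i) * P"
    if "\<And>j. j \<noteq> i \<Longrightarrow> \<beta> j = \<alpha> j" for \<beta> t
  proof -
    have "(\<Prod>j\<in>UNIV - {i}. ((y + t *\<^sub>R axis i 1) $ j - x $ j) ^ \<beta> j / fact (\<beta> j)) = P"
      unfolding P_def by (intro prod.cong) (auto simp: axis_def that)
    then show ?thesis
      unfolding taylor_monomial_def
      by (subst prod.remove[of _ i]) (auto simp: algebra_simps)
  qed
  have eq: "(\<lambda>t. taylor_monomial x \<alpha> (y + t *\<^sub>R axis i 1)) = (\<lambda>t. (t + (y $ i - x $ i)) ^ \<alpha> i / fact (\<alpha> i) * P)"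
    using split[of \<alpha>] by auto
  show "((\<lambda>t. taylor_monomial x \<alpha> (y + t *\<^sub>R axis i 1)) has_real_derivative
     (if \<alpha> i = 0 then (\<lambda>y. 0) else taylor_monomial x (\<alpha>(i := \<alpha> i - 1))) y) (at 0)"
  proof (cases "\<alpha> i")
    case (Suc n)
    have "(\<lambda>t. (t + (y $ i - x $ i)) ^ Suc n / fact (Suc n) * P) = 
       (\<lambda>t. (t + (y $ i - x $ i)) ^ Suc n * (P / fact (Suc n)))" by simp
    moreover have "((\<lambda>t. (t + (y $ i - x $ i)) ^ Suc n * (P / fact (Suc n))) has_real_derivative
        (1 + real n) * (y $ i - x $ i) ^ n * (P / fact (Suc n))) (at 0)"
      by (rule derivative_eq_intros refl | simp)+
    moreover have "(1 + real n) * (y $ i - x $ i) ^ n * (P / fact (Suc n)) = (y $ i - x $ i) ^ n / fact n * P"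
    proof -
      have "fact (Suc n) = (1 + real n) * fact n" by simp
      moreover have "1 + real n \<noteq> 0" by linarith
      ultimately show ?thesis by (simp only: times_divide_eq_left times_divide_eq_right mult_divide_mult_cancel_left mult.assoc) simp
    qed
    ultimately show ?thesis
      unfolding eq using split[of "\<alpha>(i := n)" 0] Suc by simp
  qed (simp add: eq)
qed

lemma Ck_taylor_monomial: "Ck n (taylor_monomial x \<alpha>)"
proof (induction n arbitrary: \<alpha>)
  case 0
  show ?case unfolding taylor_monomial_def[abs_def] by (auto intro!: continuous_intros)
next
  case (Suc n)
  show ?case
  proof (rule Ck_SucI[OF _ has_pderiv_taylor_monomial])
    show "continuous_on UNIV (taylor_monomial x \<alpha>)"
      unfolding taylor_monomial_def[abs_def] by (auto intro!: continuous_intros)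
  qed (use Suc Ck_const in auto)
qed

lemma mi_deriv_taylor_monomial:
  "mi_deriv \<beta> (taylor_monomial x \<alpha>) =
     (if \<forall>i. \<beta> i \<le> \<alpha> i then taylor_monomial x (\<lambda>i. \<alpha> i - \<beta> i) else (\<lambda>y. 0))"
proof -
  have 0: "(pderiv_dir i ^^ n) (\<lambda>y. 0) = (\<lambda>y. 0)" for i :: 'a and n
    by (induction n) (auto simp: has_pderiv_eq[OF has_pderiv_const])
  have 1: "(pderiv_dir i ^^ n) (taylor_monomial x \<alpha>) =
     (if n \<le> \<alpha> i then taylor_monomial x (\<alpha>(i := \<alpha> i - n)) else (\<lambda>y. 0))" for i n \<alpha>
    by (induction n) (auto simp: has_pderiv_eq[OF has_pderiv_const] has_pderiv_eq[OF has_pderiv_taylor_monomial]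
        intro!: arg_cong[where f = "taylor_monomial x"])
  have "foldr (\<lambda>i. pderiv_dir i ^^ \<beta> i) xs (taylor_monomial x \<alpha>) =
     (if \<forall>i\<in>set xs. \<beta> i \<le> \<alpha> i then taylor_monomial x (\<lambda>i. if i \<in> set xs then \<alpha> i - \<beta> i else \<alpha> i)
      else (\<lambda>y. 0))" if "distinct xs" for xs
    using that
  proof (induction xs)
    case (Cons i xs)
    have "(\<lambda>j. if j \<in> set xs then \<alpha> j - \<beta> j else \<alpha> j)(i := \<alpha> i - \<beta> i)
       = (\<lambda>j. if j \<in> set (i # xs) then \<alpha> j - \<beta> j else \<alpha> j)" by auto
    then show ?case using Cons by (auto simp: 0 1)
  qed simp
  from this[OF distinct_coords] show ?thesis by (simp add: mi_deriv_def set_coords)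
qed

lemma taylor_monomial_center: "taylor_monomial x \<alpha> x = (if \<alpha> = (\<lambda>i. 0) then 1 else 0)"
proof (cases "\<alpha> = (\<lambda>i. 0)")
  case False
  then obtain i where "\<alpha> i \<noteq> 0" by auto
  then have "(x $ i - x $ i) ^ \<alpha> i / fact (\<alpha> i) = 0" by simp
  then have "taylor_monomial x \<alpha> x = 0"
    unfolding taylor_monomial_def by (intro prod_zero) auto
  then show ?thesis using False by simp
qed (simp add: taylor_monomial_def)

lemma mi_deriv_sum:
  assumes "\<And>a. a \<in> F \<Longrightarrow> Ck (mi_abs \<beta>) (f a)"
  shows "mi_deriv \<beta> (\<lambda>x. \<Sum>a\<in>F. c a * f a x) = (\<lambda>x. \<Sum>a\<in>F. c a * mi_deriv \<beta> (f a) x)"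
proof -
  have "mi_deriv \<beta> (\<lambda>x. \<Sum>a\<in>F. c a * f a x) = (\<lambda>x. \<Sum>a\<in>F. pderivs (mi_list \<beta>) (\<lambda>x. c a * f a x) x)"
    unfolding mi_deriv_eq_pderivs using assms
    by (intro pderivs_sum Ck_mult Ck_const) (auto simp: length_mi_list)
  also have "\<dots> = (\<lambda>x. \<Sum>a\<in>F. c a * mi_deriv \<beta> (f a) x)"
    unfolding mi_deriv_eq_pderivs using assms
    by (intro ext sum.cong) (auto simp: length_mi_list pderivs_cmult)
  finally show ?thesis .
qed

lemma Ck_poly:
  assumes "q \<in> poly_space r" shows "Ck n q"
proof -
  obtain c where c: "\<And>x. q x = (\<Sum>\<alpha> | mi_abs \<alpha> \<le> r. c \<alpha> * (\<Prod>i\<in>UNIV. (x $ i) ^ \<alpha> i))"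
    using assms by (auto simp: poly_space_def)
  have "q = (\<lambda>x. \<Sum>\<alpha> | mi_abs \<alpha> \<le> r. (c \<alpha> * (\<Prod>i\<in>UNIV. fact (\<alpha> i))) * taylor_monomial 0 \<alpha> x)"
    unfolding c taylor_monomial_def
    by (intro ext sum.cong) (simp_all add: prod_dividef)
  then show ?thesis by (auto intro!: Ck_sum Ck_mult Ck_const Ck_taylor_monomial)
qed

text \<open>At \<open>x\<close>, the derivative of order \<open>\<beta>\<close> of the monomial with exponent \<open>\<alpha>\<close> is one if \<open>\<alpha> = \<beta>\<close> and
zero otherwise, so the derivatives of \<open>g\<close> at \<open>x\<close> are the coefficients. Symmetry of the mixed
derivatives extends the matching from multi-indices to lists.\<close>

lemma Taylor_polynomial:
  fixes g :: "real^'n::finite \<Rightarrow> real"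
  assumes g: "Ck r g"
  obtains T where "T \<in> poly_space r"
    "\<And>l. length l \<le> r \<Longrightarrow> pderivs l T x = pderivs l g x"
    "\<And>l. r < length l \<Longrightarrow> pderivs l T = (\<lambda>y. 0)"
proof
  define T where "T = (\<lambda>y. \<Sum>\<alpha> | mi_abs \<alpha> \<le> r. mi_deriv \<alpha> g x * taylor_monomial x \<alpha> y)"
  show T: "T \<in> poly_space r"
    unfolding T_def by (intro poly_space_sum poly_space_cmult taylor_monomial_poly) auto
  have D: "mi_deriv \<beta> T = (\<lambda>y. \<Sum>\<alpha> | mi_abs \<alpha> \<le> r. mi_deriv \<alpha> g x * mi_deriv \<beta> (taylor_monomial x \<alpha>) y)" for \<beta>
    unfolding T_def by (intro mi_deriv_sum Ck_taylor_monomial)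
  have at_x: "mi_deriv \<beta> (taylor_monomial x \<alpha>) x = (if \<alpha> = \<beta> then 1 else 0)" for \<alpha> \<beta> :: "'n \<Rightarrow> nat"
  proof -
    have "(\<lambda>i. \<alpha> i - \<beta> i) = (\<lambda>i. 0) \<longleftrightarrow> \<alpha> = \<beta>" if "\<forall>i. \<beta> i \<le> \<alpha> i"
      using that by (auto simp: fun_eq_iff le_antisym)
    then show ?thesis
      by (auto simp: mi_deriv_taylor_monomial taylor_monomial_center)
  qed
  fix l :: "'n list"
  note l = pderivs_eq_mi_deriv[OF Ck_poly[OF T], of l]
  {
    assume len: "length l \<le> r"
    note lg = pderivs_eq_mi_deriv[OF Ck_mono[OF g len]]
    have "pderivs l T x = (\<Sum>\<alpha> | mi_abs \<alpha> \<le> r. if \<alpha> = count (mset l) then mi_deriv \<alpha> g x else 0)"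
      unfolding l(1) D by (intro sum.cong) (auto simp: at_x)
    also have "\<dots> = pderivs l g x" using len l(2) by (simp add: finite_mi lg(1))
    finally show "pderivs l T x = pderivs l g x" .
  next
    assume len: "r < length l"
    have "mi_deriv (count (mset l)) (taylor_monomial x \<alpha>) = (\<lambda>y. 0)" if "mi_abs \<alpha> \<le> r" for \<alpha>
    proof -
      have "\<not> (\<forall>i. count (mset l) i \<le> \<alpha> i)"
      proof
        assume "\<forall>i. count (mset l) i \<le> \<alpha> i"
        then have "mi_abs (count (mset l)) \<le> mi_abs \<alpha>"
          unfolding mi_abs_def by (intro sum_mono) auto
        then show False using that len l(2) by simp
      qed
      then show ?thesis by (auto simp: mi_deriv_taylor_monomial)
    qed
    then show "pderivs l T = (\<lambda>y. 0)" unfolding l(1) D by simp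
  }
qed

text \<open>Induction on the order: the partial derivatives satisfy the same hypotheses with one order less.
The function is recovered from them by walking from \<open>x\<close> to \<open>y\<close> parallel to the axes; every point
of this walk is no farther from \<open>x\<close> than \<open>y\<close> is, so the walk stays within the ball on which the
bound is assumed.\<close>

lemma vanishing_jet_bound:
  fixes R :: "real^'n::finite \<Rightarrow> real"
  assumes "Ck n R" "\<And>l. length l < n \<Longrightarrow> pderivs l R x = 0"
    and "\<And>l y. length l = n \<Longrightarrow> norm (y - x) < \<delta> \<Longrightarrow> \<bar>pderivs l R y\<bar> \<le> K"
    and "norm (y - x) < \<delta>"
  shows "\<bar>R y\<bar> \<le> (real CARD('n) * norm (y - x)) ^ n * K"
  using assms
proof (induction n arbitrary: R y)
  case 0
  then show ?case using 0(3)[of "[]" y] by simp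
next
  case (Suc n)
  define s where "s = norm (y - x)"
  define B where "B = (real CARD('n) * s) ^ n * K"
  \<comment> \<open>There is a derivative of order \<open>Suc n\<close> whose absolute value \<open>K\<close> bounds.\<close>
  have K: "0 \<le> K" using Suc.prems(3)[of "replicate (Suc n) undefined" y] Suc.prems(4) by force
  have D: "\<bar>pderiv_dir i R z\<bar> \<le> B" if z: "norm (z - x) \<le> s" for i z
  proof -
    have "\<bar>pderiv_dir i R z\<bar> \<le> (real CARD('n) * norm (z - x)) ^ n * K"
    proof (rule Suc.IH)
      show "pderivs l (pderiv_dir i R) x = 0" if "length l < n" for l
        using Suc.prems(2)[of "l @ [i]"] that by (simp add: pderivs_snoc)
      show "\<bar>pderivs l (pderiv_dir i R) y\<bar> \<le> K" if "length l = n" "norm (y - x) < \<delta>" for l y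
        using Suc.prems(3)[of "l @ [i]"] that by (simp add: pderivs_snoc)
    qed (use Suc.prems z in \<open>auto simp: s_def\<close>)
    also have "\<dots> \<le> B" unfolding B_def using z K
      by (intro mult_right_mono power_mono mult_left_mono) auto
    finally show ?thesis .
  qed
  \<comment> \<open>The corners of the walk: the coordinates in \<open>I\<close> have already been changed.\<close>
  define z where "z I = (\<chi> j. if j \<in> I then y $ j else x $ j)" for I
  have "\<bar>R (z I)\<bar> \<le> real (card I) * (B * s)" if "finite I" for I
    using that
  proof (induction I rule: finite_induct)
    case empty
    have "z {} = x" by (simp add: z_def vec_eq_iff)
    then show ?case using Suc.prems(2)[of "[]"] by simp
  next
    case (insert i I)
    define h where "h = y $ i - x $ i"
    have h: "\<bar>h\<bar> \<le> s" using component_le_norm_cart[of "y - x" i] by (simp add: h_def s_def)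
    have zi: "z (insert i I) = z I + h *\<^sub>R axis i 1"
      using insert.hyps by (auto simp: z_def vec_eq_iff h_def axis_def)
    have near: "norm (z I + t *\<^sub>R axis i 1 - x) \<le> s" if "t \<in> closed_segment 0 h" for t
      unfolding s_def
    proof (rule norm_le_componentwise_cart)
      fix j
      have "\<bar>t\<bar> \<le> \<bar>h\<bar>" using that by (auto simp: closed_segment_eq_real_ivl split: if_splits)
      then show "norm ((z I + t *\<^sub>R axis i 1 - x) $ j) \<le> norm ((y - x) $ j)"
        using insert.hyps by (auto simp: z_def axis_def h_def)
    qed
    have "norm (R (z I + h *\<^sub>R axis i 1) - R (z I + 0 *\<^sub>R axis i 1)) \<le> B * norm (h - 0)"
    proof (rule field_differentiable_bound[of "closed_segment 0 h"])
      show "((\<lambda>t. R (z I + t *\<^sub>R axis i 1)) has_real_derivative pderiv_dir i R (z I + t *\<^sub>R axis i 1))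
         (at t within closed_segment 0 h)" for t
        by (rule has_field_derivative_at_within[OF has_pderiv_line[OF Ck_has_pderiv[OF Suc.prems(1)]]])
      show "norm (pderiv_dir i R (z I + t *\<^sub>R axis i 1)) \<le> B" if "t \<in> closed_segment 0 h" for t
        using D[OF near[OF that]] by simp
    qed auto
    also have "\<dots> \<le> B * s"
      using h D[of x] by (intro mult_left_mono) (auto simp: s_def intro: order_trans[OF abs_ge_zero])
    finally have "\<bar>R (z (insert i I)) - R (z I)\<bar> \<le> B * s" by (simp add: zi)
    then have "\<bar>R (z (insert i I))\<bar> \<le> B * s + \<bar>R (z I)\<bar>" by linarith
    then show ?case using insert by (simp add: algebra_simps)
  qed
  from this[of UNIV] have "\<bar>R (z UNIV)\<bar> \<le> real CARD('n) * (B * s)" by simp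
  moreover have "z UNIV = y" by (simp add: z_def vec_eq_iff)
  ultimately show ?case by (simp add: B_def s_def mult_ac)
qed

section \<open>Inverses of symmetric matrices and lattice points\<close>

lemma symmetric_dot:
  fixes A :: "real^'b^'b::finite"
  assumes "transpose A = A"
  shows "(A *v x) \<bullet> y = x \<bullet> (A *v y)"
  using assms dot_lmul_matrix[of x A y] transpose_matrix_vector[of A x] by simp

text \<open>\<open>lambda_min\<close> is a minimum over the set of eigenvalues and says something only if this set is
finite: eigenvectors to different eigenvalues of a symmetric matrix are orthogonal, hence linearly
independent.\<close>

lemma finite_eigenvalues_symmetric:
  fixes A :: "real^'b^'b::finite"
  assumes "transpose A = A"
  shows "finite {l. \<exists>v. v \<noteq> 0 \<and> A *v v = l *\<^sub>R v}"
proof -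
  let ?E = "{l. \<exists>v. v \<noteq> 0 \<and> A *v v = l *\<^sub>R v}"
  obtain v where v: "\<And>l. l \<in> ?E \<Longrightarrow> v l \<noteq> 0 \<and> A *v v l = l *\<^sub>R v l"
  proof -
    have "\<forall>l\<in>?E. \<exists>v. v \<noteq> 0 \<and> A *v v = l *\<^sub>R v" by simp
    from bchoice[OF this] show ?thesis using that by blast
  qed
  have orth: "v l \<bullet> v k = 0" if "l \<in> ?E" "k \<in> ?E" "l \<noteq> k" for l k
  proof -
    have "l * (v l \<bullet> v k) = k * (v l \<bullet> v k)"
      using symmetric_dot[OF assms, of "v l" "v k"] v[OF that(1)] v[OF that(2)] by simp
    then show ?thesis using that(3) by simp
  qed
  have inj: "inj_on v ?E"
  proof (rule inj_onI, rule ccontr)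
    fix l k assume "l \<in> ?E" "k \<in> ?E" "v l = v k" "l \<noteq> k"
    then show False using orth[of l k] v[of l] by simp
  qed
  have "pairwise orthogonal (v ` ?E)"
    using orth unfolding pairwise_def orthogonal_def by blast
  moreover have "0 \<notin> v ` ?E" using v by force
  ultimately have "finite (v ` ?E)"
    by (intro independent_imp_finite pairwise_orthogonal_independent)
  then show ?thesis using inj by (rule finite_imageD)
qed

text \<open>The quadratic form attains its minimum \<open>l\<close> over the unit sphere at some \<open>u\<close>, and \<open>l\<close> is an
eigenvalue. Otherwise \<open>w = A u - l u\<close> is nonzero, and moving from \<open>u\<close> a short way in the direction
\<open>- w\<close> pushes the form below \<open>l\<close> times the squared norm.\<close>

lemma lambda_min_quadratic_form:
  fixes A :: "real^'b^'b::finite"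
  assumes sym: "transpose A = A"
  shows "lambda_min A * (norm v)\<^sup>2 \<le> v \<bullet> (A *v v)"
proof -
  define f where "f v = v \<bullet> (A *v v)" for v
  have cont: "continuous_on (sphere 0 1) f"
    unfolding f_def by (intro continuous_intros matrix_vector_mult_linear_continuous_on)
  have "axis undefined 1 \<in> sphere (0::real^'b) 1" by simp
  then obtain u where u: "norm u = 1" "\<And>v. norm v = 1 \<Longrightarrow> f u \<le> f v"
    using continuous_attains_inf[OF compact_sphere _ cont] by (metis dist_0_norm empty_iff mem_sphere)
  define l where "l = f u"
  have ge: "l * (norm v)\<^sup>2 \<le> f v" for v
  proof (cases "v = 0")
    case False
    have "f v = (norm v)\<^sup>2 * f (v /\<^sub>R norm v)"
      using False by (simp add: f_def matrix_vector_mult_scaleR power2_eq_square field_simps)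
    moreover have "l \<le> f (v /\<^sub>R norm v)" unfolding l_def using False by (intro u(2)) simp
    ultimately show ?thesis by (metis mult.commute mult_right_mono zero_le_power2)
  qed (simp add: f_def)
  define w where "w = A *v u - l *\<^sub>R u"
  define c where "c = f w - l * (norm w)\<^sup>2"
  have quad: "0 \<le> 2 * t * (norm w)\<^sup>2 + t\<^sup>2 * c" for t
  proof -
    have eqF: "f (u + t *\<^sub>R w) = f u + t * (u \<bullet> (A *v w)) + t * (w \<bullet> (A *v u)) + t\<^sup>2 * f w"
      by (simp add: f_def matrix_vector_right_distrib matrix_vector_mult_scaleR
          inner_add_left inner_add_right power2_eq_square algebra_simps)
    have eqS: "u \<bullet> (A *v w) = w \<bullet> (A *v u)"
      using symmetric_dot[OF sym, of u w] by (simp add: inner_commute)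
    have eqN: "(norm (u + t *\<^sub>R w))\<^sup>2 = 1 + 2 * t * (w \<bullet> u) + t\<^sup>2 * (norm w)\<^sup>2"
      using u(1) unfolding power2_norm_eq_inner norm_eq_1
      by (simp add: inner_add_left inner_add_right inner_commute power2_eq_square algebra_simps)
    have eqW: "(norm w)\<^sup>2 = w \<bullet> (A *v u) - l * (w \<bullet> u)"
      by (simp add: power2_norm_eq_inner w_def inner_diff_right)
    have "f (u + t *\<^sub>R w) - l * (norm (u + t *\<^sub>R w))\<^sup>2
        = 2 * t * (w \<bullet> (A *v u) - l * (w \<bullet> u)) + t\<^sup>2 * c"
      unfolding eqF eqS eqN c_def l_def by (simp add: algebra_simps)
    then have "f (u + t *\<^sub>R w) - l * (norm (u + t *\<^sub>R w))\<^sup>2 = 2 * t * (norm w)\<^sup>2 + t\<^sup>2 * c"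
      unfolding eqW .
    then show ?thesis using ge[of "u + t *\<^sub>R w"] by linarith
  qed
  have "w = 0"
  proof (rule ccontr)
    assume "w \<noteq> 0"
    then have b: "0 < (norm w)\<^sup>2" by simp
    \<comment> \<open>For the step \<open>- (norm w)\<^sup>2 / s\<close> the linear term outweighs the quadratic one.\<close>
    define s where "s = \<bar>c\<bar> + (norm w)\<^sup>2"
    have "\<bar>c\<bar> < s" using b by (simp add: s_def)
    then have s: "0 < s" "c < 2 * s" by linarith+
    have "0 \<le> 2 * (- (norm w)\<^sup>2 / s) * (norm w)\<^sup>2 + (- (norm w)\<^sup>2 / s)\<^sup>2 * c"
      by (rule quad)
    also have "\<dots> = ((norm w)\<^sup>2 / s)\<^sup>2 * (c - 2 * s)"
      using s by (simp add: power2_eq_square field_simps)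
    also have "\<dots> < 0" using s b by (intro mult_pos_neg) auto
    finally show False by simp
  qed
  then have "l \<in> {l. \<exists>v. v \<noteq> 0 \<and> A *v v = l *\<^sub>R v}"
    using u(1) by (auto simp: w_def intro!: exI[of _ u])
  then have "lambda_min A \<le> l"
    unfolding lambda_min_def by (intro Min_le finite_eigenvalues_symmetric sym)
  then have "lambda_min A * (norm v)\<^sup>2 \<le> l * (norm v)\<^sup>2" by (intro mult_right_mono) auto
  with ge[of v] show ?thesis by (simp add: f_def)
qed

lemma inverse_entry_bound:
  fixes A :: "real^'b^'b::finite"
  assumes sym: "transpose A = A" and c: "0 < c" "c \<le> lambda_min A"
  shows "A ** matrix_inv A = mat 1" "matrix_inv A ** A = mat 1" "\<bar>matrix_inv A $ i $ j\<bar> \<le> 1 / c"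
proof -
  have lower: "c * norm v \<le> norm (A *v v)" for v
  proof (cases "v = 0")
    case False
    have "c * (norm v)\<^sup>2 \<le> lambda_min A * (norm v)\<^sup>2" using c by (intro mult_right_mono) auto
    also have "\<dots> \<le> v \<bullet> (A *v v)" by (rule lambda_min_quadratic_form[OF sym])
    also have "\<dots> \<le> norm v * norm (A *v v)" by (rule norm_cauchy_schwarz)
    finally have "norm v * (c * norm v) \<le> norm v * norm (A *v v)"
      by (simp add: power2_eq_square mult_ac)
    then show ?thesis using False by simp
  qed simp
  have "inj ((*v) A)"
  proof (rule injI)
    fix v w assume "A *v v = A *v w"
    then have "A *v (v - w) = 0" by (simp add: matrix_vector_mult_diff_distrib)
    then show "v = w" using lower[of "v - w"] c(1) by (simp add: mult_le_0_iff)
  qed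
  then have inv: "invertible A"
    using matrix_left_invertible_injective[of A] invertible_left_inverse[of A] by (simp add: inj_def)
  then show AB: "A ** matrix_inv A = mat 1" and "matrix_inv A ** A = mat 1"
    using someI_ex[OF inv[unfolded invertible_def]] by (auto simp: matrix_inv_def)
  let ?w = "matrix_inv A *v axis j 1"
  have "A *v ?w = axis j 1" by (simp add: matrix_vector_mul_assoc AB)
  then have "c * norm ?w \<le> 1" using lower[of ?w] by simp
  moreover have "\<bar>matrix_inv A $ i $ j\<bar> \<le> norm ?w"
    using component_le_norm_cart[of ?w i] by (simp add: matrix_vector_mul_component inner_axis)
  ultimately show "\<bar>matrix_inv A $ i $ j\<bar> \<le> 1 / c"
    using c(1) by (simp add: field_simps) (meson mult_left_mono order_trans less_imp_le)
qed

text \<open>The constant produced by the induction in \<open>bounded_Ck_matrix_inverse\<close>: \<open>N\<close> is the size of the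
matrix and the summand bounds \<open>B (\<partial>A) B\<close>, a double sum of products of three factors.\<close>

primrec inverse_bound :: "real \<Rightarrow> real \<Rightarrow> real \<Rightarrow> nat \<Rightarrow> real" where
  "inverse_bound N K b 0 = b"
| "inverse_bound N K b (Suc n) = inverse_bound N K b n + N * (N * (2 ^ n * (2 ^ n * (inverse_bound N K b n * K) * inverse_bound N K b n)))"

text \<open>The resolvent identity \<open>B(y) - B(x) = B(y) (A(x) - A(y)) B(x)\<close>, the source of continuity and of
the derivative of the inverse.\<close>

lemma inverse_difference:
  fixes A B :: "'x \<Rightarrow> real^'b^'b::finite"
  assumes "\<And>x. A x ** B x = mat 1" "\<And>x. B x ** A x = mat 1"
  shows "B y $ i $ j - B x $ i $ j = (\<Sum>k\<in>UNIV. \<Sum>l\<in>UNIV. B y $ i $ k * (A x $ k $ l - A y $ k $ l) * B x $ l $ j)"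
proof -
  have "B y = B y ** (A x ** B x)" "B x = B y ** (A y ** B x)"
    by (simp_all add: assms matrix_mul_assoc)
  then have "B y $ i $ j - B x $ i $ j = (B y ** (A x ** B x)) $ i $ j - (B y ** (A y ** B x)) $ i $ j"
    by metis
  also have "\<dots> = (\<Sum>k\<in>UNIV. \<Sum>l\<in>UNIV. B y $ i $ k * (A x $ k $ l - A y $ k $ l) * B x $ l $ j)"
    by (simp add: matrix_matrix_mult_def sum_distrib_left sum_subtractf[symmetric] algebra_simps)
  finally show ?thesis .
qed

text \<open>Since \<open>\<partial>B = - B (\<partial>A) B\<close>, a bound on \<open>B\<close> up to order \<open>n\<close> gives one on \<open>\<partial>B\<close> up to order \<open>n\<close>, that
is, on \<open>B\<close> up to order \<open>n + 1\<close>. Smoothness of the inverse and its bounds come out of the same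
induction.\<close>

lemma bounded_Ck_matrix_inverse:
  fixes A B :: "real^'n::finite \<Rightarrow> real^'b^'b::finite"
  assumes inv: "\<And>x. A x ** B x = mat 1" "\<And>x. B x ** A x = mat 1"
    and \<epsilon>: "0 < \<epsilon>"
    and A: "\<And>i j. bounded_Ck n \<epsilon> K (\<lambda>x. A x $ i $ j)"
    and b: "\<And>x i j. \<bar>B x $ i $ j\<bar> \<le> b"
  shows "bounded_Ck n \<epsilon> (inverse_bound (real CARD('b)) K b n) (\<lambda>x. B x $ i $ j)"
  using A
proof (induction n arbitrary: i j)
  case 0
  have "isCont (\<lambda>x. B x $ i $ j) x" for x
  proof -
    have Acont: "isCont (\<lambda>x. A x $ k $ l) x" for k l
      using Ck_continuous[OF bounded_Ck_imp_Ck[OF 0]] by (simp add: continuous_on_eq_continuous_at)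
    have lim: "((\<lambda>y. \<Sum>k\<in>UNIV. \<Sum>l\<in>UNIV. b * \<bar>A x $ k $ l - A y $ k $ l\<bar> * b) \<longlongrightarrow>
        (\<Sum>k\<in>UNIV. \<Sum>l\<in>UNIV. b * \<bar>A x $ k $ l - A x $ k $ l\<bar> * b)) (at x)"
      by (intro tendsto_sum tendsto_mult tendsto_const tendsto_rabs tendsto_diff Acont[unfolded isCont_def])
    have "norm (B y $ i $ j - B x $ i $ j) \<le> (\<Sum>k\<in>UNIV. \<Sum>l\<in>UNIV. b * \<bar>A x $ k $ l - A y $ k $ l\<bar> * b)" for y
      unfolding inverse_difference[where A = A and B = B, OF inv] real_norm_def
    proof (intro order_trans[OF sum_abs] sum_mono)
      fix k l
      have "0 \<le> b" using b[of x i j] by linarith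
      then show "\<bar>B y $ i $ k * (A x $ k $ l - A y $ k $ l) * B x $ l $ j\<bar> \<le> b * \<bar>A x $ k $ l - A y $ k $ l\<bar> * b"
        unfolding abs_mult using b by (intro mult_mono) auto
    qed
    then have bound: "\<forall>y. norm (B y $ i $ j - B x $ i $ j) \<le>
        (\<Sum>k\<in>UNIV. \<Sum>l\<in>UNIV. b * \<bar>A x $ k $ l - A y $ k $ l\<bar> * b)" ..
    have "((\<lambda>y. \<Sum>k\<in>UNIV. \<Sum>l\<in>UNIV. b * \<bar>A x $ k $ l - A y $ k $ l\<bar> * b) \<longlongrightarrow> 0) (at x)"
      using lim by simp
    then have "((\<lambda>y. B y $ i $ j - B x $ i $ j) \<longlongrightarrow> 0) (at x)"
      by (rule Lim_null_comparison[OF always_eventually[OF bound]])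
    then show ?thesis by (simp add: isCont_def LIM_zero_iff)
  qed
  then show ?case using b by (intro bounded_Ck_0I) (auto simp: continuous_on_eq_continuous_at)
next
  case (Suc n)
  let ?c = "inverse_bound (real CARD('b)) K b"
  have IH: "bounded_Ck n \<epsilon> (?c n) (\<lambda>x. B x $ i $ j)" for i j
    by (rule Suc.IH[OF bounded_Ck_less[OF Suc.prems]])
  define D where "D = (\<lambda>i' x. \<Sum>k\<in>UNIV. \<Sum>l\<in>UNIV.
      - B x $ i $ k * pderiv_dir i' (\<lambda>x. A x $ k $ l) x * B x $ l $ j)"
  show ?case
  proof (rule bounded_Ck_SucI[OF \<epsilon>, where g' = D])
    show "continuous_on UNIV (\<lambda>x. B x $ i $ j)" by (rule Ck_continuous[OF bounded_Ck_imp_Ck[OF IH]])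
    have "0 \<le> K" using bounded_Ck_nonneg[OF Suc.prems] .
    then have "0 \<le> real CARD('b) * (real CARD('b) * (2 ^ n * (2 ^ n * (?c n * K) * ?c n)))"
      using bounded_Ck_nonneg[OF IH] by simp
    then show "\<bar>B x $ i $ j\<bar> \<le> ?c (Suc n)" for x
      using bounded_Ck_abs_le[OF IH, of x i j] by simp
    show "has_pderiv i' (\<lambda>x. B x $ i $ j) (D i')" for i'
      unfolding has_pderiv_def DERIV_def
    proof
      fix x :: "real^'n"
      let ?p = "\<lambda>t::real. x + t *\<^sub>R axis i' 1"
      have Bcont: "((\<lambda>t. B (?p t) $ i $ k) \<longlongrightarrow> B x $ i $ k) (at 0)" for k
      proof -
        have "isCont (\<lambda>x. B x $ i $ k) (?p 0)"
          using Ck_continuous[OF bounded_Ck_imp_Ck[OF IH]] by (simp add: continuous_on_eq_continuous_at)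
        moreover have "((\<lambda>t. ?p t) \<longlongrightarrow> ?p 0) (at 0)" by (intro tendsto_intros)
        ultimately show ?thesis using isCont_tendsto_compose by fastforce
      qed
      have Ader: "((\<lambda>t. (A (?p t) $ k $ l - A x $ k $ l) / t) \<longlongrightarrow> pderiv_dir i' (\<lambda>x. A x $ k $ l) x) (at 0)" for k l
        using bounded_Ck_has_pderiv[OF Suc.prems, of i' k l] by (simp add: has_pderiv_def DERIV_def)
      have "((\<lambda>t. \<Sum>k\<in>UNIV. \<Sum>l\<in>UNIV. - B (?p t) $ i $ k * ((A (?p t) $ k $ l - A x $ k $ l) / t) * B x $ l $ j)
          \<longlongrightarrow> D i' x) (at 0)"
        unfolding D_def by (intro tendsto_intros Bcont Ader)
      moreover have "(B (?p t) $ i $ j - B x $ i $ j) / t =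
         (\<Sum>k\<in>UNIV. \<Sum>l\<in>UNIV. - B (?p t) $ i $ k * ((A (?p t) $ k $ l - A x $ k $ l) / t) * B x $ l $ j)" for t
        unfolding inverse_difference[where A = A and B = B, OF inv] sum_divide_distrib
        by (intro sum.cong refl) (simp add: field_simps)
      ultimately show "((\<lambda>h. (B (x + (0 + h) *\<^sub>R axis i' 1) $ i $ j - B (x + 0 *\<^sub>R axis i' 1) $ i $ j) / h)
          \<longlongrightarrow> D i' x) (at 0)" by simp
    qed
    show "bounded_Ck n \<epsilon> (?c (Suc n) / \<epsilon>) (D i')" for i'
    proof -
      let ?t = "2 ^ n * (2 ^ n * (?c n * (K / \<epsilon>)) * ?c n)"
      have summand: "bounded_Ck n \<epsilon> ?t (\<lambda>x. - B x $ i $ k * pderiv_dir i' (\<lambda>x. A x $ k $ l) x * B x $ l $ j)" for k l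
      proof -
        have neg: "bounded_Ck n \<epsilon> (?c n) (\<lambda>x. - B x $ i $ k)"
          using bounded_Ck_cmult[OF _ IH[of i k], of "-1"] \<epsilon> by simp
        show ?thesis
          by (rule bounded_Ck_mult[OF \<epsilon> bounded_Ck_mult[OF \<epsilon> neg bounded_Ck_pderiv[OF \<epsilon> Suc.prems]] IH])
      qed
      have D: "bounded_Ck n \<epsilon> (\<Sum>k\<in>(UNIV::'b set). \<Sum>l\<in>(UNIV::'b set). ?t) (D i')"
        unfolding D_def using \<epsilon> by (intro bounded_Ck_sum summand) auto
      have "(\<Sum>k\<in>(UNIV::'b set). \<Sum>l\<in>(UNIV::'b set). ?t)
          = real CARD('b) * (real CARD('b) * (2 ^ n * (2 ^ n * (?c n * K) * ?c n))) / \<epsilon>"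
        by simp
      also have "\<dots> \<le> ?c (Suc n) / \<epsilon>"
        using \<epsilon> bounded_Ck_nonneg[OF IH] by (intro divide_right_mono) auto
      finally show ?thesis by (rule bounded_Ck_weaken[OF D])
    qed
  qed
qed

text \<open>Rounding embeds the lattice points of the ball into a product of integer intervals of length
\<open>2 \<rho> / h\<close>.\<close>

lemma lattice_ball:
  fixes x :: "real^'n::finite"
  assumes h: "0 < h"
  shows finite_lattice_ball: "finite {q \<in> int_lattice. norm (x - h *\<^sub>R q) \<le> \<rho>}"
    and card_lattice_ball: "0 \<le> \<rho> \<Longrightarrow>
      real (card {q \<in> int_lattice. norm (x - h *\<^sub>R q) \<le> \<rho>}) \<le> (2 * \<rho> / h + 1) ^ CARD('n)"
proof -
  let ?Q = "{q \<in> int_lattice. norm (x - h *\<^sub>R q) \<le> \<rho>}"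
  define I where "I i = {\<lceil>(x $ i - \<rho>) / h\<rceil>..\<lfloor>(x $ i + \<rho>) / h\<rfloor>}" for i
  define \<phi> where "\<phi> q i = \<lfloor>q $ i\<rfloor>" for q :: "real^'n" and i
  have inj: "inj_on \<phi> ?Q"
  proof (rule inj_onI)
    fix p q assume *: "p \<in> ?Q" "q \<in> ?Q" "\<phi> p = \<phi> q"
    have "p $ i = q $ i" for i
    proof -
      have "\<lfloor>p $ i\<rfloor> = \<lfloor>q $ i\<rfloor>" using *(3) by (metis \<phi>_def)
      moreover have "p $ i \<in> \<int>" "q $ i \<in> \<int>" using * by (auto simp: int_lattice_def)
      ultimately show ?thesis by (metis of_int_floor)
    qed
    then show "p = q" by (simp add: vec_eq_iff)
  qed
  have sub: "\<phi> ` ?Q \<subseteq> PiE UNIV I"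
  proof (clarsimp simp: PiE_UNIV_domain I_def \<phi>_def)
    fix q i assume q: "q \<in> int_lattice" "norm (x - h *\<^sub>R q) \<le> \<rho>"
    have "\<bar>x $ i - h * q $ i\<bar> \<le> \<rho>"
      using component_le_norm_cart[of "x - h *\<^sub>R q" i] q(2) by simp
    then have "(x $ i - \<rho>) / h \<le> q $ i" "q $ i \<le> (x $ i + \<rho>) / h"
      using h by (auto simp: field_simps abs_le_iff)
    moreover have "of_int \<lfloor>q $ i\<rfloor> = q $ i" using q(1) by (simp add: int_lattice_def)
    ultimately show "\<lceil>(x $ i - \<rho>) / h\<rceil> \<le> \<lfloor>q $ i\<rfloor> \<and> \<lfloor>q $ i\<rfloor> \<le> \<lfloor>(x $ i + \<rho>) / h\<rfloor>"
      by (simp only: ceiling_le_iff floor_mono simp_thms)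
  qed
  have fin: "finite (PiE UNIV I)" by (intro finite_PiE) (auto simp: I_def)
  show "finite ?Q" using inj_on_finite[OF inj sub fin] .
  assume \<rho>: "0 \<le> \<rho>"
  have "card ?Q \<le> card (PiE UNIV I)" by (rule card_inj_on_le[OF inj sub fin])
  also have "\<dots> = (\<Prod>i\<in>UNIV. card (I i))" by (simp add: card_PiE)
  finally have "real (card ?Q) \<le> (\<Prod>i\<in>UNIV. real (card (I i)))"
    unfolding of_nat_prod[symmetric] of_nat_le_iff .
  also have "\<dots> \<le> (\<Prod>i\<in>(UNIV::'n set). 2 * \<rho> / h + 1)"
  proof (intro prod_mono conjI)
    fix i
    have "real_of_int (\<lfloor>(x $ i + \<rho>) / h\<rfloor> + 1 - \<lceil>(x $ i - \<rho>) / h\<rceil>) \<le> (x $ i + \<rho>) / h + 1 - (x $ i - \<rho>) / h"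
      using diff_mono[OF of_int_floor_le[of "(x $ i + \<rho>) / h"] le_of_int_ceiling[of "(x $ i - \<rho>) / h"]] by simp
    also have "\<dots> = 2 * \<rho> / h + 1" using h by (simp add: field_simps)
    finally show "real (card (I i)) \<le> 2 * \<rho> / h + 1"
      using \<rho> h by (cases "\<lfloor>(x $ i + \<rho>) / h\<rfloor> + 1 - \<lceil>(x $ i - \<rho>) / h\<rceil> \<ge> 0") (auto simp: I_def)
  qed auto
  finally show "real (card ?Q) \<le> (2 * \<rho> / h + 1) ^ CARD('n)" by simp
qed

section \<open>Local error of one moving least squares step\<close>

lemma card_lattice_ball_nu:
  fixes x :: "real^'n::finite"
  assumes "0 < h" "1 < \<nu>"
  shows "real (card {q \<in> int_lattice. norm (x - h *\<^sub>R q) \<le> \<nu> * h}) \<le> 3 ^ CARD('n) * \<nu> ^ CARD('n)"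
proof -
  have "real (card {q \<in> int_lattice. norm (x - h *\<^sub>R q) \<le> \<nu> * h}) \<le> (2 * (\<nu> * h) / h + 1) ^ CARD('n)"
    using assms by (intro card_lattice_ball) auto
  also have "\<dots> \<le> (3 * \<nu>) ^ CARD('n)" using assms by (intro power_mono) auto
  finally show ?thesis by (simp add: power_mult_distrib)
qed

context
  fixes \<Phi> :: "real^'n::finite \<Rightarrow> real" and p :: "'b::finite \<Rightarrow> real^'n \<Rightarrow> real"
    and m r :: nat and \<nu>s \<tau>s :: real
  assumes smooth: "Ck m \<Phi>"
    and supp: "\<And>x. 1 < norm x \<Longrightarrow> \<Phi> x = 0"
    and basis: "poly_basis r p"
    and \<tau>s: "0 < \<tau>s"
    and lambda_min: "\<And>h \<nu> x. 0 < h \<Longrightarrow> 1 < \<nu> \<Longrightarrow> \<nu>s \<le> \<nu> \<Longrightarrow>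
           \<tau>s * \<nu> ^ CARD('n) \<le> lambda_min (mls_matrix \<Phi> p \<nu> h x)"
begin

lemma scaled_supp:
  assumes "0 < \<delta>" "\<delta> < norm (x - y)" shows "\<Phi> ((x - y) /\<^sub>R \<delta>) = 0"
proof (rule supp)
  have "norm ((x - y) /\<^sub>R \<delta>) = norm (x - y) / \<delta>"
    using assms(1) by (simp add: divide_inverse mult.commute)
  then show "1 < norm ((x - y) /\<^sub>R \<delta>)" using assms by simp
qed

lemma mls_matrix_inverse:
  assumes "0 < h" "1 < \<nu>" "\<nu>s \<le> \<nu>"
  shows "mls_matrix \<Phi> p \<nu> h x ** matrix_inv (mls_matrix \<Phi> p \<nu> h x) = mat 1"
    and "matrix_inv (mls_matrix \<Phi> p \<nu> h x) ** mls_matrix \<Phi> p \<nu> h x = mat 1"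
    and "\<bar>matrix_inv (mls_matrix \<Phi> p \<nu> h x) $ i $ j\<bar> \<le> 1 / (\<tau>s * \<nu> ^ CARD('n))"
proof -
  have sym: "transpose (mls_matrix \<Phi> p \<nu> h x) = mls_matrix \<Phi> p \<nu> h x"
    by (simp add: transpose_def mls_matrix_def vec_eq_iff mult_ac)
  have pos: "0 < \<tau>s * \<nu> ^ CARD('n)" using assms \<tau>s by simp
  note * = inverse_entry_bound[OF sym pos lambda_min[OF assms]]
  show "mls_matrix \<Phi> p \<nu> h x ** matrix_inv (mls_matrix \<Phi> p \<nu> h x) = mat 1"
    "matrix_inv (mls_matrix \<Phi> p \<nu> h x) ** mls_matrix \<Phi> p \<nu> h x = mat 1"
    "\<bar>matrix_inv (mls_matrix \<Phi> p \<nu> h x) $ i $ j\<bar> \<le> 1 / (\<tau>s * \<nu> ^ CARD('n))"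
    by (fact *)+
qed

text \<open>The functions that generate the moment matrix and the weights have compact support in the
normalised variable, so one constant bounds their derivatives up to order \<open>m\<close>.\<close>

lemma local_basis_bounds:
  obtains K where "0 \<le> K" "\<And>j. bounded_Ck m 1 K (\<lambda>u. \<Phi> u * p j u)" "\<And>i j. bounded_Ck m 1 K (\<lambda>u. \<Phi> u * p i u * p j u)"
proof -
  have pC: "Ck m (p j)" for j using basis by (auto simp: poly_basis_def intro: Ck_poly)
  have "\<exists>K. bounded_Ck m 1 K (\<lambda>u. \<Phi> u * p j u)" for j
    by (rule bounded_Ck_compact_support[OF Ck_mult[OF smooth pC]]) (simp add: supp)
  then obtain K1 where K1: "\<And>j. bounded_Ck m 1 (K1 j) (\<lambda>u. \<Phi> u * p j u)" by metis
  have "\<exists>K. bounded_Ck m 1 K (\<lambda>u. \<Phi> u * p i u * p j u)" for i j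
    by (rule bounded_Ck_compact_support[OF Ck_mult[OF Ck_mult[OF smooth pC] pC]]) (simp add: supp)
  then obtain K2 where K2: "\<And>i j. bounded_Ck m 1 (K2 i j) (\<lambda>u. \<Phi> u * p i u * p j u)" by metis
  define K where "K = (\<Sum>j\<in>UNIV. K1 j) + (\<Sum>i\<in>UNIV. \<Sum>j\<in>UNIV. K2 i j)"
  have n1: "0 \<le> K1 j" and n2: "0 \<le> K2 i j" for i j using bounded_Ck_nonneg K1 K2 by blast+
  have le1: "K1 j \<le> K" for j
    using member_le_sum[of j UNIV K1] n1 n2 by (auto simp: K_def intro!: add_increasing2 sum_nonneg)
  have le2: "K2 i j \<le> K" for i j
  proof -
    have "K2 i j \<le> (\<Sum>j\<in>UNIV. K2 i j)" using n2 by (intro member_le_sum) auto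
    also have "\<dots> \<le> (\<Sum>i\<in>UNIV. \<Sum>j\<in>UNIV. K2 i j)"
      using n2 by (intro member_le_sum[of i UNIV "\<lambda>i. \<Sum>j\<in>UNIV. K2 i j"] sum_nonneg) auto
    finally show ?thesis using n1 by (auto simp: K_def intro!: add_increasing sum_nonneg)
  qed
  show thesis
    by (rule that[of K]) (use n1 le1 order_trans bounded_Ck_weaken[OF K1 le1] bounded_Ck_weaken[OF K2 le2] in blast)+
qed

text \<open>With \<open>V = \<nu> ^ d\<close>, the entries of \<open>A\<close> are of order \<open>V\<close>, being sums of about that many bounded
terms, and its inverse is of order \<open>1 / V\<close> by the eigenvalue bound. Applying the inversion lemma
to \<open>A\<close> divided by \<open>V\<close> makes its constant independent of \<open>\<nu>\<close>.\<close>

lemma mls_weight_bound: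
  obtains K where "0 \<le> K"
    "\<And>h \<nu> y. 0 < h \<Longrightarrow> 1 < \<nu> \<Longrightarrow> \<nu>s \<le> \<nu> \<Longrightarrow> bounded_Ck m (\<nu> * h) (K / \<nu> ^ CARD('n)) (mls_weight \<Phi> p \<nu> h y)"
proof -
  obtain K where K: "0 \<le> K" "\<And>j. bounded_Ck m 1 K (\<lambda>u. \<Phi> u * p j u)"
    "\<And>i j. bounded_Ck m 1 K (\<lambda>u. \<Phi> u * p i u * p j u)" by (rule local_basis_bounds) blast
  define KI where "KI = inverse_bound (real CARD('b)) (3 ^ CARD('n) * K) (1 / \<tau>s) m"
  define KL where "KL = (\<Sum>i\<in>UNIV. \<bar>p i 0\<bar> * KI)"
  have main: "bounded_Ck m (\<nu> * h) ((\<Sum>j\<in>(UNIV::'b set). 2 ^ m * (KL * K)) / \<nu> ^ CARD('n)) (mls_weight \<Phi> p \<nu> h y)"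
    if h: "0 < h" "1 < \<nu>" "\<nu>s \<le> \<nu>" for h \<nu> y
  proof -
    define \<delta> where "\<delta> = \<nu> * h"
    define V where "V = \<nu> ^ CARD('n)"
    have \<delta>: "0 < \<delta>" and V: "0 < V" using h by (auto simp: \<delta>_def V_def)
    let ?A = "\<lambda>x. mls_matrix \<Phi> p \<nu> h x"
    have A: "bounded_Ck m \<delta> (3 ^ CARD('n) * V * K) (\<lambda>x. ?A x $ i $ j)" for i j
    proof -
      have "bounded_Ck m \<delta> (3 ^ CARD('n) * V * K)
        (\<lambda>x. \<Sum>\<^sub>\<infinity>q\<in>int_lattice. (\<lambda>u. \<Phi> u * p i u * p j u) ((x - h *\<^sub>R q) /\<^sub>R \<delta>))"
      proof (rule bounded_Ck_locally_finite_sum[where c = "\<lambda>q. h *\<^sub>R q" and \<delta> = \<delta>])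
        show "finite {q \<in> int_lattice. norm (x - h *\<^sub>R q) \<le> \<rho>}" for x :: "real^'n" and \<rho>
          by (rule finite_lattice_ball[OF h(1)])
        show "bounded_Ck m \<delta> K (\<lambda>x. (\<lambda>u. \<Phi> u * p i u * p j u) ((x - h *\<^sub>R q) /\<^sub>R \<delta>))" for q
          by (rule bounded_Ck_affine[OF \<delta> K(3)])
        show "real (card {q \<in> int_lattice. norm (x - h *\<^sub>R q) \<le> \<delta>}) \<le> 3 ^ CARD('n) * V" for x :: "real^'n"
          unfolding \<delta>_def V_def by (rule card_lattice_ball_nu[OF h(1,2)])
      qed (use \<delta> K scaled_supp in auto)
      then show ?thesis by (simp add: mls_matrix_def \<delta>_def)
    qed
    have AA: "bounded_Ck m \<delta> (3 ^ CARD('n) * K) (\<lambda>x. ((1 / V) *\<^sub>R ?A x) $ i $ j)" for i j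
      using bounded_Ck_cmult[OF _ A, of "1 / V" i j] \<delta> V by simp
    have BB: "bounded_Ck m \<delta> KI (\<lambda>x. (V *\<^sub>R matrix_inv (?A x)) $ i $ j)" for i j
      unfolding KI_def
    proof (rule bounded_Ck_matrix_inverse[where A = "\<lambda>x. (1 / V) *\<^sub>R ?A x"])
      fix x
      show "((1 / V) *\<^sub>R ?A x) ** (V *\<^sub>R matrix_inv (?A x)) = mat 1"
        "(V *\<^sub>R matrix_inv (?A x)) ** ((1 / V) *\<^sub>R ?A x) = mat 1"
        using mls_matrix_inverse[OF h, of x] V by (simp_all add: matrix_scalar_ac flip: scalar_matrix_assoc)
      show "\<bar>(V *\<^sub>R matrix_inv (?A x)) $ i $ j\<bar> \<le> 1 / \<tau>s" for i j
        using mls_matrix_inverse(3)[OF h, of x i j] V \<tau>s by (simp add: abs_mult V_def field_simps)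
    qed (use \<delta> AA in auto)
    have L: "bounded_Ck m \<delta> (KL / V) (\<lambda>x. mls_lambda \<Phi> p \<nu> h x $ j)" for j
    proof -
      have "bounded_Ck m \<delta> (\<Sum>i\<in>UNIV. \<bar>p i 0 / V\<bar> * KI)
          (\<lambda>x. \<Sum>i\<in>UNIV. (p i 0 / V) * (V *\<^sub>R matrix_inv (?A x)) $ j $ i)"
        using \<delta> by (intro bounded_Ck_sum bounded_Ck_cmult BB) auto
      then show ?thesis
        using V by (simp add: mls_lambda_def matrix_vector_mult_def KL_def sum_divide_distrib mult_ac)
    qed
    have "bounded_Ck m \<delta> (\<Sum>j\<in>(UNIV::'b set). 2 ^ m * (KL / V * K))
      (\<lambda>x. \<Sum>j\<in>UNIV. mls_lambda \<Phi> p \<nu> h x $ j * (\<lambda>u. \<Phi> u * p j u) ((x - y) /\<^sub>R \<delta>))"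
      using \<delta> by (intro bounded_Ck_sum bounded_Ck_mult L bounded_Ck_affine K(2)) auto
    then show ?thesis
      by (simp add: mls_weight_def[abs_def] sum_distrib_left \<delta>_def V_def sum_divide_distrib mult_ac)
  qed
  \<comment> \<open>The bound is nonnegative because it holds for at least one admissible parameter.\<close>
  define \<nu> where "\<nu> = max 2 \<nu>s"
  have "0 \<le> (\<Sum>j\<in>(UNIV::'b set). 2 ^ m * (KL * K)) / \<nu> ^ CARD('n)"
    by (rule bounded_Ck_nonneg[OF main[of 1 \<nu>]]) (auto simp: \<nu>_def)
  moreover have "0 < \<nu> ^ CARD('n)" by (simp add: \<nu>_def)
  ultimately have "0 \<le> (\<Sum>j\<in>(UNIV::'b set). 2 ^ m * (KL * K))"
    by (simp only: zero_le_divide_iff) linarith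
  then show thesis by (rule that[OF _ main])
qed

lemma mls_weight_supp:
  assumes "0 < h" "1 < \<nu>" "\<nu> * h < norm (x - y)" shows "mls_weight \<Phi> p \<nu> h y x = 0"
  using assms scaled_supp[of "\<nu> * h" x y] by (simp add: mls_weight_def)

lemma mls_weight_Ck:
  assumes "0 < h" "1 < \<nu>" "\<nu>s \<le> \<nu>" shows "Ck m (mls_weight \<Phi> p \<nu> h y)"
  using mls_weight_bound assms by (metis bounded_Ck_imp_Ck)

lemma Ck_mls_E:
  assumes h: "0 < h" "1 < \<nu>" "\<nu>s \<le> \<nu>" and f: "Ck k f" "k \<le> m"
  shows "Ck k (mls_E \<Phi> p \<nu> h f)"
proof -
  have "Ck k (\<lambda>x. \<Sum>\<^sub>\<infinity>q\<in>int_lattice. mls_weight \<Phi> p \<nu> h (h *\<^sub>R q) x * f (h *\<^sub>R q))"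
    by (rule Ck_locally_finite_sum[where c = "\<lambda>q. h *\<^sub>R q" and \<delta> = "\<nu> * h", OF finite_lattice_ball[OF h(1)]])
      (simp_all add: mls_weight_supp[OF h(1,2)] Ck_mult Ck_const Ck_mono[OF mls_weight_Ck[OF h] f(2)])
  then show ?thesis
    unfolding mls_E_def[abs_def] mls_Q_def by (intro Ck_diff f)
qed

lemma mls_Q_eq_sum:
  assumes h: "0 < h" "1 < \<nu>"
  shows "mls_Q \<Phi> p \<nu> h f x =
    (\<Sum>q\<in>{q \<in> int_lattice. norm (x - h *\<^sub>R q) \<le> \<nu> * h}. mls_weight \<Phi> p \<nu> h (h *\<^sub>R q) x * f (h *\<^sub>R q))"
  unfolding mls_Q_def using mls_weight_supp[OF h]
  by (intro infsum_eq_sum finite_lattice_ball h) auto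

text \<open>Written in the basis with respect to the normalised variable, \<open>P\<close> has coefficients \<open>c\<close>, and the
weighted sum of its lattice values is \<open>c \<bullet> A \<lambda>\<close>. Since \<open>A \<lambda>\<close> lists the basis values at \<open>0\<close>, this
is the value of \<open>P\<close> at the point that corresponds to \<open>0\<close>, namely \<open>x\<close>.\<close>

lemma mls_Q_poly:
  assumes h: "0 < h" "1 < \<nu>" "\<nu>s \<le> \<nu>" and P: "P \<in> poly_space r"
  shows "mls_Q \<Phi> p \<nu> h P x = P x"
proof -
  define \<delta> where "\<delta> = \<nu> * h"
  have \<delta>: "0 < \<delta>" using h by (simp add: \<delta>_def)
  define F where "F = {q \<in> int_lattice. norm (x - h *\<^sub>R q) \<le> \<delta>}"
  define u where "u q = (x - h *\<^sub>R q) /\<^sub>R \<delta>" for q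
  let ?lam = "mls_lambda \<Phi> p \<nu> h x"
  let ?A = "mls_matrix \<Phi> p \<nu> h x"
  obtain c where c: "\<And>v. P (x - \<delta> *\<^sub>R v) = (\<Sum>i\<in>UNIV. c i * p i v)"
    using basis poly_space_affine[OF P, of x \<delta>] unfolding poly_basis_def by meson
  have A: "?A $ i $ j = (\<Sum>q\<in>F. \<Phi> (u q) * p i (u q) * p j (u q))" for i j
    unfolding mls_matrix_def F_def u_def using scaled_supp[OF \<delta>]
    by (simp add: \<delta>_def[symmetric]) (intro infsum_eq_sum finite_lattice_ball h; auto)
  have "?A *v ?lam = (\<chi> j. p j 0)"
    unfolding mls_lambda_def by (simp add: matrix_vector_mul_assoc mls_matrix_inverse[OF h])
  then have moments: "(\<Sum>j\<in>UNIV. ?A $ i $ j * ?lam $ j) = p i 0" for i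
    by (simp add: matrix_vector_mult_def vec_eq_iff)
  have P_hq: "P (h *\<^sub>R q) = (\<Sum>i\<in>UNIV. c i * p i (u q))" for q
    using c[of "u q"] \<delta> by (simp add: u_def)
  have "mls_Q \<Phi> p \<nu> h P x = (\<Sum>q\<in>F. (\<Phi> (u q) * (\<Sum>j\<in>UNIV. ?lam $ j * p j (u q))) * (\<Sum>i\<in>UNIV. c i * p i (u q)))"
    unfolding mls_Q_eq_sum[OF h(1,2)] P_hq mls_weight_def F_def u_def \<delta>_def by simp
  also have "\<dots> = (\<Sum>q\<in>F. \<Phi> (u q) * ((\<Sum>i\<in>UNIV. c i * p i (u q)) * (\<Sum>j\<in>UNIV. ?lam $ j * p j (u q))))"
    by (simp add: mult_ac)
  also have "\<dots> = (\<Sum>q\<in>F. \<Sum>i\<in>UNIV. \<Sum>j\<in>UNIV. c i * (\<Phi> (u q) * p i (u q) * p j (u q) * ?lam $ j))"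
    unfolding sum_product by (simp add: sum_distrib_left mult_ac)
  also have "\<dots> = (\<Sum>i\<in>UNIV. \<Sum>j\<in>UNIV. \<Sum>q\<in>F. c i * (\<Phi> (u q) * p i (u q) * p j (u q) * ?lam $ j))"
    by (subst sum.swap) (intro sum.cong refl sum.swap)
  also have "\<dots> = (\<Sum>i\<in>UNIV. c i * (\<Sum>j\<in>UNIV. ?A $ i $ j * ?lam $ j))"
    unfolding A by (simp add: sum_distrib_left sum_distrib_right)
  also have "\<dots> = (\<Sum>i\<in>UNIV. c i * p i 0)" by (simp add: moments)
  also have "\<dots> = P x" using c[of 0] by simp
  finally show ?thesis .
qed

text \<open>Polynomial reproduction allows \<open>g\<close> to be replaced by its Taylor remainder \<open>R\<close> at the point \<open>x\<close>
where the derivative is evaluated. There the derivatives of \<open>R\<close> of order at most \<open>r\<close> vanish, so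
what is left is the derivative of order \<open>r + 1\<close> and the sum over the lattice, in which \<open>R\<close> is of
size \<open>K\<close>.\<close>

lemma mls_E_local_estimate:
  obtains C0 where "0 < C0"
    "\<And>h \<nu> g x l K. 0 < h \<Longrightarrow> 1 < \<nu> \<Longrightarrow> \<nu>s \<le> \<nu> \<Longrightarrow> r + 1 \<le> m \<Longrightarrow> Ck (r + 1) g \<Longrightarrow>
       (\<And>l y. length l = r + 1 \<Longrightarrow> y \<in> ball x (\<nu> * h) \<Longrightarrow> (\<nu> * h) ^ (r + 1) * \<bar>pderivs l g y\<bar> \<le> K) \<Longrightarrow>
       length l \<le> r + 1 \<Longrightarrow> \<bar>pderivs l (mls_E \<Phi> p \<nu> h g) x\<bar> \<le> C0 / (\<nu> * h) ^ length l * K"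
proof -
  obtain KW where KW: "0 \<le> KW"
    "\<And>h \<nu> y. 0 < h \<Longrightarrow> 1 < \<nu> \<Longrightarrow> \<nu>s \<le> \<nu> \<Longrightarrow> bounded_Ck m (\<nu> * h) (KW / \<nu> ^ CARD('n)) (mls_weight \<Phi> p \<nu> h y)"
    by (rule mls_weight_bound) blast
  define D where "D = real CARD('n) ^ (r + 1)"
  \<comment> \<open>One accounts for the Taylor remainder itself; in the other summand the number of lattice
    points, at most \<open>3 ^ d * \<nu> ^ d\<close>, has cancelled the denominator of the weight bound.\<close>
  define C0 where "C0 = 1 + 3 ^ CARD('n) * KW * D"
  have "\<bar>pderivs l (mls_E \<Phi> p \<nu> h g) x\<bar> \<le> C0 / (\<nu> * h) ^ length l * K"
    if h: "0 < h" "1 < \<nu>" "\<nu>s \<le> \<nu>" and rm: "r + 1 \<le> m" and g: "Ck (r + 1) g"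
      and K: "\<And>l y. length l = r + 1 \<Longrightarrow> y \<in> ball x (\<nu> * h) \<Longrightarrow> (\<nu> * h) ^ (r + 1) * \<bar>pderivs l g y\<bar> \<le> K"
      and l: "length l \<le> r + 1" for h \<nu> g x l K
  proof -
    define \<delta> where "\<delta> = \<nu> * h"
    define V where "V = \<nu> ^ CARD('n)"
    have \<delta>: "0 < \<delta>" and V: "0 < V" using h by (auto simp: \<delta>_def V_def)
    note lf = finite_lattice_ball[OF h(1)]
    obtain T where T: "T \<in> poly_space r" "\<And>l. length l \<le> r \<Longrightarrow> pderivs l T x = pderivs l g x"
      "\<And>l. r < length l \<Longrightarrow> pderivs l T = (\<lambda>y. 0)"
      using Taylor_polynomial[OF Ck_mono[OF g, of r]] by auto
    define R where "R = (\<lambda>y. g y - T y)"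
    have RC: "Ck (r + 1) R" unfolding R_def by (intro Ck_diff g Ck_poly[OF T(1)])
    have DR: "pderivs l R y = pderivs l g y - pderivs l T y" if "length l \<le> r + 1" for l y
      unfolding R_def by (subst pderivs_diff[OF Ck_mono[OF g that] Ck_poly[OF T(1)]]) simp
    have R0: "pderivs l R x = 0" if "length l < r + 1" for l
      using that T(2) by (simp add: DR)
    have R1: "\<bar>pderivs l R y\<bar> \<le> K / \<delta> ^ (r + 1)" if "length l = r + 1" "norm (y - x) < \<delta>" for l y
      using that T(3)[of l] K[OF that(1), of y] \<delta>
      by (simp add: DR \<delta>_def[symmetric] dist_norm norm_minus_commute field_simps)
    have "0 \<le> \<delta> ^ (r + 1) * \<bar>pderivs (replicate (r + 1) undefined) g x\<bar>" using \<delta> by simp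
    also have "\<dots> \<le> K" unfolding \<delta>_def by (rule K) (use \<delta> in \<open>auto simp: \<delta>_def\<close>)
    finally have K0: "0 \<le> K" .
    \<comment> \<open>Lattice points at distance exactly \<open>\<delta>\<close> may occur in the sum, so the bound is carried over to
      the closed ball by continuity.\<close>
    have "ball x \<delta> \<subseteq> {y. \<bar>R y\<bar> \<le> D * K}"
    proof clarify
      fix y assume "y \<in> ball x \<delta>"
      then have y: "norm (y - x) < \<delta>" by (simp add: dist_norm norm_minus_commute)
      have "\<bar>R y\<bar> \<le> (real CARD('n) * norm (y - x)) ^ (r + 1) * (K / \<delta> ^ (r + 1))"
        by (rule vanishing_jet_bound[OF RC R0 R1 y])
      also have "\<dots> \<le> (real CARD('n) * \<delta>) ^ (r + 1) * (K / \<delta> ^ (r + 1))"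
        using y \<delta> K0 by (intro mult_right_mono power_mono mult_left_mono) auto
      also have "\<dots> = D * K" using \<delta> by (simp add: D_def power_mult_distrib)
      finally show "\<bar>R y\<bar> \<le> D * K" .
    qed
    moreover have "closed {y. \<bar>R y\<bar> \<le> D * K}"
      by (intro closed_Collect_le continuous_intros Ck_continuous[OF RC])
    ultimately have "closure (ball x \<delta>) \<subseteq> {y. \<bar>R y\<bar> \<le> D * K}" by (rule closure_minimal)
    then have R: "\<bar>R y\<bar> \<le> D * K" if "norm (x - y) \<le> \<delta>" for y
      using that \<delta> by (auto simp: dist_norm)
    have E: "mls_E \<Phi> p \<nu> h g = (\<lambda>y. R y - (\<Sum>\<^sub>\<infinity>q\<in>int_lattice. mls_weight \<Phi> p \<nu> h (h *\<^sub>R q) y * R (h *\<^sub>R q)))"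
    proof
      fix y
      have "mls_Q \<Phi> p \<nu> h g y = mls_Q \<Phi> p \<nu> h R y + mls_Q \<Phi> p \<nu> h T y"
        unfolding mls_Q_eq_sum[OF h(1,2)] R_def by (simp add: sum.distrib[symmetric] algebra_simps)
      then show "mls_E \<Phi> p \<nu> h g y = R y - (\<Sum>\<^sub>\<infinity>q\<in>int_lattice. mls_weight \<Phi> p \<nu> h (h *\<^sub>R q) y * R (h *\<^sub>R q))"
        using mls_Q_poly[OF h T(1)] by (simp add: mls_E_def R_def mls_Q_def)
    qed
    let ?g = "\<lambda>q y. mls_weight \<Phi> p \<nu> h (h *\<^sub>R q) y * R (h *\<^sub>R q)"
    have WC: "Ck (length l) (mls_weight \<Phi> p \<nu> h y)" for y
      using Ck_mono[OF mls_weight_Ck[OF h]] l rm by simp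
    then have gC: "Ck (length l) (?g q)" for q by (intro Ck_mult Ck_const)
    have g0: "?g q y = 0" if "\<delta> < norm (y - h *\<^sub>R q)" for q y
      using mls_weight_supp[OF h(1,2)] that by (simp add: \<delta>_def)
    have Dg: "pderivs l (?g q) y = pderivs l (mls_weight \<Phi> p \<nu> h (h *\<^sub>R q)) y * R (h *\<^sub>R q)" for q y
      using pderivs_cmult[OF WC, of "R (h *\<^sub>R q)"] by (simp add: mult.commute)
    have "pderivs l (mls_E \<Phi> p \<nu> h g) = (\<lambda>y. pderivs l R y - pderivs l (\<lambda>y. \<Sum>\<^sub>\<infinity>q\<in>int_lattice. ?g q y) y)"
      unfolding E by (rule pderivs_diff[OF Ck_mono[OF RC l] Ck_locally_finite_sum[OF lf g0 gC]])
    also have "pderivs l (\<lambda>y. \<Sum>\<^sub>\<infinity>q\<in>int_lattice. ?g q y) = (\<lambda>y. \<Sum>\<^sub>\<infinity>q\<in>int_lattice. pderivs l (?g q) y)"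
      by (rule pderivs_locally_finite_sum[OF lf g0 gC])
    finally have "\<bar>pderivs l (mls_E \<Phi> p \<nu> h g) x\<bar> \<le> \<bar>pderivs l R x\<bar> + \<bar>\<Sum>\<^sub>\<infinity>q\<in>int_lattice. pderivs l (?g q) x\<bar>"
      by simp
    also have "\<bar>pderivs l R x\<bar> \<le> K / \<delta> ^ length l"
      using R0[of l] R1[of l x] l \<delta> K0 by (cases "length l = r + 1") auto
    also have "\<bar>\<Sum>\<^sub>\<infinity>q\<in>int_lattice. pderivs l (?g q) x\<bar> \<le> (3 ^ CARD('n) * V) * (KW / V / \<delta> ^ length l * (D * K))"
    proof (rule locally_finite_sum_abs_le[where \<delta> = \<delta>, OF lf])
      show "pderivs l (?g q) x = 0" if "\<delta> < norm (x - h *\<^sub>R q)" for q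
        by (rule pderivs_zero_outside[OF g0 that])
      show "\<bar>pderivs l (?g q) x\<bar> \<le> KW / V / \<delta> ^ length l * (D * K)" if "norm (x - h *\<^sub>R q) \<le> \<delta>" for q
      proof -
        have "\<bar>pderivs l (mls_weight \<Phi> p \<nu> h (h *\<^sub>R q)) x\<bar> \<le> KW / V / \<delta> ^ length l"
          using bounded_Ck_pderivs_le[OF KW(2)[OF h, of "h *\<^sub>R q"], of l x] l rm zero_less_power[OF \<delta>, of "length l"]
          by (simp add: V_def \<delta>_def pos_le_divide_eq mult.commute del: divide_divide_eq_left)
        then show ?thesis unfolding Dg abs_mult using R[OF that] KW(1) V \<delta> by (intro mult_mono) auto
      qed
      show "real (card {q \<in> int_lattice. norm (x - h *\<^sub>R q) \<le> \<delta>}) \<le> 3 ^ CARD('n) * V"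
        unfolding \<delta>_def V_def by (rule card_lattice_ball_nu[OF h(1,2)])
      show "0 \<le> KW / V / \<delta> ^ length l * (D * K)" using KW(1) V \<delta> K0 by (simp add: D_def)
    qed
    also have "K / \<delta> ^ length l + (3 ^ CARD('n) * V) * (KW / V / \<delta> ^ length l * (D * K)) = C0 / \<delta> ^ length l * K"
      using V \<delta> by (simp add: C0_def field_simps)
    finally show ?thesis by (simp add: \<delta>_def)
  qed
  moreover have "0 < C0" using KW(1) by (auto simp: C0_def D_def intro!: add_pos_nonneg)
  ultimately show thesis using that by blast
qed

end

section \<open>Norms and the cascade over the levels\<close>

lemma Linf_norm_leI:
  assumes "open \<Omega>" "continuous_on UNIV g" "\<And>x. x \<in> \<Omega> \<Longrightarrow> ennreal \<bar>g x\<bar> \<le> B"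
  shows "Linf_norm \<Omega> g \<le> B"
  unfolding Linf_norm_def
proof (rule esssup_I)
  have "continuous_on \<Omega> (\<lambda>x. \<bar>g x\<bar>)"
    using assms(2) by (intro continuous_intros) (auto intro: continuous_on_subset)
  then have "(\<lambda>x. \<bar>g x\<bar>) \<in> borel_measurable (lebesgue_on \<Omega>)"
    using assms(1) by (intro continuous_imp_measurable_on_sets_lebesgue) auto
  then show "(\<lambda>x. ennreal \<bar>g x\<bar>) \<in> borel_measurable (lebesgue_on \<Omega>)" by measurable
  show "AE x in lebesgue_on \<Omega>. ennreal \<bar>g x\<bar> \<le> B"
    using assms(3) by (intro AE_I2) (simp add: space_restrict_space)
qed

text \<open>A continuous function that exceeds its essential supremum at a point of an open set does so on a
ball, which has positive measure.\<close>

lemma le_Linf_norm: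
  assumes \<Omega>: "open \<Omega>" and g: "continuous_on UNIV g" and x: "x \<in> \<Omega>"
  shows "ennreal \<bar>g x\<bar> \<le> Linf_norm \<Omega> g"
proof (rule ccontr)
  assume "\<not> ennreal \<bar>g x\<bar> \<le> Linf_norm \<Omega> g"
  then have less: "Linf_norm \<Omega> g < ennreal \<bar>g x\<bar>" by simp
  then obtain c where c: "Linf_norm \<Omega> g = ennreal c" "0 \<le> c"
    by (cases "Linf_norm \<Omega> g") auto
  let ?U = "{y \<in> space (lebesgue_on \<Omega>). Linf_norm \<Omega> g < ennreal \<bar>g y\<bar>}"
  have "open (\<Omega> \<inter> {y. c < \<bar>g y\<bar>})"
    using g \<Omega> by (intro open_Int open_Collect_less continuous_intros) auto
  moreover have U: "?U = \<Omega> \<inter> {y. c < \<bar>g y\<bar>}"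
    using c(2) by (auto simp: c(1) space_restrict_space ennreal_less_iff)
  moreover have "x \<in> ?U" using less x by (simp add: space_restrict_space)
  ultimately obtain e where e: "0 < e" "ball x e \<subseteq> ?U"
    by (metis open_contains_ball)
  have "emeasure (lebesgue_on \<Omega>) ?U = 0"
    unfolding Linf_norm_def by (rule esssup_zero_measure)
  moreover have "emeasure (lebesgue_on \<Omega>) ?U = emeasure lebesgue ?U"
    using \<Omega> by (intro emeasure_restrict_space) (auto simp: space_restrict_space)
  ultimately have "emeasure lebesgue (ball x e) = 0"
    using emeasure_mono[OF e(2), of lebesgue] \<open>open (\<Omega> \<inter> {y. c < \<bar>g y\<bar>})\<close> U by simp
  then show False using e(1) unit_ball_vol_pos[of "real CARD('a)"] by (simp add: emeasure_ball)
qed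

lemma mi_deriv_continuous:
  assumes "Ck n g" "mi_abs \<alpha> \<le> n" shows "continuous_on UNIV (mi_deriv \<alpha> g)"
  using Ck_pderivs[of "mi_list \<alpha>" 0 g] Ck_mono[OF assms]
  by (simp add: mi_deriv_eq_pderivs length_mi_list)

lemma le_W_seminorm:
  assumes "open \<Omega>" "Ck n g" "j \<le> mi_abs \<alpha>" "mi_abs \<alpha> \<le> n" "x \<in> \<Omega>"
  shows "ennreal (\<epsilon> ^ mi_abs \<alpha>) * ennreal \<bar>mi_deriv \<alpha> g x\<bar> \<le> W_seminorm j n \<epsilon> \<Omega> g"
proof -
  have "ennreal (\<epsilon> ^ mi_abs \<alpha>) * ennreal \<bar>mi_deriv \<alpha> g x\<bar> \<le> ennreal (\<epsilon> ^ mi_abs \<alpha>) * Linf_norm \<Omega> (mi_deriv \<alpha> g)"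
    using assms by (intro mult_left_mono le_Linf_norm mi_deriv_continuous[of n]) auto
  also have "\<dots> \<le> W_seminorm j n \<epsilon> \<Omega> g"
    unfolding W_seminorm_def using assms by (intro SUP_upper) auto
  finally show ?thesis .
qed

lemma Linf_norm_mono:
  assumes "open \<Omega>" "open \<Omega>'" "\<Omega> \<subseteq> \<Omega>'" "continuous_on UNIV g"
  shows "Linf_norm \<Omega> g \<le> Linf_norm \<Omega>' g"
  using assms by (intro Linf_norm_leI le_Linf_norm) auto

lemma W_seminorm_mono_domain:
  fixes g :: "real^'n::finite \<Rightarrow> real"
  assumes "open \<Omega>" "open \<Omega>'" "\<Omega> \<subseteq> \<Omega>'" "Ck n g"
  shows "W_seminorm j n \<epsilon> \<Omega> g \<le> W_seminorm j n \<epsilon> \<Omega>' g"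
  unfolding W_seminorm_def
proof (rule SUP_mono)
  fix \<alpha> :: "'n \<Rightarrow> nat" assume \<alpha>: "\<alpha> \<in> {\<alpha>. j \<le> mi_abs \<alpha> \<and> mi_abs \<alpha> \<le> n}"
  then have "ennreal (\<epsilon> ^ mi_abs \<alpha>) * Linf_norm \<Omega> (mi_deriv \<alpha> g) \<le> ennreal (\<epsilon> ^ mi_abs \<alpha>) * Linf_norm \<Omega>' (mi_deriv \<alpha> g)"
    using assms by (intro mult_left_mono Linf_norm_mono mi_deriv_continuous[of n]) auto
  with \<alpha> show "\<exists>\<beta>\<in>{\<alpha>. j \<le> mi_abs \<alpha> \<and> mi_abs \<alpha> \<le> n}.
      ennreal (\<epsilon> ^ mi_abs \<alpha>) * Linf_norm \<Omega> (mi_deriv \<alpha> g) \<le> ennreal (\<epsilon> ^ mi_abs \<beta>) * Linf_norm \<Omega>' (mi_deriv \<beta> g)"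
    by blast
qed

lemma W_seminorm_mono_order:
  "j' \<le> j \<Longrightarrow> n \<le> n' \<Longrightarrow> W_seminorm j n \<epsilon> \<Omega> g \<le> W_seminorm j' n' \<epsilon> \<Omega> g"
  unfolding W_seminorm_def by (intro SUP_subset_mono) auto

text \<open>Passing to a finer scale gains the power of \<open>\<mu>\<close> that belongs to the lowest order. This is where
a factor \<open>\<mu> ^ (r + 1)\<close> per level comes from.\<close>

lemma W_seminorm_scale:
  fixes g :: "real^'n::finite \<Rightarrow> real"
  assumes "0 \<le> \<mu>" "\<mu> \<le> 1" "0 \<le> \<epsilon>"
  shows "W_seminorm j n (\<mu> * \<epsilon>) \<Omega> g \<le> ennreal (\<mu> ^ j) * W_seminorm j n \<epsilon> \<Omega> g"
  unfolding W_seminorm_def[of j n "\<mu> * \<epsilon>"]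
proof (rule SUP_least)
  fix \<alpha> :: "'n \<Rightarrow> nat" assume \<alpha>: "\<alpha> \<in> {\<alpha>. j \<le> mi_abs \<alpha> \<and> mi_abs \<alpha> \<le> n}"
  have "ennreal ((\<mu> * \<epsilon>) ^ mi_abs \<alpha>) \<le> ennreal (\<mu> ^ j) * ennreal (\<epsilon> ^ mi_abs \<alpha>)"
    using assms \<alpha> by (auto simp: power_mult_distrib ennreal_mult[symmetric]
        intro!: ennreal_leI mult_right_mono power_decreasing)
  then have "ennreal ((\<mu> * \<epsilon>) ^ mi_abs \<alpha>) * Linf_norm \<Omega> (mi_deriv \<alpha> g)
      \<le> ennreal (\<mu> ^ j) * (ennreal (\<epsilon> ^ mi_abs \<alpha>) * Linf_norm \<Omega> (mi_deriv \<alpha> g))"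
    by (simp add: mult_right_mono flip: mult.assoc)
  also have "\<dots> \<le> ennreal (\<mu> ^ j) * W_seminorm j n \<epsilon> \<Omega> g"
    unfolding W_seminorm_def using \<alpha> by (intro mult_left_mono SUP_upper) auto
  finally show "ennreal ((\<mu> * \<epsilon>) ^ mi_abs \<alpha>) * Linf_norm \<Omega> (mi_deriv \<alpha> g)
      \<le> ennreal (\<mu> ^ j) * W_seminorm j n \<epsilon> \<Omega> g" .
qed

text \<open>For \<open>j = 0\<close> this is the quantity under the \<open>M\<close>-th root in \<open>J\<close>. The offset \<open>j\<close> counts how often the
order has been raised; it is what makes the recursion below close.\<close>

definition cascade_factor :: "real \<Rightarrow> real \<Rightarrow> (nat \<Rightarrow> nat) \<Rightarrow> real \<Rightarrow> nat \<Rightarrow> nat \<Rightarrow> real" where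
  "cascade_factor v \<rho> \<theta> \<mu> M j = \<mu> ^ (\<Sum>i=1..M. \<theta> (j + i)) +
     v * (\<Sum>i<M. \<mu> ^ (\<Sum>l=1..i. \<theta> (j + l)) * \<rho> ^ (M - i - 1))"

text \<open>One step of the cascade: either the remaining \<open>M\<close> levels are estimated in all orders at once, or
the order is raised again and the cascade continues.\<close>

lemma cascade_factor_Suc:
  "cascade_factor v \<rho> \<theta> \<mu> (Suc M) j = v * \<rho> ^ M + \<mu> ^ \<theta> (j + 1) * cascade_factor v \<rho> \<theta> \<mu> M (j + 1)"
proof -
  have shift: "(\<Sum>i=1..Suc n. \<theta> (j + i)) = \<theta> (j + 1) + (\<Sum>i=1..n. \<theta> (j + 1 + i))" for n
    by (induction n) simp_all
  have "(\<Sum>i<Suc M. \<mu> ^ (\<Sum>l=1..i. \<theta> (j + l)) * \<rho> ^ (Suc M - i - 1))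
      = \<rho> ^ M + (\<Sum>i<M. \<mu> ^ (\<Sum>l=1..Suc i. \<theta> (j + l)) * \<rho> ^ (M - i - 1))"
    by (subst sum.lessThan_Suc_shift) simp
  also have "\<dots> = \<rho> ^ M + \<mu> ^ \<theta> (j + 1) * (\<Sum>i<M. \<mu> ^ (\<Sum>l=1..i. \<theta> (j + 1 + l)) * \<rho> ^ (M - i - 1))"
    unfolding shift by (simp add: power_add sum_distrib_left mult_ac)
  finally show ?thesis unfolding cascade_factor_def shift by (simp add: power_add algebra_simps)
qed

lemma cascade_factor_nonneg: "0 \<le> v \<Longrightarrow> 0 \<le> \<rho> \<Longrightarrow> 0 \<le> \<mu> \<Longrightarrow> 0 \<le> cascade_factor v \<rho> \<theta> \<mu> M j"
  by (auto simp: cascade_factor_def intro!: add_nonneg_nonneg mult_nonneg_nonneg sum_nonneg)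

lemma J_power:
  assumes "0 < L" "0 \<le> C" "1 < \<nu>" "0 < \<mu>"
  shows "J C m k r L \<nu> \<mu> ^ L = C ^ L * min (rho m k r \<nu> \<mu> ^ L)
      (cascade_factor (\<nu> powi (int k - int m)) (rho m k r \<nu> \<mu>) (theta k r) \<mu> L 0)"
    and "0 \<le> J C m k r L \<nu> \<mu>"
proof -
  define S where "S = cascade_factor (\<nu> powi (int k - int m)) (rho m k r \<nu> \<mu>) (theta k r) \<mu> L 0"
  have \<rho>: "0 \<le> rho m k r \<nu> \<mu>" using assms by (simp add: rho_def)
  have S: "0 \<le> S" unfolding S_def using assms \<rho> by (intro cascade_factor_nonneg) auto
  have "(\<Sum>i\<le>j. theta k r i) = (\<Sum>i=1..j. theta k r i)" for j
    by (induction j) (simp_all add: theta_def)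
  then have J: "J C m k r L \<nu> \<mu> = C * min (rho m k r \<nu> \<mu>) (root L S)"
    by (simp add: J_def S_def cascade_factor_def)
  show "0 \<le> J C m k r L \<nu> \<mu>" unfolding J using assms(1,2) \<rho> S by (simp add: min_def)
  have root: "0 \<le> root L S" "root L S ^ L = S" using S assms(1) by auto
  have "min (rho m k r \<nu> \<mu>) (root L S) ^ L = min (rho m k r \<nu> \<mu> ^ L) S"
  proof (cases "rho m k r \<nu> \<mu> \<le> root L S")
    case True
    then show ?thesis using power_mono[OF True \<rho>, of L] root(2) by (simp add: min_absorb1)
  next
    case False
    then show ?thesis using power_mono[of "root L S" "rho m k r \<nu> \<mu>" L] root by (simp add: min_absorb2)
  qed
  then show "J C m k r L \<nu> \<mu> ^ L = C ^ L * min (rho m k r \<nu> \<mu> ^ L) S"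
    unfolding J power_mult_distrib S_def by simp
qed

text \<open>The decay of the residual over the levels uses of the operators only the two single-level
estimates and the fact that residuals stay in \<open>C\<^sup>k\<close>.\<close>

context
  fixes \<Phi> :: "real^'n::finite \<Rightarrow> real" and p :: "'b::finite \<Rightarrow> real^'n \<Rightarrow> real"
    and m r k :: nat and \<nu>s C h0 \<mu> \<nu> :: real and f :: "real^'n \<Rightarrow> real"
  assumes Ck_E: "\<And>j. Ck k (ml_E \<Phi> p \<nu> \<mu> h0 f j)"
    and single: "single_level_const \<Phi> p m r k \<nu>s C"
    and rk: "r < k" and C: "0 < C" and h0: "0 < h0" and \<mu>: "0 < \<mu>" "\<mu> < 1"
    and \<nu>: "1 < \<nu>" "\<nu>s \<le> \<nu>"
begin

lemma all_orders_decay: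
  assumes "0 < R"
  shows "W_seminorm (r + 1) k (\<nu> * (\<mu> ^ N * h0)) (ball x R) (ml_E \<Phi> p \<nu> \<mu> h0 f N)
     \<le> ennreal ((C * (\<mu> ^ (r + 1) * rho m k r \<nu> \<mu>)) ^ N)
        * W_seminorm (r + 1) k (\<nu> * h0) (ball x (R + radius_sum \<nu> \<mu> h0 N)) f"
  using assms
proof (induction N arbitrary: R)
  case 0
  then show ?case by (simp add: radius_sum_def)
next
  case (Suc N)
  define h where "h = \<mu> ^ Suc N * h0"
  define E where "E = ml_E \<Phi> p \<nu> \<mu> h0 f N"
  define a where "a = C * (\<mu> ^ (r + 1) * rho m k r \<nu> \<mu>)"
  have h: "0 < h" using h0 \<mu> by (simp add: h_def)
  have a: "0 \<le> a" using C \<mu> \<nu> by (simp add: a_def rho_def)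
  \<comment> \<open>This identity splits off \<open>\<mu> ^ (r + 1)\<close> and leaves exactly \<open>\<rho>\<close>.\<close>
  have "min (2 * r + 2) k = (r + 1) + theta k r 1" using rk by (auto simp: theta_def)
  then have coeff: "C * (\<nu> powi (int k - int m) * \<mu> ^ (r + 1) + \<mu> ^ min (2 * r + 2) k) = a"
    by (simp add: a_def rho_def power_add algebra_simps)
  have prev: "\<nu> * h / \<mu> = \<nu> * (\<mu> ^ N * h0)" using \<mu> by (simp add: h_def)
  have "W_seminorm (r + 1) k (\<nu> * h) (ball x R) (mls_E \<Phi> p \<nu> h E)
     \<le> ennreal a * W_seminorm (r + 1) k (\<nu> * h / \<mu>) (ball x (R + \<nu> * h)) E"
    using single Ck_E[of N] h Suc.prems \<nu> \<mu> unfolding single_level_const_def E_def coeff[symmetric] by auto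
  also have "\<dots> \<le> ennreal a * (ennreal (a ^ N) * W_seminorm (r + 1) k (\<nu> * h0) (ball x (R + \<nu> * h + radius_sum \<nu> \<mu> h0 N)) f)"
    unfolding prev E_def a_def using Suc.prems h \<nu> by (intro mult_left_mono Suc.IH) (auto intro: add_pos_pos)
  also have "\<dots> = ennreal (a ^ Suc N) * W_seminorm (r + 1) k (\<nu> * h0) (ball x (R + radius_sum \<nu> \<mu> h0 (Suc N))) f"
    using a by (simp add: ennreal_mult mult.assoc radius_sum_def h_def add_ac)
  finally show ?case unfolding ml_E_Suc E_def h_def a_def .
qed

text \<open>The order attached to \<open>j\<close> is \<open>r + 1 + \<theta>\<^sub>j\<close>, and the given estimate at this order refers to the order
attached to \<open>j + 1\<close> on the level below. Hence the induction on the level has to range over all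
\<open>j\<close>; the case \<open>j = 0\<close> is the one that enters the minimum in \<open>J\<close>.\<close>

lemma single_order_decay:
  assumes "0 < R"
  shows "W_seminorm (min ((j + 1) * (r + 1)) k) (min ((j + 1) * (r + 1)) k) (\<nu> * (\<mu> ^ M * h0)) (ball x R) (ml_E \<Phi> p \<nu> \<mu> h0 f M)
     \<le> ennreal ((C * \<mu> ^ (r + 1)) ^ M * cascade_factor (\<nu> powi (int k - int m)) (rho m k r \<nu> \<mu>) (theta k r) \<mu> M j)
        * W_seminorm (r + 1) k (\<nu> * h0) (ball x (R + radius_sum \<nu> \<mu> h0 M)) f"
  using assms
proof (induction M arbitrary: j R)
  case 0
  then show ?case using rk
    by (simp add: radius_sum_def cascade_factor_def) (intro W_seminorm_mono_order; simp)
next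
  case (Suc M)
  define h where "h = \<mu> ^ Suc M * h0"
  define E where "E = ml_E \<Phi> p \<nu> \<mu> h0 f M"
  define v where "v = \<nu> powi (int k - int m)"
  define \<rho> where "\<rho> = rho m k r \<nu> \<mu>"
  define s where "s = \<mu> ^ (r + 1)"
  define n where "n j = min ((j + 1) * (r + 1)) k" for j
  define Z where "Z = cascade_factor v \<rho> (theta k r) \<mu> M (j + 1)"
  define B where "B = ball x (R + \<nu> * h)"
  define W where "W = W_seminorm (r + 1) k (\<nu> * h0) (ball x (R + \<nu> * h + radius_sum \<nu> \<mu> h0 M)) f"
  have h: "0 < h" using h0 \<mu> by (simp add: h_def)
  have pos: "0 \<le> v" "0 \<le> \<rho>" "0 \<le> s" "0 \<le> Z"
    using \<mu> \<nu> by (auto simp: v_def \<rho>_def s_def rho_def Z_def intro!: cascade_factor_nonneg)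
  have n: "r + 1 \<le> n j" "n j \<le> k" for j using rk by (auto simp: n_def)
  have n_Suc: "min (n j + r + 1) k = n (j + 1)" by (auto simp: n_def)
  have \<delta>: "\<nu> * h = \<mu> * (\<nu> * (\<mu> ^ M * h0))" by (simp add: h_def)
  have R': "0 < R + \<nu> * h" using Suc.prems h \<nu> by (simp add: add_pos_pos)
  have "W_seminorm (n j) (n j) (\<nu> * h) (ball x R) (mls_E \<Phi> p \<nu> h E)
     \<le> ennreal C * (ennreal (\<nu> powi (int (n j) - int m)) * W_seminorm (r + 1) k (\<nu> * h) B E
         + W_seminorm (n (j + 1)) (n (j + 1)) (\<nu> * h) B E)"
    using single Ck_E[of M] h Suc.prems \<nu> n[of j] unfolding single_level_const_def E_def B_def n_Suc[symmetric] by auto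
  also have "\<dots> \<le> ennreal C * (ennreal v * (ennreal s * (ennreal ((C * (s * \<rho>)) ^ M) * W))
         + ennreal (\<mu> ^ n (j + 1)) * (ennreal ((C * s) ^ M * Z) * W))"
  proof (intro mult_left_mono add_mono mult_mono)
    show "ennreal (\<nu> powi (int (n j) - int m)) \<le> ennreal v"
      unfolding v_def using n[of j] \<nu> by (intro ennreal_leI power_int_increasing) auto
    have "W_seminorm (r + 1) k (\<nu> * h) B E \<le> ennreal s * W_seminorm (r + 1) k (\<nu> * (\<mu> ^ M * h0)) B E"
      unfolding \<delta> s_def using \<mu> \<nu> h0 by (intro W_seminorm_scale) auto
    also have "\<dots> \<le> ennreal s * (ennreal ((C * (s * \<rho>)) ^ M) * W)"
      unfolding s_def \<rho>_def B_def E_def W_def by (intro mult_left_mono all_orders_decay R') auto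
    finally show "W_seminorm (r + 1) k (\<nu> * h) B E \<le> ennreal s * (ennreal ((C * (s * \<rho>)) ^ M) * W)" .
    have "W_seminorm (n (j + 1)) (n (j + 1)) (\<nu> * h) B E
       \<le> ennreal (\<mu> ^ n (j + 1)) * W_seminorm (n (j + 1)) (n (j + 1)) (\<nu> * (\<mu> ^ M * h0)) B E"
      unfolding \<delta> using \<mu> \<nu> h0 by (intro W_seminorm_scale) auto
    also have "\<dots> \<le> ennreal (\<mu> ^ n (j + 1)) * (ennreal ((C * s) ^ M * Z) * W)"
      unfolding s_def \<rho>_def B_def E_def W_def Z_def v_def n_def by (intro mult_left_mono Suc.IH R') auto
    finally show "W_seminorm (n (j + 1)) (n (j + 1)) (\<nu> * h) B E
       \<le> ennreal (\<mu> ^ n (j + 1)) * (ennreal ((C * s) ^ M * Z) * W)" .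
  qed auto
  also have "\<dots> = ennreal (C * (v * (s * (C * (s * \<rho>)) ^ M) + \<mu> ^ n (j + 1) * ((C * s) ^ M * Z))) * W"
    using pos C \<mu> by (simp add: ennreal_mult ennreal_plus mult.assoc distrib_left distrib_right)
  also have "C * (v * (s * (C * (s * \<rho>)) ^ M) + \<mu> ^ n (j + 1) * ((C * s) ^ M * Z))
     = (C * s) ^ Suc M * cascade_factor v \<rho> (theta k r) \<mu> (Suc M) j"
  proof -
    have "n (j + 1) = (r + 1) + theta k r (j + 1)" using rk by (auto simp: n_def theta_def)
    then have "\<mu> ^ n (j + 1) = s * \<mu> ^ theta k r (j + 1)" by (simp add: s_def power_add)
    then show ?thesis unfolding cascade_factor_Suc Z_def[symmetric]
      by (simp add: power_mult_distrib algebra_simps)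
  qed
  finally show ?case
    unfolding ml_E_Suc W_def v_def \<rho>_def s_def n_def E_def h_def
    by (simp add: radius_sum_def add_ac)
qed

text \<open>The two iterations compete, and the minimum in \<open>J\<close> selects the better one.\<close>

lemma J_decay:
  assumes R: "0 < R" and N: "0 < N"
  shows "W_seminorm (r + 1) (r + 1) (\<nu> * (\<mu> ^ N * h0)) (ball x R) (ml_E \<Phi> p \<nu> \<mu> h0 f N)
     \<le> ennreal ((\<mu> ^ N) ^ (r + 1) * J C m k r N \<nu> \<mu> ^ N)
        * W_seminorm (r + 1) k (\<nu> * h0) (ball x (R + radius_sum \<nu> \<mu> h0 N)) f"
proof -
  define Z where "Z = cascade_factor (\<nu> powi (int k - int m)) (rho m k r \<nu> \<mu>) (theta k r) \<mu> N 0"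
  have \<mu>N: "(\<mu> ^ (r + 1)) ^ N = (\<mu> ^ N) ^ (r + 1)" by (metis mult.commute power_mult)
  have J: "J C m k r N \<nu> \<mu> ^ N = C ^ N * min (rho m k r \<nu> \<mu> ^ N) Z"
    unfolding Z_def using N C \<nu> \<mu> by (intro J_power) auto
  show ?thesis
  proof (cases "rho m k r \<nu> \<mu> ^ N \<le> Z")
    case True
    have "W_seminorm (r + 1) (r + 1) (\<nu> * (\<mu> ^ N * h0)) (ball x R) (ml_E \<Phi> p \<nu> \<mu> h0 f N)
        \<le> W_seminorm (r + 1) k (\<nu> * (\<mu> ^ N * h0)) (ball x R) (ml_E \<Phi> p \<nu> \<mu> h0 f N)"
      using rk by (intro W_seminorm_mono_order) auto
    also note all_orders_decay[OF R]
    also have "(C * (\<mu> ^ (r + 1) * rho m k r \<nu> \<mu>)) ^ N = (\<mu> ^ N) ^ (r + 1) * J C m k r N \<nu> \<mu> ^ N"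
      unfolding J using True by (simp only: power_mult_distrib \<mu>N min_absorb1 mult_ac)
    finally show ?thesis .
  next
    case False
    have "min ((0 + 1) * (r + 1)) k = r + 1" using rk by simp
    moreover have "(C * \<mu> ^ (r + 1)) ^ N * Z = (\<mu> ^ N) ^ (r + 1) * J C m k r N \<nu> \<mu> ^ N"
      unfolding J using False by (simp only: power_mult_distrib \<mu>N min_absorb2 mult_ac linear not_le less_imp_le)
    ultimately show ?thesis using single_order_decay[OF R, of 0 N x] unfolding Z_def by simp
  qed
qed

end

section \<open>The error after L levels\<close>

text \<open>The local estimate in terms of the seminorm. An infinite seminorm is harmless because its
coefficient is positive.\<close>

lemma mls_E_local_Linf:
  fixes \<Phi> :: "real^'n::finite \<Rightarrow> real" and p :: "'b::finite \<Rightarrow> real^'n \<Rightarrow> real"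
  assumes "Ck m \<Phi>" "\<And>x. 1 < norm x \<Longrightarrow> \<Phi> x = 0" "poly_basis r p" "0 < \<tau>s"
    and "\<And>h \<nu> x. 0 < h \<Longrightarrow> 1 < \<nu> \<Longrightarrow> \<nu>s \<le> \<nu> \<Longrightarrow>
           \<tau>s * \<nu> ^ CARD('n) \<le> lambda_min (mls_matrix \<Phi> p \<nu> h x)"
  obtains C0 where "0 < C0"
    "\<And>h \<nu> g x \<alpha>. 0 < h \<Longrightarrow> 1 < \<nu> \<Longrightarrow> \<nu>s \<le> \<nu> \<Longrightarrow> r + 1 \<le> m \<Longrightarrow> Ck (r + 1) g \<Longrightarrow> mi_abs \<alpha> \<le> r + 1 \<Longrightarrow>
       ennreal \<bar>mi_deriv \<alpha> (mls_E \<Phi> p \<nu> h g) x\<bar>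
         \<le> ennreal (C0 / (\<nu> * h) ^ mi_abs \<alpha>) * W_seminorm (r + 1) (r + 1) (\<nu> * h) (ball x (\<nu> * h)) g"
proof (rule mls_E_local_estimate[OF assms])
  fix C0 assume C0: "0 < C0"
    "\<And>h \<nu> g x l K. 0 < h \<Longrightarrow> 1 < \<nu> \<Longrightarrow> \<nu>s \<le> \<nu> \<Longrightarrow> r + 1 \<le> m \<Longrightarrow> Ck (r + 1) g \<Longrightarrow>
       (\<And>l y. length l = r + 1 \<Longrightarrow> y \<in> ball x (\<nu> * h) \<Longrightarrow> (\<nu> * h) ^ (r + 1) * \<bar>pderivs l g y\<bar> \<le> K) \<Longrightarrow>
       length l \<le> r + 1 \<Longrightarrow> \<bar>pderivs l (mls_E \<Phi> p \<nu> h g) x\<bar> \<le> C0 / (\<nu> * h) ^ length l * K"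
  show thesis
  proof (rule that[OF C0(1)])
    fix h \<nu> :: real and g :: "real^'n \<Rightarrow> real" and x :: "real^'n" and \<alpha> :: "'n \<Rightarrow> nat"
    assume h: "0 < h" "1 < \<nu>" "\<nu>s \<le> \<nu>" and rm: "r + 1 \<le> m" and g: "Ck (r + 1) g" and \<alpha>: "mi_abs \<alpha> \<le> r + 1"
    define \<delta> where "\<delta> = \<nu> * h"
    have \<delta>: "0 < \<delta>" using h by (simp add: \<delta>_def)
    have pos: "0 < C0 / \<delta> ^ mi_abs \<alpha>" using C0(1) \<delta> by simp
    show "ennreal \<bar>mi_deriv \<alpha> (mls_E \<Phi> p \<nu> h g) x\<bar>
      \<le> ennreal (C0 / (\<nu> * h) ^ mi_abs \<alpha>) * W_seminorm (r + 1) (r + 1) (\<nu> * h) (ball x (\<nu> * h)) g"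
      unfolding \<delta>_def[symmetric]
    proof (cases "W_seminorm (r + 1) (r + 1) \<delta> (ball x \<delta>) g")
      case (real K)
      have K: "\<delta> ^ (r + 1) * \<bar>pderivs l g y\<bar> \<le> K" if l: "length l = r + 1" and y: "y \<in> ball x \<delta>" for l y
      proof -
        note D = pderivs_eq_mi_deriv[of l g, unfolded l, OF g]
        have "ennreal (\<delta> ^ (r + 1)) * ennreal \<bar>pderivs l g y\<bar> \<le> ennreal K"
          unfolding real(2)[symmetric] D(1) D(2)[symmetric] using D(2) g y by (intro le_W_seminorm) auto
        then have "ennreal (\<delta> ^ (r + 1) * \<bar>pderivs l g y\<bar>) \<le> ennreal K"
          using \<delta> by (simp add: ennreal_mult)
        then show ?thesis using real(1) by (simp only: ennreal_le_iff)
      qed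
      have "\<bar>mi_deriv \<alpha> (mls_E \<Phi> p \<nu> h g) x\<bar> \<le> C0 / \<delta> ^ mi_abs \<alpha> * K"
        using C0(2)[OF h rm g, of x K "mi_list \<alpha>"] K \<alpha> by (simp add: \<delta>_def mi_deriv_eq_pderivs length_mi_list)
      then show "ennreal \<bar>mi_deriv \<alpha> (mls_E \<Phi> p \<nu> h g) x\<bar>
          \<le> ennreal (C0 / \<delta> ^ mi_abs \<alpha>) * W_seminorm (r + 1) (r + 1) \<delta> (ball x \<delta>) g"
        unfolding real(2) using real(1) pos by (simp add: ennreal_leI flip: ennreal_mult)
    next
      case top
      then show "ennreal \<bar>mi_deriv \<alpha> (mls_E \<Phi> p \<nu> h g) x\<bar>
          \<le> ennreal (C0 / \<delta> ^ mi_abs \<alpha>) * W_seminorm (r + 1) (r + 1) \<delta> (ball x \<delta>) g"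
        using pos C0(1) \<delta> by (simp add: ennreal_mult_top)
    qed
  qed
qed

text \<open>With \<open>h = \<mu> ^ L * h0\<close> and \<open>\<delta> = \<nu> * h\<close>, the pointwise bound for derivatives of order \<open>s\<close> carries the
factor \<open>(h / h0) ^ (r + 1) / \<delta> ^ s\<close>. For \<open>s = 0\<close> this is the first claim. For \<open>s \<le> r + 1\<close> the
factor is at most \<open>1 / h0 ^ (r + 1)\<close>, because \<open>h < 1\<close> and \<open>h \<le> \<delta>\<close> give \<open>h ^ (r + 1) \<le> \<delta> ^ s\<close>;
this is the second claim.\<close>

theorem theorem3p4:
  fixes \<Phi> :: "real^'n::finite \<Rightarrow> real"
    and p :: "'b::finite \<Rightarrow> real^'n \<Rightarrow> real"
    and m r :: nat
    and \<nu>s \<tau>s :: real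
  assumes "Ck m \<Phi>"
    and "\<And>x. 0 \<le> \<Phi> x"
    and "\<exists>x. \<Phi> x \<noteq> 0"
    and "closure {x. \<Phi> x \<noteq> 0} \<subseteq> cball 0 1"
    and "poly_basis r p"
    and "0 < \<nu>s" and "0 < \<tau>s"
    and "\<And>h \<nu> x. 0 < h \<Longrightarrow> 1 < \<nu> \<Longrightarrow> \<nu>s \<le> \<nu> \<Longrightarrow>
           \<tau>s * \<nu> ^ CARD('n) \<le> lambda_min (mls_matrix \<Phi> p \<nu> h x)"
  shows "\<exists>C0>0. \<forall>(k::nat) (C::real) (\<Omega>::(real^'n) set) (h0::real) (\<mu>::real) (\<nu>::real) (L::nat) f.
           r < k \<longrightarrow> k < m \<longrightarrow> 0 < C \<longrightarrow> single_level_const \<Phi> p m r k \<nu>s C \<longrightarrow>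
           open \<Omega> \<longrightarrow> bounded \<Omega> \<longrightarrow> \<Omega> \<noteq> {} \<longrightarrow>
           0 < h0 \<longrightarrow> 0 < \<mu> \<longrightarrow> \<mu> < 1 \<longrightarrow> 1 < \<nu> \<longrightarrow> \<nu>s \<le> \<nu> \<longrightarrow> 2 \<le> L \<longrightarrow> Ck k f \<longrightarrow>
             Linf_norm \<Omega> (ml_E \<Phi> p \<nu> \<mu> h0 f L)
               \<le> ennreal (C0 / h0 ^ (r + 1) * J C m k r (L - 1) \<nu> \<mu> ^ (L - 1) * (\<mu> ^ L * h0) ^ (r + 1))
                 * W_seminorm (r + 1) k (\<nu> * h0) (nbhd (radius_sum \<nu> \<mu> h0 L) \<Omega>) f
           \<and> (Lipschitz_domain \<Omega> \<longrightarrow> \<mu> ^ L * h0 < 1 \<longrightarrow>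
             W_norm (r + 1) \<Omega> (ml_E \<Phi> p \<nu> \<mu> h0 f L)
               \<le> ennreal (C0 / h0 ^ (r + 1) * J C m k r (L - 1) \<nu> \<mu> ^ (L - 1))
                 * W_seminorm (r + 1) k (\<nu> * h0) (nbhd (radius_sum \<nu> \<mu> h0 L) \<Omega>) f)"
proof -
  have supp: "\<Phi> x = 0" if "1 < norm x" for x
    using assms(4) closure_subset[of "{x. \<Phi> x \<noteq> 0}"] that by fastforce
  obtain C0 where C0: "0 < C0"
    "\<And>h \<nu> g x \<alpha>. 0 < h \<Longrightarrow> 1 < \<nu> \<Longrightarrow> \<nu>s \<le> \<nu> \<Longrightarrow> r + 1 \<le> m \<Longrightarrow> Ck (r + 1) g \<Longrightarrow> mi_abs \<alpha> \<le> r + 1 \<Longrightarrow>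
       ennreal \<bar>mi_deriv \<alpha> (mls_E \<Phi> p \<nu> h g) x\<bar>
         \<le> ennreal (C0 / (\<nu> * h) ^ mi_abs \<alpha>) * W_seminorm (r + 1) (r + 1) (\<nu> * h) (ball x (\<nu> * h)) g"
    by (rule mls_E_local_Linf[OF assms(1) supp assms(5,7,8)]) (assumption | blast)+
  show ?thesis
  proof (intro exI[of _ C0] conjI C0(1) allI impI)
    fix k :: nat and C :: real and \<Omega> :: "(real^'n) set" and h0 \<mu> \<nu> :: real and L :: nat and f :: "real^'n \<Rightarrow> real"
    assume km: "r < k" "k < m" and C: "0 < C" and single: "single_level_const \<Phi> p m r k \<nu>s C"
      and \<Omega>: "open \<Omega>" and h0: "0 < h0" and \<mu>: "0 < \<mu>" "\<mu> < 1" and \<nu>: "1 < \<nu>" "\<nu>s \<le> \<nu>"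
      and L: "2 \<le> L" and f: "Ck k f"
    define N where "N = L - 1"
    have N: "L = Suc N" "0 < N" using L by (auto simp: N_def)
    define h where "h = \<mu> ^ L * h0"
    have h: "0 < h" using h0 \<mu> by (simp add: h_def)
    define \<delta> where "\<delta> = \<nu> * h"
    have \<delta>: "0 < \<delta>" "h \<le> \<delta>" using h \<nu> by (auto simp: \<delta>_def)
    define E where "E = ml_E \<Phi> p \<nu> \<mu> h0 f"
    define X where "X = W_seminorm (r + 1) k (\<nu> * h0) (nbhd (radius_sum \<nu> \<mu> h0 L) \<Omega>) f"
    define JN where "JN = J C m k r N \<nu> \<mu> ^ N"
    have JN: "0 \<le> JN" unfolding JN_def using J_power(2)[of N C \<nu> \<mu> m k r] N C \<nu> \<mu> by simp
    have CE: "Ck k (E j)" for j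
    proof (induction j)
      case (Suc j)
      then show ?case unfolding E_def ml_E_Suc
        using h0 \<mu> \<nu> km by (intro Ck_mls_E[OF assms(1) supp assms(5,7,8)]) auto
    qed (simp add: E_def f)
    have cont: "continuous_on UNIV (mi_deriv \<alpha> (E L))" if "mi_abs \<alpha> \<le> r + 1" for \<alpha>
      using mi_deriv_continuous[OF CE] that km by simp
    have pointwise: "ennreal \<bar>mi_deriv \<alpha> (E L) x\<bar> \<le> ennreal (C0 / \<delta> ^ mi_abs \<alpha> * ((\<mu> ^ L) ^ (r + 1) * JN)) * X"
      if \<alpha>: "mi_abs \<alpha> \<le> r + 1" and x: "x \<in> \<Omega>" for \<alpha> x
    proof -
      have nb: "nbhd (radius_sum \<nu> \<mu> h0 L) \<Omega> = (\<Union>y\<in>\<Omega>. ball y (radius_sum \<nu> \<mu> h0 L))"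
        by (auto simp: nbhd_def dist_norm norm_minus_commute)
      have radius: "\<delta> + radius_sum \<nu> \<mu> h0 N = radius_sum \<nu> \<mu> h0 L"
        by (simp add: radius_sum_def N(1) \<delta>_def h_def)
      have "ennreal \<bar>mi_deriv \<alpha> (E L) x\<bar>
          \<le> ennreal (C0 / \<delta> ^ mi_abs \<alpha>) * W_seminorm (r + 1) (r + 1) \<delta> (ball x \<delta>) (E N)"
        using C0(2)[OF h \<nu> _ Ck_mono[OF CE[of N]] \<alpha>] km
        unfolding E_def N(1) ml_E_Suc \<delta>_def h_def by simp
      also have "\<dots> \<le> ennreal (C0 / \<delta> ^ mi_abs \<alpha>) * (ennreal (\<mu> ^ (r + 1)) * (ennreal ((\<mu> ^ N) ^ (r + 1) * JN) * X))"
      proof (intro mult_left_mono)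
        have scale: "\<delta> = \<mu> * (\<nu> * (\<mu> ^ N * h0))" by (simp add: \<delta>_def h_def N(1))
        have "W_seminorm (r + 1) (r + 1) \<delta> (ball x \<delta>) (E N)
            \<le> ennreal (\<mu> ^ (r + 1)) * W_seminorm (r + 1) (r + 1) (\<nu> * (\<mu> ^ N * h0)) (ball x \<delta>) (E N)"
          unfolding scale using \<mu> \<nu> h0 by (intro W_seminorm_scale) auto
        also have "\<dots> \<le> ennreal (\<mu> ^ (r + 1)) * (ennreal ((\<mu> ^ N) ^ (r + 1) * JN)
            * W_seminorm (r + 1) k (\<nu> * h0) (ball x (radius_sum \<nu> \<mu> h0 L)) f)"
          unfolding radius[symmetric] JN_def E_def
          by (intro mult_left_mono J_decay[where \<nu>s = \<nu>s] CE[unfolded E_def] single km C h0 \<mu> \<nu> \<delta>(1) N(2)) auto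
        also have "\<dots> \<le> ennreal (\<mu> ^ (r + 1)) * (ennreal ((\<mu> ^ N) ^ (r + 1) * JN) * X)"
          unfolding X_def nb using x by (intro mult_left_mono W_seminorm_mono_domain f) auto
        finally show "W_seminorm (r + 1) (r + 1) \<delta> (ball x \<delta>) (E N)
            \<le> ennreal (\<mu> ^ (r + 1)) * (ennreal ((\<mu> ^ N) ^ (r + 1) * JN) * X)" .
      qed auto
      also have "\<dots> = ennreal (C0 / \<delta> ^ mi_abs \<alpha> * (\<mu> ^ (r + 1) * ((\<mu> ^ N) ^ (r + 1) * JN))) * X"
      proof -
        have "ennreal a * (ennreal b * (ennreal c * X)) = ennreal (a * (b * c)) * X"
          if "0 \<le> a" "0 \<le> b" "0 \<le> c" for a b c
          using that by (simp add: ennreal_mult mult.assoc)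
        then show ?thesis using C0(1) \<delta> \<mu> JN by simp
      qed
      also have "\<mu> ^ (r + 1) * ((\<mu> ^ N) ^ (r + 1) * JN) = (\<mu> ^ L) ^ (r + 1) * JN"
        unfolding N(1) by (simp add: power_mult_distrib)
      finally show ?thesis .
    qed
    show "Linf_norm \<Omega> (ml_E \<Phi> p \<nu> \<mu> h0 f L)
       \<le> ennreal (C0 / h0 ^ (r + 1) * J C m k r (L - 1) \<nu> \<mu> ^ (L - 1) * (\<mu> ^ L * h0) ^ (r + 1))
         * W_seminorm (r + 1) k (\<nu> * h0) (nbhd (radius_sum \<nu> \<mu> h0 L) \<Omega>) f"
    proof -
      have 0: "mi_deriv (\<lambda>i. 0) g = g" for g :: "real^'n \<Rightarrow> real"
      proof -
        have "length (mi_list (\<lambda>i::'n. 0)) = 0" unfolding length_mi_list by (simp add: mi_abs_def)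
        then show ?thesis by (simp add: mi_deriv_eq_pderivs)
      qed
      have "Linf_norm \<Omega> (E L) \<le> ennreal (C0 * ((\<mu> ^ L) ^ (r + 1) * JN)) * X"
        using pointwise[of "\<lambda>i. 0"] cont[of "\<lambda>i. 0"]
        by (intro Linf_norm_leI \<Omega>) (simp_all add: 0 mi_abs_def)
      also have "C0 * ((\<mu> ^ L) ^ (r + 1) * JN) = C0 / h0 ^ (r + 1) * JN * (\<mu> ^ L * h0) ^ (r + 1)"
        using h0 by (simp only: power_mult_distrib) (simp add: field_simps)
      finally show ?thesis unfolding E_def X_def JN_def N_def .
    qed
    assume small: "\<mu> ^ L * h0 < 1"
    show "W_norm (r + 1) \<Omega> (ml_E \<Phi> p \<nu> \<mu> h0 f L)
       \<le> ennreal (C0 / h0 ^ (r + 1) * J C m k r (L - 1) \<nu> \<mu> ^ (L - 1))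
         * W_seminorm (r + 1) k (\<nu> * h0) (nbhd (radius_sum \<nu> \<mu> h0 L) \<Omega>) f"
      unfolding W_norm_def
    proof (rule SUP_least)
      fix \<alpha> :: "'n \<Rightarrow> nat" assume "\<alpha> \<in> {\<alpha>. mi_abs \<alpha> \<le> r + 1}"
      then have \<alpha>: "mi_abs \<alpha> \<le> r + 1" by simp
      have "h ^ (r + 1) \<le> h ^ mi_abs \<alpha>"
        using h small \<alpha> by (intro power_decreasing) (auto simp: h_def)
      also have "\<dots> \<le> \<delta> ^ mi_abs \<alpha>" using h \<delta> by (intro power_mono) auto
      finally have "(\<mu> ^ L) ^ (r + 1) / \<delta> ^ mi_abs \<alpha> \<le> 1 / h0 ^ (r + 1)"
        using \<delta> h0 unfolding h_def power_mult_distrib by (simp only: divide_le_eq le_divide_eq zero_less_power) (simp add: field_simps)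
      then have "C0 * JN * ((\<mu> ^ L) ^ (r + 1) / \<delta> ^ mi_abs \<alpha>) \<le> C0 * JN * (1 / h0 ^ (r + 1))"
        using C0(1) JN by (intro mult_left_mono) auto
      then have coeff: "C0 / \<delta> ^ mi_abs \<alpha> * ((\<mu> ^ L) ^ (r + 1) * JN) \<le> C0 / h0 ^ (r + 1) * JN"
        by (simp add: mult_ac)
      have "Linf_norm \<Omega> (mi_deriv \<alpha> (E L)) \<le> ennreal (C0 / \<delta> ^ mi_abs \<alpha> * ((\<mu> ^ L) ^ (r + 1) * JN)) * X"
        by (rule Linf_norm_leI[OF \<Omega> cont[OF \<alpha>] pointwise[OF \<alpha>]])
      also have "\<dots> \<le> ennreal (C0 / h0 ^ (r + 1) * JN) * X"
        by (intro mult_right_mono ennreal_leI coeff) auto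
      finally show "Linf_norm \<Omega> (mi_deriv \<alpha> (ml_E \<Phi> p \<nu> \<mu> h0 f L))
         \<le> ennreal (C0 / h0 ^ (r + 1) * J C m k r (L - 1) \<nu> \<mu> ^ (L - 1))
           * W_seminorm (r + 1) k (\<nu> * h0) (nbhd (radius_sum \<nu> \<mu> h0 L) \<Omega>) f"
        unfolding E_def X_def JN_def N_def .
    qed
  qed
qed

end
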